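(* Let $T=S^1\times S^1$ be the torus and $f:T\to\mathbb{R}^3$ a smooth embedding. Then there exist a basis of $H_1(T;\mathbb{Z})\cong\mathbb{Z}^2$ and a sign $\epsilon\in\{+1,-1\}$ such that, writing elements in this basis as $(x,y)$, $L(f)((x_1,y_1),(x_2,y_2))=\epsilon\, x_1y_2$ for all $(x_1,y_1),(x_2,y_2)\in H_1(T;\mathbb{Z})$.
   Context: Orientations on $T$ and on $\mathbb{R}^3$ are fixed. For a smooth embedding $f:T\to\mathbb{R}^3$, a shift $\overline f$ of $f$ is defined by $\overline f(x)=f(x)+\varepsilon n(x)$, where $n(x)$ is a vector normal to $f(T)$ at $f(x)$ such that (the orientation of $T_xT$ pushed forward by $df$, followed by $n(x)$) agrees with the orientation of $\mathbb{R}^3$, and $\varepsilon>0$ is small. For integer 1-cycles $b,c$ on $T$, $L(f)(b,c)$ is the linking number in $\mathbb{R}^3$ of $f|_b$ and $\overline f|_c$; this gives the Seifert form $L(f)$ on $H_1(T;\mathbb{Z})$. *)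

theory Defs
  imports "HOL-Analysis.Analysis"
begin

text \<open>The torus T = S^1 x S^1 is modelled as R^2 / Z^2. A map T -> R^3 is a map
  f :: real x real -> real^3 that is 1-periodic in both variables. The orientation of T
  is the one induced by the coordinates (s,t); the orientation of R^3 is the standard one.\<close>

coinductive smooth_map :: "('a::real_normed_vector \<Rightarrow> 'b::real_normed_vector) \<Rightarrow> bool" where
  "(\<forall>x. f differentiable (at x)) \<Longrightarrow>
   (\<forall>v. smooth_map (\<lambda>x. frechet_derivative f (at x) v)) \<Longrightarrow> smooth_map f"

definition torus_periodic :: "(real \<times> real \<Rightarrow> 'b) \<Rightarrow> bool" where
  "torus_periodic f \<longleftrightarrow> (\<forall>s t. f (s + 1, t) = f (s, t) \<and> f (s, t + 1) = f (s, t))"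

definition d_s :: "(real \<times> real \<Rightarrow> real^3) \<Rightarrow> real \<times> real \<Rightarrow> real^3" where
  "d_s f p = frechet_derivative f (at p) (1, 0)"

definition d_t :: "(real \<times> real \<Rightarrow> real^3) \<Rightarrow> real \<times> real \<Rightarrow> real^3" where
  "d_t f p = frechet_derivative f (at p) (0, 1)"

text \<open>Smooth embedding of the torus: smooth, doubly periodic, injective on the quotient
  R^2/Z^2, and an immersion (the two partial derivatives are linearly independent).
  Since T is compact, an injective immersion is an embedding.\<close>
definition torus_smooth_embedding :: "(real \<times> real \<Rightarrow> real^3) \<Rightarrow> bool" where
  "torus_smooth_embedding f \<longleftrightarrow>
     smooth_map f \<and> torus_periodic f \<and>
     (\<forall>s t s' t'. f (s, t) = f (s', t') \<longrightarrow> s - s' \<in> \<int> \<and> t - t' \<in> \<int>) \<and>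
     (\<forall>p. cross3 (d_s f p) (d_t f p) \<noteq> 0)"

text \<open>Unit normal n(x): (df e_s, df e_t, n) is positively oriented in R^3.\<close>
definition unit_normal :: "(real \<times> real \<Rightarrow> real^3) \<Rightarrow> real \<times> real \<Rightarrow> real^3" where
  "unit_normal f p = (1 / norm (cross3 (d_s f p) (d_t f p))) *\<^sub>R cross3 (d_s f p) (d_t f p)"

definition shift :: "(real \<times> real \<Rightarrow> real^3) \<Rightarrow> real \<Rightarrow> real \<times> real \<Rightarrow> real^3" where
  "shift f eps p = f p + eps *\<^sub>R unit_normal f p"

text \<open>Gauss linking integral of two closed C^1 curves parametrised on [0,1].\<close>
definition linking_number :: "(real \<Rightarrow> real^3) \<Rightarrow> (real \<Rightarrow> real^3) \<Rightarrow> real" where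
  "linking_number g h =
     (1 / (4 * pi)) *
     integral (cbox (0, 0) (1, 1))
       (\<lambda>(u, v). ((g u - h v) \<bullet> cross3 (vector_derivative g (at u)) (vector_derivative h (at v)))
                 / norm (g u - h v) ^ 3)"

text \<open>H_1(T;Z) = Z^2, the class (a,b) being represented by the integer 1-cycle
  u |-> (a u, b u) mod Z^2, u in [0,1].\<close>
definition torus_loop :: "int \<times> int \<Rightarrow> real \<Rightarrow> real \<times> real" where
  "torus_loop c u = (of_int (fst c) * u, of_int (snd c) * u)"

definition seifert_lk :: "(real \<times> real \<Rightarrow> real^3) \<Rightarrow> real \<Rightarrow> int \<times> int \<Rightarrow> int \<times> int \<Rightarrow> real" where
  "seifert_lk f eps b c = linking_number (f \<circ> torus_loop b) (shift f eps \<circ> torus_loop c)"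

end

theory Submission
  imports Defs
begin

text \<open>
  Away from a closed curve its Biot--Savart field is closed, and its periods are linking numbers. Pulling
  these fields back to a collar \<open>\<real>\<^sup>2 \<times> (-\<delta>, \<delta>)\<close> of the torus shows that the linking numbers of pushed-off
  loops are given by a real bilinear form \<open>M\<close> on \<open>\<int>\<^sup>2\<close> that does not depend on the levels.

  \<open>M\<close> is integral: on a fine periodic grid the Gauss integral is a sum of solid angles of small triangles. Half
  the solid angle is the argument of a product of three link phases between spinors, and these phases cancel
  over the closed grid.

  The antisymmetric part of \<open>M\<close> is the intersection form up to sign, since the Gauss integral jumps by \<open>4\<pi>\<close>
  when two strands cross.

  \<open>det M = 0\<close>: let \<open>B\<^sub>1, B\<^sub>2\<close> be the fields of two generators pushed to one side of the torus, and let \<open>U\<close> vanish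
  near these loops and have its gradient supported in the collar on the other side of them. Then \<open>div (U B\<^sub>1 \<times> B\<^sub>2) = \<nabla>U \<cdot> (B\<^sub>1 \<times> B\<^sub>2)\<close> integrates to 0 by decay, while in collar
  coordinates the integral is the determinant of the periods by the Riemann bilinear relation.

  An integral matrix of rank one with \<open>M\<^sub>1\<^sub>2 - M\<^sub>2\<^sub>1 = \<plusminus>1\<close> is the product of a column and a row that
  together form a basis of \<open>\<int>\<^sup>2\<close>.
\<close>

subsection \<open>Functions of class C^k\<close>

text \<open>Linking numbers are given here by an integral, so the homological input has to be
  recovered from analysis. The determinant condition stands in for the fact that passing to either
  side of the torus kills a rank-one part of its first homology. It is obtained without knowing
  which side is bounded: the cutoff \<open>U\<close> only has to be bounded, because the product of
  the two fields decays like the inverse fourth power of the distance. Rank one and the jump alone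
  would give a basis of the real plane; integrality makes it a basis of the lattice, and for its
  sake the Gauss integral is discretised. The jump is not read off from a degree but computed: near
  their crossing the two strands are compared with two orthogonal lines, whose Gauss integral over a
  square is elementary. Since the positive normal puts the pushed-off cycle above the other one,
  \<open>seifert_lk\<close> is the transpose of the matrix studied here, and this decides which
  basis vector kills which factor.\<close>

primrec ck :: "nat \<Rightarrow> ('a::real_normed_vector \<Rightarrow> 'b::real_normed_vector) \<Rightarrow> bool" where
  "ck 0 f \<longleftrightarrow> continuous_on UNIV f"
| "ck (Suc k) f \<longleftrightarrow> (\<forall>x. f differentiable (at x)) \<and> (\<forall>v. ck k (\<lambda>x. frechet_derivative f (at x) v))"

text \<open>Finite orders admit induction on \<open>k\<close>: the derivative of a sum, product or
  quotient is built from functions available one order lower. \<open>ck\<close> speaks of each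
  directional derivative separately, so that no operator norm enters.\<close>

lemma smooth_map_ck: "smooth_map f \<Longrightarrow> ck k f"
proof (induction k arbitrary: f)
  case 0
  then show ?case
    by (auto elim!: smooth_map.cases simp: continuous_on_eq_continuous_at differentiable_imp_continuous_within)
next
  case (Suc k)
  from Suc.prems show ?case
    by (cases rule: smooth_map.cases) (auto intro: Suc.IH)
qed

lemma ck_SucI:
  assumes "\<And>x. (f has_derivative f' x) (at x)" "\<And>v. ck k (\<lambda>x. f' x v)"
  shows "ck (Suc k) f"
proof -
  have "frechet_derivative f (at x) = f' x" for x
    using assms(1) frechet_derivative_at by metis
  then show ?thesis
    using assms by (auto simp: differentiable_def)
qed

lemma ck_Suc_has_derivative:
  "ck (Suc k) f \<Longrightarrow> (f has_derivative frechet_derivative f (at x)) (at x)"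
  by (simp add: frechet_derivative_works)

lemma ck_Suc_derivative: "ck (Suc k) f \<Longrightarrow> ck k (\<lambda>x. frechet_derivative f (at x) v)"
  by simp

lemma ck_continuous: "ck k f \<Longrightarrow> continuous_on UNIV f"
  by (cases k) (auto simp: continuous_on_eq_continuous_at differentiable_imp_continuous_within)

lemma ck_Suc_imp: "ck (Suc k) f \<Longrightarrow> ck k f"
proof (induction k arbitrary: f)
  case 0
  then show ?case using ck_continuous[OF 0] by simp
next
  case (Suc k)
  then show ?case by (metis ck.simps(2))
qed

lemma ck_const: "ck k (\<lambda>x. c)"
proof (induction k arbitrary: c)
  case (Suc k)
  show ?case by (rule ck_SucI[where f'="\<lambda>_ _. 0"]) (auto intro: Suc)
qed simp

lemma ck_add: "ck k f \<Longrightarrow> ck k g \<Longrightarrow> ck k (\<lambda>x. f x + g x)"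
proof (induction k arbitrary: f g)
  case (Suc k)
  show ?case
    by (rule ck_SucI[where f'="\<lambda>x v. frechet_derivative f (at x) v + frechet_derivative g (at x) v"])
      (use Suc in \<open>auto intro!: has_derivative_add simp: frechet_derivative_works\<close>)
qed (auto intro: continuous_intros)

lemma (in bounded_linear) ck_compose: "ck k g \<Longrightarrow> ck k (\<lambda>x. f (g x))"
proof (induction k arbitrary: g)
  case 0
  then show ?case by (auto intro: continuous_on)
next
  case (Suc k)
  show ?case
    by (rule ck_SucI[where f'="\<lambda>x v. f (frechet_derivative g (at x) v)"])
      (use Suc in \<open>auto intro!: has_derivative simp: frechet_derivative_works\<close>)
qed

lemma ck_compose_linear:
  assumes "bounded_linear A"
  shows "ck k f \<Longrightarrow> ck k (\<lambda>x. f (A x))"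
proof (induction k arbitrary: f)
  case 0
  then show ?case
    using continuous_on_compose2[of UNIV f UNIV A] linear_continuous_on[OF assms] by auto
next
  case (Suc k)
  show ?case
  proof (rule ck_SucI[where f'="\<lambda>x v. frechet_derivative f (at (A x)) (A v)"])
    fix x
    have "(f has_derivative frechet_derivative f (at (A x))) (at (A x))"
      using Suc.prems ck_Suc_has_derivative by blast
    then show "((\<lambda>x. f (A x)) has_derivative (\<lambda>v. frechet_derivative f (at (A x)) (A v))) (at x)"
      by (rule has_derivative_compose[OF bounded_linear_imp_has_derivative[OF assms]])
  next
    fix v
    show "ck k (\<lambda>x. frechet_derivative f (at (A x)) (A v))"
      using Suc.IH[OF ck_Suc_derivative[OF Suc.prems, of "A v"]] .
  qed
qed

lemma ck_linear:
  assumes "bounded_linear A"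
  shows "ck k A"
proof (cases k)
  case 0
  then show ?thesis using linear_continuous_on[OF assms] by simp
next
  case (Suc j)
  show ?thesis unfolding Suc
    by (rule ck_SucI[where f'="\<lambda>x v. A v"])
      (auto intro: ck_const bounded_linear_imp_has_derivative assms)
qed

lemma ck_bilinear:
  assumes "bounded_bilinear p"
  shows "ck k f \<Longrightarrow> ck k g \<Longrightarrow> ck k (\<lambda>x. p (f x) (g x))"
proof (induction k arbitrary: f g)
  case 0
  then show ?case by (auto intro: bounded_bilinear.continuous_on[OF assms])
next
  case (Suc k)
  note 1 = ck_Suc_imp[OF Suc.prems(1)] and 2 = ck_Suc_imp[OF Suc.prems(2)]
  show ?case
    by (rule ck_SucI[where f'="\<lambda>x v. p (f x) (frechet_derivative g (at x) v) + p (frechet_derivative f (at x) v) (g x)"])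
      (use Suc 1 2 in \<open>auto intro!: bounded_bilinear.FDERIV[OF assms] ck_add simp: frechet_derivative_works\<close>)
qed

lemma ck_inverse:
  fixes g :: "'a::real_normed_vector \<Rightarrow> real"
  assumes "\<And>x. g x \<noteq> 0"
  shows "ck k g \<Longrightarrow> ck k (\<lambda>x. inverse (g x))"
proof (induction k)
  case 0
  then show ?case using assms by (auto intro: continuous_intros)
next
  case (Suc k)
  note IH = Suc.IH[OF ck_Suc_imp[OF Suc.prems]]
  show ?case
  proof (rule ck_SucI[where f'="\<lambda>x v. - (inverse (g x) * frechet_derivative g (at x) v * inverse (g x))"])
    fix x
    show "((\<lambda>x. inverse (g x)) has_derivative (\<lambda>v. - (inverse (g x) * frechet_derivative g (at x) v * inverse (g x)))) (at x)"
      using Deriv.has_derivative_inverse[OF assms ck_Suc_has_derivative[OF Suc.prems]] .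
  next
    fix v
    show "ck k (\<lambda>x. - (inverse (g x) * frechet_derivative g (at x) v * inverse (g x)))"
      by (intro bounded_linear.ck_compose[OF bounded_linear_minus[OF bounded_linear_ident]]
          ck_bilinear[OF bounded_bilinear_mult] IH ck_Suc_derivative Suc.prems)
  qed
qed

text \<open>The derivative contains the inverse of the norm itself, which has order \<open>k\<close>
  by the induction hypothesis and \<open>ck_inverse\<close>.\<close>

lemma ck_norm:
  fixes g :: "'a::real_normed_vector \<Rightarrow> 'b::real_inner"
  assumes "\<And>x. g x \<noteq> 0"
  shows "ck k g \<Longrightarrow> ck k (\<lambda>x. norm (g x))"
proof (induction k)
  case 0
  then show ?case by (auto intro: continuous_intros)
next
  case (Suc k)
  note IH = Suc.IH[OF ck_Suc_imp[OF Suc.prems]]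
  show ?case
  proof (rule ck_SucI[where f'="\<lambda>x v. (g x \<bullet> frechet_derivative g (at x) v) * inverse (norm (g x))"])
    fix x
    have "((\<lambda>x. norm (g x)) has_derivative (\<lambda>v. frechet_derivative g (at x) v \<bullet> sgn (g x))) (at x)"
      using has_derivative_compose[OF ck_Suc_has_derivative[OF Suc.prems] has_derivative_norm[OF assms]] .
    then show "((\<lambda>x. norm (g x)) has_derivative (\<lambda>v. (g x \<bullet> frechet_derivative g (at x) v) * inverse (norm (g x)))) (at x)"
      by (simp add: sgn_div_norm inner_commute mult.commute)
  next
    fix v
    show "ck k (\<lambda>x. (g x \<bullet> frechet_derivative g (at x) v) * inverse (norm (g x)))"
      by (intro ck_bilinear[OF bounded_bilinear_mult] ck_bilinear[OF bounded_bilinear_inner]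
          ck_inverse IH ck_Suc_imp[OF Suc.prems] ck_Suc_derivative Suc.prems) (use assms in auto)
  qed
qed

lemma bounded_bilinear_cross3: "bounded_bilinear cross3"
  by (simp add: bilinear_conv_bounded_bilinear[symmetric] bilinear_cross)

lemma ck_has_vector_derivative_line:
  assumes "ck (Suc k) f"
  shows "((\<lambda>u. f (x + u *\<^sub>R b)) has_vector_derivative frechet_derivative f (at (x + u *\<^sub>R b)) b) (at u within S)"
proof -
  let ?D = "frechet_derivative f (at (x + u *\<^sub>R b))"
  have D: "(f has_derivative ?D) (at (x + u *\<^sub>R b))"
    using assms ck_Suc_has_derivative by blast
  have "((\<lambda>u. f (x + u *\<^sub>R b)) has_derivative (\<lambda>h. ?D (h *\<^sub>R b))) (at u within S)"
    by (rule has_derivative_compose[where f="\<lambda>u. x + u *\<^sub>R b", OF _ D]) (auto intro!: derivative_eq_intros)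
  then show ?thesis
    by (simp add: has_vector_derivative_def linear_cmul[OF has_derivative_linear[OF D]])
qed

lemma ck_line:
  assumes "ck k f"
  shows "continuous_on S (\<lambda>u. f (x + u *\<^sub>R b))"
  by (rule continuous_on_compose2[OF ck_continuous[OF assms]]) (auto intro!: continuous_intros)

text \<open>Differentiating \<open>f(x + sa + tb) = f(x + tb) + \<integral>\<^sub>0\<^sup>s D\<^sub>a f(x + \<sigma>a + tb) d\<sigma>\<close> first in \<open>t\<close> and then in \<open>s\<close>.\<close>
lemma ck_symmetric:
  fixes f :: "'a::real_normed_vector \<Rightarrow> 'b::euclidean_space"
  assumes f: "ck (Suc (Suc k)) f"
  shows "frechet_derivative (\<lambda>x. frechet_derivative f (at x) a) (at x) b
       = frechet_derivative (\<lambda>x. frechet_derivative f (at x) b) (at x) a"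
proof -
  let ?Da = "\<lambda>x. frechet_derivative f (at x) a" and ?Db = "\<lambda>x. frechet_derivative f (at x) b"
  let ?Dba = "\<lambda>x. frechet_derivative ?Da (at x) b"
  have Da: "ck (Suc k) ?Da" and Db: "ck (Suc k) ?Db" and f1: "ck (Suc k) f"
    using f ck_Suc_derivative ck_Suc_imp by blast+
  have Dba: "ck k ?Dba" using ck_Suc_derivative[OF Da] .
  have eq1: "integral (cbox 0 s) (\<lambda>\<sigma>. ?Da ((x + t *\<^sub>R b) + \<sigma> *\<^sub>R a)) = f ((x + t *\<^sub>R b) + s *\<^sub>R a) - f (x + t *\<^sub>R b)"
    if "s \<ge> 0" for s t
    using fundamental_theorem_of_calculus[of 0 s "\<lambda>u. f ((x + t *\<^sub>R b) + u *\<^sub>R a)", OF that ck_has_vector_derivative_line[OF f1]]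
    by (auto intro: integral_unique)
  have eq2: "integral (cbox 0 s) (\<lambda>\<sigma>. ?Dba (x + \<sigma> *\<^sub>R a)) = ?Db (x + s *\<^sub>R a) - ?Db x"
    if "s \<ge> 0" for s
  proof -
    have "((\<lambda>t. integral (cbox 0 s) (\<lambda>\<sigma>. ?Da ((x + t *\<^sub>R b) + \<sigma> *\<^sub>R a))) has_vector_derivative
        integral (cbox 0 s) (\<lambda>\<sigma>. ?Dba ((x + 0 *\<^sub>R b) + \<sigma> *\<^sub>R a))) (at 0 within UNIV)"
    proof (rule leibniz_rule_vector_derivative)
      fix t \<sigma> :: real
      show "((\<lambda>t. ?Da (x + t *\<^sub>R b + \<sigma> *\<^sub>R a)) has_vector_derivative ?Dba (x + t *\<^sub>R b + \<sigma> *\<^sub>R a)) (at t within UNIV)"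
        using ck_has_vector_derivative_line[OF Da, of "x + \<sigma> *\<^sub>R a" b t UNIV] by (simp add: algebra_simps)
    next
      fix t :: real
      show "(\<lambda>\<sigma>. ?Da (x + t *\<^sub>R b + \<sigma> *\<^sub>R a)) integrable_on cbox 0 s"
        by (intro integrable_continuous ck_line[OF Da])
    next
      show "continuous_on (UNIV \<times> cbox 0 s) (\<lambda>(t, \<sigma>). ?Dba (x + t *\<^sub>R b + \<sigma> *\<^sub>R a))"
        unfolding case_prod_beta
        by (rule continuous_on_compose2[OF ck_continuous[OF Dba]]) (auto intro!: continuous_intros)
    qed auto
    moreover have "((\<lambda>t. integral (cbox 0 s) (\<lambda>\<sigma>. ?Da ((x + t *\<^sub>R b) + \<sigma> *\<^sub>R a))) has_vector_derivative
       ?Db (x + s *\<^sub>R a) - ?Db x) (at 0 within UNIV)"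
      unfolding eq1[OF that]
      using ck_has_vector_derivative_line[OF f1, of "x + s *\<^sub>R a" b 0 UNIV] ck_has_vector_derivative_line[OF f1, of x b 0 UNIV]
      by (auto intro!: derivative_eq_intros simp: algebra_simps)
    ultimately show ?thesis
      by (auto dest: vector_derivative_unique_at)
  qed
  \<comment> \<open>The integral formula is known for \<open>s \<ge> 0\<close> only, so both
    derivatives at 0 are taken from the right; they agree because 0 is a limit point of
    \<open>{0..1}\<close>.\<close>
  have "((\<lambda>s. ?Db (x + s *\<^sub>R a) - ?Db x) has_vector_derivative ?Dba (x + 0 *\<^sub>R a)) (at 0 within {0..1})"
  proof (rule has_vector_derivative_transform)
    show "((\<lambda>s. integral {0..s} (\<lambda>\<sigma>. ?Dba (x + \<sigma> *\<^sub>R a))) has_vector_derivative ?Dba (x + 0 *\<^sub>R a)) (at 0 within {0..1})"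
      by (rule integral_has_vector_derivative) (auto intro: ck_line[OF Dba])
  qed (use eq2 in auto)
  moreover have "((\<lambda>s. ?Db (x + s *\<^sub>R a) - ?Db x) has_vector_derivative frechet_derivative ?Db (at (x + 0 *\<^sub>R a)) a) (at 0 within {0..1})"
    using ck_has_vector_derivative_line[OF Db, of x a 0 "{0..1}"] by (auto intro!: derivative_eq_intros)
  moreover have "at 0 within {0..1::real} \<noteq> bot"
    by (simp add: trivial_limit_within islimpt_Icc)
  ultimately have "?Dba (x + 0 *\<^sub>R a) = frechet_derivative ?Db (at (x + 0 *\<^sub>R a)) a"
    by (intro vector_derivative_unique_within)
  then show ?thesis by simp
qed

subsection \<open>Potentials of closed 1-forms\<close>

text \<open>The potential is the line integral of \<open>W\<close> along segments from a base point.
  By the symmetry of \<open>W'\<close>, the \<open>x\<close>-derivative of its integrand is the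
  \<open>t\<close>-derivative of \<open>t W(a + t(x - a))\<close>, and integrating that over
  \<open>t\<close> leaves \<open>W x\<close>.\<close>

lemma poincare_lemma:
  fixes W :: "'a::euclidean_space \<Rightarrow> 'a" and W' :: "'a \<Rightarrow> 'a \<Rightarrow> 'a"
  assumes S: "convex S" "open S"
    and W: "\<And>x. x \<in> S \<Longrightarrow> (W has_derivative W' x) (at x)"
    and cont: "\<And>v. continuous_on S (\<lambda>x. W' x v)"
    and sym: "\<And>x a b. x \<in> S \<Longrightarrow> W' x a \<bullet> b = W' x b \<bullet> a"
  obtains p where "\<And>x. x \<in> S \<Longrightarrow> (p has_derivative (\<lambda>h. W x \<bullet> h)) (at x)"
proof (cases "S = {}")
  case False
  then obtain a where a: "a \<in> S" by auto
  \<comment> \<open>Differentiation under the integral asks for a derivative that is continuous in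
    operator norm; in finite dimension this follows from the continuity of each
    \<open>W' x v\<close>.\<close>
  define V where "V x = Blinfun (W' x)" for x
  have V: "blinfun_apply (V x) = W' x" if "x \<in> S" for x
    using has_derivative_bounded_linear[OF W[OF that]] by (simp add: V_def bounded_linear_Blinfun_apply)
  have contV: "continuous_on S V"
    by (rule continuous_on_blinfun_componentwise)
      (use cont V in \<open>auto intro: continuous_on_eq\<close>)
  have contW: "continuous_on S W"
    by (meson W continuous_at_imp_continuous_on has_derivative_continuous)
  have seg: "a + t *\<^sub>R (x - a) \<in> S" if "x \<in> S" "t \<in> {0..1}" for t x
  proof -
    have "(1 - t) *\<^sub>R a + t *\<^sub>R x \<in> S"
      using S(1) a that by (auto simp: convex_alt)
    then show ?thesis by (simp add: algebra_simps)
  qed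
  define p where "p x = integral (cbox 0 1) (\<lambda>t. W (a + t *\<^sub>R (x - a)) \<bullet> (x - a))" for x
  define F where "F x t = t *\<^sub>R (blinfun_inner_left (x - a) o\<^sub>L V (a + t *\<^sub>R (x - a)))
      + blinfun_inner_left (W (a + t *\<^sub>R (x - a)))" for x t
  have contseg: "continuous_on (S \<times> cbox 0 1) (\<lambda>z. a + snd z *\<^sub>R (fst z - a))"
    by (auto intro!: continuous_intros)
  have cF: "continuous_on (S \<times> cbox 0 1) (\<lambda>(x, t). F x t)"
    unfolding F_def case_prod_beta
    by (intro continuous_intros continuous_on_compose2[OF contV] continuous_on_compose2[OF contW])
      (auto simp: seg)
  have "(p has_derivative (\<lambda>h. W x \<bullet> h)) (at x)" if x: "x \<in> S" for x
  proof -
    have "(p has_derivative integral (cbox 0 1) (F x)) (at x within S)"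
      unfolding p_def
    proof (rule leibniz_rule)
      fix y :: 'a and t :: real assume y: "y \<in> S" and t: "t \<in> cbox 0 1"
      have seg': "a + t *\<^sub>R (y - a) \<in> S" using seg y t by auto
      have "((\<lambda>y. W (a + t *\<^sub>R (y - a))) has_derivative (\<lambda>h. W' (a + t *\<^sub>R (y - a)) (t *\<^sub>R h))) (at y within S)"
        by (rule has_derivative_compose[where f="\<lambda>y. a + t *\<^sub>R (y - a)", OF _ W[OF seg']])
          (auto intro!: derivative_eq_intros)
      then have "((\<lambda>y. W (a + t *\<^sub>R (y - a)) \<bullet> (y - a)) has_derivative
          (\<lambda>h. W (a + t *\<^sub>R (y - a)) \<bullet> h + W' (a + t *\<^sub>R (y - a)) (t *\<^sub>R h) \<bullet> (y - a))) (at y within S)"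
        by (rule has_derivative_inner) (auto intro!: derivative_eq_intros)
      moreover have "(\<lambda>h. W (a + t *\<^sub>R (y - a)) \<bullet> h + W' (a + t *\<^sub>R (y - a)) (t *\<^sub>R h) \<bullet> (y - a)) = blinfun_apply (F y t)"
        using linear_cmul[OF has_derivative_linear[OF W[OF seg']]]
        by (auto simp: F_def V[OF seg'] blinfun.bilinear_simps inner_commute)
      ultimately show "((\<lambda>y. W (a + t *\<^sub>R (y - a)) \<bullet> (y - a)) has_derivative blinfun_apply (F y t)) (at y within S)"
        by simp
    next
      fix y assume y: "y \<in> S"
      show "(\<lambda>t. W (a + t *\<^sub>R (y - a)) \<bullet> (y - a)) integrable_on cbox 0 1"
        by (intro integrable_continuous continuous_intros continuous_on_compose2[OF contW])
          (use seg y in auto)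
    qed (use x S cF in auto)
    moreover have "blinfun_apply (integral (cbox 0 1) (F x)) h = W x \<bullet> h" for h
    proof -
      have cFx: "continuous_on (cbox 0 1) (F x)"
        using continuous_on_compose2[OF cF continuous_on_Pair[OF continuous_on_const[of "cbox 0 1" x] continuous_on_id]] x
        by auto
      have "blinfun_apply (integral (cbox 0 1) (F x)) h = integral (cbox 0 1) (\<lambda>t. blinfun_apply (F x t) h)"
        by (rule blinfun_apply_integral) (use cFx in \<open>rule integrable_continuous\<close>)
      also have "\<dots> = 1 *\<^sub>R (W (a + 1 *\<^sub>R (x - a)) \<bullet> h) - 0 *\<^sub>R (W (a + 0 *\<^sub>R (x - a)) \<bullet> h)"
      proof (rule integral_unique, unfold cbox_interval, rule fundamental_theorem_of_calculus)
        fix t :: real assume t: "t \<in> {0..1}"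
        have seg': "a + t *\<^sub>R (x - a) \<in> S" using seg x t by auto
        have "((\<lambda>t. W (a + t *\<^sub>R (x - a))) has_derivative (\<lambda>h. W' (a + t *\<^sub>R (x - a)) (h *\<^sub>R (x - a)))) (at t within {0..1})"
          by (rule has_derivative_compose[where f="\<lambda>t. a + t *\<^sub>R (x - a)", OF _ W[OF seg']])
            (auto intro!: derivative_eq_intros)
        then have "((\<lambda>t. W (a + t *\<^sub>R (x - a))) has_vector_derivative W' (a + t *\<^sub>R (x - a)) (x - a)) (at t within {0..1})"
          by (simp add: has_vector_derivative_def linear_cmul[OF has_derivative_linear[OF W[OF seg']]])
        from has_vector_derivative_scaleR[OF DERIV_ident bounded_linear.has_vector_derivative[OF bounded_linear_inner_left this]]
        have "((\<lambda>t. t *\<^sub>R (W (a + t *\<^sub>R (x - a)) \<bullet> h)) has_vector_derivative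
          t *\<^sub>R (W' (a + t *\<^sub>R (x - a)) (x - a) \<bullet> h) + 1 *\<^sub>R (W (a + t *\<^sub>R (x - a)) \<bullet> h)) (at t within {0..1})" .
        moreover have "blinfun_apply (F x t) h = t *\<^sub>R (W' (a + t *\<^sub>R (x - a)) (x - a) \<bullet> h) + 1 *\<^sub>R (W (a + t *\<^sub>R (x - a)) \<bullet> h)"
          using sym[OF seg', of h "x - a"] by (simp add: F_def V[OF seg'] blinfun.bilinear_simps inner_commute)
        ultimately show "((\<lambda>t. t *\<^sub>R (W (a + t *\<^sub>R (x - a)) \<bullet> h)) has_vector_derivative blinfun_apply (F x t) h) (at t within {0..1})"
          by simp
      qed auto
      finally show ?thesis by simp
    qed
    then have "blinfun_apply (integral (cbox 0 1) (F x)) = (\<lambda>h. W x \<bullet> h)" by auto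
    ultimately show ?thesis using at_within_open[OF x S(2)] by simp
  qed
  then show ?thesis using that by blast
qed (use that in auto)

text \<open>A pull-back of a closed form is closed. Differentiating \<open>B (\<Psi> x)\<close>
  paired with the derivative of \<open>\<Psi>\<close> gives two terms: one is symmetric by
  \<open>sym\<close>, the other because second derivatives of \<open>\<Psi>\<close> commute.
  \<open>W\<close> is the vector field that represents the pulled-back form.\<close>

lemma pullback_potential:
  fixes \<Psi> :: "'a::euclidean_space \<Rightarrow> 'b::euclidean_space" and B :: "'b \<Rightarrow> 'b" and B' :: "'b \<Rightarrow> 'b \<Rightarrow>\<^sub>L 'b"
  assumes B: "\<And>y. y \<in> \<Omega> \<Longrightarrow> (B has_derivative blinfun_apply (B' y)) (at y)"
    and cont: "continuous_on \<Omega> B'"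
    and sym: "\<And>y a b. y \<in> \<Omega> \<Longrightarrow> B' y a \<bullet> b = B' y b \<bullet> a"
    and S: "convex S" "open S" "\<Psi> ` S \<subseteq> \<Omega>" and \<Psi>: "ck (Suc (Suc 0)) \<Psi>"
  obtains p where "\<And>x. x \<in> S \<Longrightarrow> (p has_derivative (\<lambda>h. B (\<Psi> x) \<bullet> frechet_derivative \<Psi> (at x) h)) (at x)"
proof -
  let ?D = "\<lambda>h x. frechet_derivative \<Psi> (at x) h"
  let ?DD = "\<lambda>a b x. frechet_derivative (?D b) (at x) a"
  define W where "W x = (\<Sum>b\<in>Basis. (B (\<Psi> x) \<bullet> ?D b x) *\<^sub>R b)" for x
  define W' where "W' x a = (\<Sum>b\<in>Basis. (B (\<Psi> x) \<bullet> ?DD a b x + B' (\<Psi> x) (?D a x) \<bullet> ?D b x) *\<^sub>R b)" for x a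
  have \<Psi>1: "ck (Suc 0) \<Psi>" using ck_Suc_imp[OF \<Psi>] .
  have D: "(\<Psi> has_derivative (\<lambda>h. ?D h x)) (at x)" for x using ck_Suc_has_derivative[OF \<Psi>] .
  have DD: "(?D b has_derivative (\<lambda>a. ?DD a b x)) (at x)" for x b
    using ck_Suc_has_derivative[OF ck_Suc_derivative[OF \<Psi>]] .
  have linD: "linear (\<lambda>h. ?D h x)" for x using has_derivative_linear[OF D] .
  have Wh: "W x \<bullet> h = B (\<Psi> x) \<bullet> ?D h x" for x h
  proof -
    have "B (\<Psi> x) \<bullet> ?D h x = B (\<Psi> x) \<bullet> ?D (\<Sum>b\<in>Basis. (h \<bullet> b) *\<^sub>R b) x"
      by (simp add: euclidean_representation)
    also have "\<dots> = W x \<bullet> h"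
      by (simp add: linear_sum[OF linD] linear_cmul[OF linD] inner_sum_right inner_sum_left W_def inner_commute mult.commute)
    finally show ?thesis by simp
  qed
  have DDlin: "(\<Sum>b\<in>Basis. (h \<bullet> b) *\<^sub>R ?DD a b x) = ?DD a h x" for x a h
  proof -
    have 1: "?D h = (\<lambda>x. \<Sum>b\<in>Basis. (h \<bullet> b) *\<^sub>R ?D b x)"
    proof
      fix x
      have "?D h x = ?D (\<Sum>b\<in>Basis. (h \<bullet> b) *\<^sub>R b) x" by (simp add: euclidean_representation)
      also have "\<dots> = (\<Sum>b\<in>Basis. (h \<bullet> b) *\<^sub>R ?D b x)"
        by (simp add: linear_sum[OF linD] linear_cmul[OF linD])
      finally show "?D h x = (\<Sum>b\<in>Basis. (h \<bullet> b) *\<^sub>R ?D b x)" .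
    qed
    have "(?D h has_derivative (\<lambda>a. \<Sum>b\<in>Basis. (h \<bullet> b) *\<^sub>R ?DD a b x)) (at x)"
      by (subst 1) (intro has_derivative_sum has_derivative_scaleR_right DD)
    from has_derivative_unique[OF this DD[of h x]] show ?thesis by metis
  qed
  have W'h: "W' x a \<bullet> h = B (\<Psi> x) \<bullet> ?DD a h x + B' (\<Psi> x) (?D a x) \<bullet> ?D h x" for x a h
  proof -
    have "?D h x = ?D (\<Sum>b\<in>Basis. (h \<bullet> b) *\<^sub>R b) x" by (simp add: euclidean_representation)
    also have "\<dots> = (\<Sum>b\<in>Basis. (h \<bullet> b) *\<^sub>R ?D b x)"
      by (simp add: linear_sum[OF linD] linear_cmul[OF linD])
    finally have 1: "?D h x = (\<Sum>b\<in>Basis. (h \<bullet> b) *\<^sub>R ?D b x)" .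
    have 2: "B (\<Psi> x) \<bullet> ?DD a h x = (\<Sum>b\<in>Basis. (b \<bullet> h) * (B (\<Psi> x) \<bullet> ?DD a b x))"
      by (subst DDlin[symmetric]) (simp add: inner_sum_right inner_commute)
    show ?thesis
      unfolding 2 1
      by (simp add: W'_def inner_sum_left inner_sum_right sum.distrib[symmetric] inner_commute algebra_simps)
  qed
  have cB: "continuous_on \<Omega> B"
    by (meson B continuous_at_imp_continuous_on has_derivative_continuous)
  have c\<Psi>: "continuous_on S \<Psi>" using ck_continuous[OF \<Psi>] continuous_on_subset by blast
  have cD: "continuous_on S (?D b)" for b
    using ck_continuous[OF ck_Suc_derivative[OF \<Psi>1]] continuous_on_subset by blast
  have cDD: "continuous_on S (?DD a b)" for a b
    using ck_continuous[OF ck_Suc_derivative[OF ck_Suc_derivative[OF \<Psi>]]] continuous_on_subset by blast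
  show thesis
  proof (rule poincare_lemma[of S W W', OF S(1,2)])
    fix x assume x: "x \<in> S"
    have "((\<lambda>x. B (\<Psi> x)) has_derivative (\<lambda>a. B' (\<Psi> x) (?D a x))) (at x)"
      by (rule has_derivative_compose[OF D B]) (use x S in auto)
    then show "(W has_derivative W' x) (at x)"
      unfolding W_def W'_def
      by (intro has_derivative_sum has_derivative_scaleR_left has_derivative_inner DD)
    fix a b
    show "W' x a \<bullet> b = W' x b \<bullet> a"
      using sym[of "\<Psi> x"] x S(3) ck_symmetric[OF \<Psi>, of b x a] by (auto simp: W'h)
  next
    fix v
    show "continuous_on S (\<lambda>x. W' x v)"
      unfolding W'_def
      by (intro continuous_intros cD cDD continuous_on_compose2[OF cB c\<Psi>] continuous_on_compose2[OF cont c\<Psi>] S)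
  next
    fix p assume "\<And>x. x \<in> S \<Longrightarrow> (p has_derivative (\<lambda>h. W x \<bullet> h)) (at x)"
    then show thesis using that[of p] by (simp add: Wh)
  qed
qed

text \<open>The two points admit exactly the same derivatives, so the choice operator behind
  \<open>frechet_derivative\<close> picks the same one.\<close>

lemma frechet_derivative_periodic:
  assumes "\<And>x. f (x + e) = f x"
  shows "frechet_derivative f (at (x + e)) = frechet_derivative f (at x)"
proof -
  have "(f has_derivative D) (at (x + e)) \<longleftrightarrow> (f has_derivative D) (at x)" for D
  proof
    assume D: "(f has_derivative D) (at (x + e))"
    have "((\<lambda>x. f (x + e)) has_derivative (\<lambda>h. D h)) (at x)"
      by (rule has_derivative_compose[where f="\<lambda>x. x + e" and g=f and f'="\<lambda>h. h", OF _ D])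
        (auto intro!: derivative_eq_intros)
    then show "(f has_derivative D) (at x)" by (simp only: assms)
  next
    assume D: "(f has_derivative D) (at x)"
    have "((\<lambda>y. f (y - e)) has_derivative (\<lambda>h. D h)) (at (x + e))"
      by (rule has_derivative_compose[where f="\<lambda>y. y - e" and g=f and f'="\<lambda>h. h" and g'=D])
        (use D in \<open>auto intro!: derivative_eq_intros\<close>)
    moreover have "f (y - e) = f y" for y using assms[of "y - e"] by simp
    ultimately show "(f has_derivative D) (at (x + e))" by (simp only:)
  qed
  then show ?thesis by (simp add: frechet_derivative_def)
qed

text \<open>\<open>a\<close> and \<open>b\<close> are the periods of the closed form over the two generators of the deck group.\<close>
definition torus_potential ::
  "(real^3 \<Rightarrow> real^3) \<Rightarrow> ((real \<times> real) \<times> real \<Rightarrow> real^3) \<Rightarrow> real \<Rightarrow> real \<Rightarrow> real \<Rightarrow> real \<Rightarrow> ((real \<times> real) \<times> real \<Rightarrow> real) \<Rightarrow> bool" where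
  "torus_potential B \<Psi> lo hi a b p \<longleftrightarrow>
    (\<forall>s t r. lo < r \<and> r < hi \<longrightarrow>
      (p has_derivative (\<lambda>h. B (\<Psi> ((s, t), r)) \<bullet> frechet_derivative \<Psi> (at ((s, t), r)) h)) (at ((s, t), r)) \<and>
      p ((s + 1, t), r) = p ((s, t), r) + a \<and> p ((s, t + 1), r) = p ((s, t), r) + b)"

text \<open>The closed form need not be exact on the collar, but its universal cover is a convex
  slab. There a potential exists, and its change under a deck translation has derivative zero
  because the form is periodic.\<close>

lemma torus_potential_exists:
  fixes B :: "real^3 \<Rightarrow> real^3"
  assumes B: "\<And>y. y \<in> \<Omega> \<Longrightarrow> (B has_derivative blinfun_apply (B' y)) (at y)"
    and cont: "continuous_on \<Omega> B'"
    and sym: "\<And>y a b. y \<in> \<Omega> \<Longrightarrow> B' y a \<bullet> b = B' y b \<bullet> a"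
    and \<Psi>: "ck (Suc (Suc 0)) \<Psi>"
    and per: "\<And>s t r. \<Psi> ((s + 1, t), r) = \<Psi> ((s, t), r)" "\<And>s t r. \<Psi> ((s, t + 1), r) = \<Psi> ((s, t), r)"
    and sub: "\<And>s t r. lo < r \<Longrightarrow> r < hi \<Longrightarrow> \<Psi> ((s, t), r) \<in> \<Omega>"
  shows "\<exists>a b p. torus_potential B \<Psi> lo hi a b p"
proof -
  define S where "S = (UNIV :: (real \<times> real) set) \<times> {lo<..<hi}"
  have S: "convex S" "open S" "\<Psi> ` S \<subseteq> \<Omega>"
    unfolding S_def using sub by (auto intro: convex_Times open_Times)
  obtain p where p: "\<And>x. x \<in> S \<Longrightarrow> (p has_derivative (\<lambda>h. B (\<Psi> x) \<bullet> frechet_derivative \<Psi> (at x) h)) (at x)"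
    using pullback_potential[OF B cont sym S \<Psi>] by blast
  have *: "\<exists>a. \<forall>x\<in>S. p (x + e) - p x = a"
    if e: "\<And>x. \<Psi> (x + e) = \<Psi> x" "snd e = 0" for e
  proof (rule has_derivative_zero_constant[OF S(1)])
    fix x assume x: "x \<in> S"
    then have x': "x + e \<in> S" using e(2) by (auto simp: S_def mem_Times_iff)
    have "((\<lambda>x. p (x + e)) has_derivative (\<lambda>h. B (\<Psi> (x + e)) \<bullet> frechet_derivative \<Psi> (at (x + e)) h)) (at x)"
      by (rule has_derivative_compose[where f="\<lambda>x. x + e", OF _ p[OF x']]) (auto intro!: derivative_eq_intros)
    then have "((\<lambda>x. p (x + e)) has_derivative (\<lambda>h. B (\<Psi> x) \<bullet> frechet_derivative \<Psi> (at x) h)) (at x)"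
      by (simp add: e(1) frechet_derivative_periodic[where f=\<Psi> and e=e, OF e(1)])
    from has_derivative_diff[OF this p[OF x]]
    show "((\<lambda>x. p (x + e) - p x) has_derivative (\<lambda>h. 0)) (at x within S)"
      by (auto intro: has_derivative_at_withinI)
  qed
  have e1: "\<Psi> (x + ((1,0),0)) = \<Psi> x" and e2: "\<Psi> (x + ((0,1),0)) = \<Psi> x" for x
    using per[of "fst (fst x)" "snd (fst x)" "snd x"] by (cases x; auto)+
  obtain a where a: "\<forall>x\<in>S. p (x + ((1,0),0)) - p x = a"
    using *[OF e1] by auto
  obtain b where b: "\<forall>x\<in>S. p (x + ((0,1),0)) - p x = b"
    using *[OF e2] by auto
  have "torus_potential B \<Psi> lo hi a b p"
    unfolding torus_potential_def
  proof (intro allI impI conjI)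
    fix s t r assume r: "lo < r \<and> r < hi"
    then have x: "((s,t),r) \<in> S" by (auto simp: S_def)
    show "(p has_derivative (\<lambda>h. B (\<Psi> ((s, t), r)) \<bullet> frechet_derivative \<Psi> (at ((s, t), r)) h)) (at ((s, t), r))"
      using p[OF x] .
    show "p ((s + 1, t), r) = p ((s, t), r) + a" "p ((s, t + 1), r) = p ((s, t), r) + b"
      using bspec[OF a x] bspec[OF b x] by auto
  qed
  then show ?thesis by blast
qed

text \<open>With \<open>a = 0\<close> this is periodicity; with \<open>a\<close> a period it
  describes a multivalued potential.\<close>

lemma periodic_int_shift:
  fixes q :: "real \<Rightarrow> 'a::real_vector"
  assumes "\<And>s. q (s + 1) = q s + a"
  shows "q (s + of_int n) = q s + of_int n *\<^sub>R a"
proof -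
  have 1: "q (s + of_nat m) = q s + of_nat m *\<^sub>R a" for s m
  proof (induction m)
    case (Suc m)
    then show ?case using assms[of "s + of_nat m"] by (simp add: algebra_simps)
  qed simp
  show ?thesis
  proof (cases "n \<ge> 0")
    case True
    then show ?thesis using 1[of s "nat n"] by simp
  next
    case False
    then show ?thesis using 1[of "s + of_int n" "nat (- n)"] by (simp add: algebra_simps)
  qed
qed

text \<open>The integrand is the derivative of the potential along a segment whose end points differ
  by a lattice vector. Hence neither the base point \<open>x\<close> nor the level \<open>r\<close>
  influences the integral.\<close>

lemma torus_potential_period:
  assumes p: "torus_potential B \<Psi> lo hi a b p" and r: "lo < r" "r < hi"
  shows "((\<lambda>u. B (\<Psi> (x + u *\<^sub>R (of_int m, of_int n), r)) \<bullet>
     frechet_derivative \<Psi> (at (x + u *\<^sub>R (of_int m, of_int n), r)) ((of_int m, of_int n), 0))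
     has_integral (of_int m * a + of_int n * b)) {0..1}"
proof -
  obtain s t where x: "x = (s, t)" by (cases x)
  let ?c = "((real_of_int m, real_of_int n), 0::real)"
  let ?q = "\<lambda>u. p (x + u *\<^sub>R (real_of_int m, real_of_int n), r)"
  let ?B = "\<lambda>u. B (\<Psi> (x + u *\<^sub>R (of_int m, of_int n), r)) \<bullet> frechet_derivative \<Psi> (at (x + u *\<^sub>R (of_int m, of_int n), r)) ?c"
  have "(?q has_vector_derivative ?B u) (at u within {0..1})" for u
  proof -
    let ?D = "\<lambda>h. B (\<Psi> (x + u *\<^sub>R (of_int m, of_int n), r)) \<bullet> frechet_derivative \<Psi> (at (x + u *\<^sub>R (of_int m, of_int n), r)) h"
    have D: "(p has_derivative ?D) (at (x + u *\<^sub>R (of_int m, of_int n), r))"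
      using p r unfolding torus_potential_def x by auto
    have "((\<lambda>u. (x + u *\<^sub>R (real_of_int m, real_of_int n), r)) has_derivative (\<lambda>h. h *\<^sub>R ?c)) (at u within {0..1})"
      by (auto intro!: derivative_eq_intros simp del: scaleR_Pair) (auto simp: zero_prod_def)
    from has_derivative_compose[OF this D]
    have "(?q has_derivative (\<lambda>h. ?D (h *\<^sub>R ?c))) (at u within {0..1})" .
    moreover have "(\<lambda>h. ?D (h *\<^sub>R ?c)) = (\<lambda>h. h *\<^sub>R ?D ?c)"
      using linear_cmul[OF has_derivative_linear[OF D]] by blast
    ultimately show ?thesis
      by (simp only: has_vector_derivative_def)
  qed
  from fundamental_theorem_of_calculus[OF _ this]
  have "(?B has_integral ?q 1 - ?q 0) {0..1}" by simp
  moreover have "?q 1 - ?q 0 = of_int m * a + of_int n * b"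
    using periodic_int_shift[of "\<lambda>s. p ((s, t + of_int n), r)" a s m] periodic_int_shift[of "\<lambda>t. p ((s, t), r)" b t n]
      p r unfolding torus_potential_def x by auto
  ultimately show ?thesis by simp
qed

subsection \<open>The field of a closed curve\<close>

text \<open>The Coulomb field. Paired with a cross product of two tangent vectors it is the
  solid-angle form, and hence the integrand of Gauss.\<close>

definition gk :: "real^3 \<Rightarrow> real^3" where
  "gk x = (1 / norm x ^ 3) *\<^sub>R x"

definition gk' :: "real^3 \<Rightarrow> real^3 \<Rightarrow> real^3" where
  "gk' x v = (1 / norm x ^ 3) *\<^sub>R v - (3 * (x \<bullet> v) / norm x ^ 5) *\<^sub>R x"

lemma gk_has_derivative:
  assumes "x \<noteq> 0"
  shows "(gk has_derivative gk' x) (at x)"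
proof -
  have n: "(norm has_derivative (\<lambda>v. (x \<bullet> v) / norm x)) (at x)"
    using has_derivative_norm[OF assms] by (simp add: sgn_div_norm inner_commute divide_inverse mult.commute)
  have "((\<lambda>y. 1 / norm y ^ 3) has_derivative (\<lambda>v. - (3 * (x \<bullet> v) / norm x ^ 5))) (at x)"
    using assms
    by (auto intro!: derivative_eq_intros n simp: field_simps power_numeral_reduce)
  then have "((\<lambda>y. (1 / norm y ^ 3) *\<^sub>R y) has_derivative (\<lambda>v. (1 / norm x ^ 3) *\<^sub>R v + (- (3 * (x \<bullet> v) / norm x ^ 5)) *\<^sub>R x)) (at x)"
    by (rule has_derivative_scaleR) (rule has_derivative_ident)
  then show ?thesis
    by (simp add: gk_def[abs_def] gk'_def[abs_def])
qed

lemma continuous_on_gk: "continuous_on S f \<Longrightarrow> (\<And>x. x \<in> S \<Longrightarrow> f x \<noteq> 0) \<Longrightarrow> continuous_on S (\<lambda>x. gk (f x))"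
  unfolding gk_def by (auto intro!: continuous_intros)

lemma continuous_on_gk':
  "continuous_on S f \<Longrightarrow> continuous_on S v \<Longrightarrow> (\<And>x. x \<in> S \<Longrightarrow> f x \<noteq> 0) \<Longrightarrow> continuous_on S (\<lambda>x. gk' (f x) (v x))"
  unfolding gk'_def by (auto intro!: continuous_intros)

lemma linear_gk': "linear (gk' x)"
  by (rule linearI) (auto simp: gk'_def algebra_simps inner_simps add_divide_distrib)

text \<open>The expansion of \<open>(a \<bullet> cross3 b c) x\<close> in the three cross products,
  paired with \<open>x\<close>.\<close>

lemma cross3_Cramer:
  fixes x a b c :: "real^3"
  shows "(x \<bullet> a) * (x \<bullet> cross3 b c) + (x \<bullet> b) * (x \<bullet> cross3 c a) + (x \<bullet> c) * (x \<bullet> cross3 a b)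
    = (x \<bullet> x) * (a \<bullet> cross3 b c)"
  by (simp add: cross3_def inner_vec_def sum_3 vector_3) algebra

lemma cross3_triple:
  fixes a b c :: "real^3"
  shows "b \<bullet> cross3 c a = a \<bullet> cross3 b c" "c \<bullet> cross3 a b = a \<bullet> cross3 b c"
  by (simp_all add: cross3_def inner_vec_def sum_3 vector_3) algebra+

lemma gk'_inner: "gk' x a \<bullet> w = (a \<bullet> w) / norm x ^ 3 - 3 / norm x ^ 5 * ((x \<bullet> a) * (x \<bullet> w))"
  by (simp add: gk'_def inner_diff_left)

text \<open>The left side is the trace of \<open>gk' x\<close> times the determinant of
  \<open>a\<close>, \<open>b\<close>, \<open>c\<close>, so this says that the Coulomb field is
  divergence free. The form without coordinates fits arbitrary tangent vectors of a
  parametrisation.\<close>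

lemma gk'_trace:
  assumes "x \<noteq> 0"
  shows "gk' x a \<bullet> cross3 b c + gk' x b \<bullet> cross3 c a + gk' x c \<bullet> cross3 a b = 0"
proof -
  let ?n = "norm x"
  have n: "?n > 0" using assms by simp
  have "gk' x a \<bullet> cross3 b c + gk' x b \<bullet> cross3 c a + gk' x c \<bullet> cross3 a b
     = 3 * (a \<bullet> cross3 b c) / ?n ^ 3
     - 3 / ?n ^ 5 * ((x \<bullet> a) * (x \<bullet> cross3 b c) + (x \<bullet> b) * (x \<bullet> cross3 c a) + (x \<bullet> c) * (x \<bullet> cross3 a b))"
    using cross3_triple[where a=a and b=b and c=c]
    by (simp add: gk'_inner algebra_simps)
  also have "\<dots> = 0"
    unfolding cross3_Cramer using n
    by (simp add: power2_norm_eq_inner[symmetric] field_simps power_numeral_reduce)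
  finally show ?thesis .
qed

text \<open>A period on the whole line, rather than equal end points on \<open>{0..1}\<close>, makes
  the velocities match at the seam too.\<close>

definition closed_curve :: "(real \<Rightarrow> real^3) \<Rightarrow> (real \<Rightarrow> real^3) \<Rightarrow> bool" where
  "closed_curve g g' \<longleftrightarrow> (\<forall>u. (g has_vector_derivative g' u) (at u)) \<and> continuous_on UNIV g' \<and> (\<forall>u. g (u + 1) = g u)"

lemma closed_curve_continuous: "closed_curve g g' \<Longrightarrow> continuous_on S g"
  unfolding closed_curve_def
  by (meson continuous_at_imp_continuous_on has_vector_derivative_continuous)

lemma closed_curve_continuous': "closed_curve g g' \<Longrightarrow> continuous_on S g'"
  unfolding closed_curve_def using continuous_on_subset by blast

lemma periodic_frac:
  fixes g :: "real \<Rightarrow> 'a::real_vector"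
  assumes "\<And>u. g (u + 1) = g u"
  shows "g u = g (frac u)"
  using periodic_int_shift[of g 0 "frac u" "\<lfloor>u\<rfloor>"] assms by (simp add: frac_def)

lemma closed_curve_range: "closed_curve g g' \<Longrightarrow> range g = g ` {0..1}"
proof -
  assume "closed_curve g g'"
  then have "g u = g (frac u)" for u
    unfolding closed_curve_def by (intro periodic_frac) auto
  moreover have "frac u \<in> {0..1::real}" for u
    by (simp add: frac_lt_1 less_imp_le)
  ultimately show ?thesis by (metis (no_types, lifting) image_eqI image_subset_iff subset_antisym subset_UNIV image_mono)
qed

lemma closed_curve_compact: "closed_curve g g' \<Longrightarrow> compact (range g)"
  using closed_curve_range closed_curve_continuous compact_continuous_image compact_Icc by metis

text \<open>\<open>4\<pi>\<close> times the Biot--Savart field of a unit current along \<open>g\<close>.\<close>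
definition bs :: "(real \<Rightarrow> real^3) \<Rightarrow> (real \<Rightarrow> real^3) \<Rightarrow> real^3 \<Rightarrow> real^3" where
  "bs g g' y = integral {0..1} (\<lambda>u. cross3 (gk (g u - y)) (g' u))"

lemma continuous_on_cross3:
  "continuous_on S f \<Longrightarrow> continuous_on S g \<Longrightarrow> continuous_on S (\<lambda>x. cross3 (f x) (g x))"
  using bounded_bilinear.continuous_on[OF bounded_bilinear_cross3] .

text \<open>The curl vanishes because the curve is closed: by \<open>gk'_trace\<close> the
  antisymmetric part of the derivative is, up to sign, the integral of
  \<open>gk' (g u - y) (g' u)\<close>, that is, the increment of \<open>gk (g u - y)\<close> around
  the curve. Differentiability off the curve is differentiation under the integral.\<close>

lemma bs_field:
  assumes g: "closed_curve g g'"
  shows "\<exists>B' :: real^3 \<Rightarrow> (real^3) \<Rightarrow>\<^sub>L (real^3).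
    (\<forall>y\<in>- range g. (bs g g' has_derivative blinfun_apply (B' y)) (at y)) \<and>
    continuous_on (- range g) B' \<and>
    (\<forall>y\<in>- range g. \<forall>a b. B' y a \<bullet> b = B' y b \<bullet> a)"
proof -
  define \<Omega> where "\<Omega> = - range g"
  have op: "open \<Omega>" unfolding \<Omega>_def using closed_curve_compact[OF g] compact_imp_closed by blast
  have nz: "g u - y \<noteq> 0" if "y \<in> \<Omega>" for y u using that by (auto simp: \<Omega>_def)
  have cg: "continuous_on S (\<lambda>z. g (snd z))" "continuous_on S (\<lambda>z. g' (snd z))" for S :: "((real^3) \<times> real) set"
    by (rule continuous_on_compose2[OF closed_curve_continuous[OF g, of UNIV]]
            continuous_on_compose2[OF closed_curve_continuous'[OF g, of UNIV]]; auto intro!: continuous_intros)+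
  define F where "F y u = Blinfun (\<lambda>h. cross3 (gk' (g u - y) (- h)) (g' u))" for y u
  have F: "blinfun_apply (F y u) = (\<lambda>h. cross3 (gk' (g u - y) (- h)) (g' u))" for y u
    unfolding F_def
  proof (rule bounded_linear_Blinfun_apply)
    have "linear (\<lambda>h. cross3 (gk' (g u - y) (- h)) (g' u))"
      by (rule linearI) (auto simp: linear_add[OF linear_gk'] linear_diff[OF linear_gk'] linear_neg[OF linear_gk'] linear_cmul[OF linear_gk'] cross3_simps)
    then show "bounded_linear (\<lambda>h. cross3 (gk' (g u - y) (- h)) (g' u))"
      using linear_conv_bounded_linear by blast
  qed
  have cF: "continuous_on (\<Omega> \<times> cbox 0 1) (\<lambda>(y, u). F y u)"
    unfolding case_prod_beta
    by (rule continuous_on_blinfun_componentwise)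
      (auto simp: F intro!: continuous_on_cross3 continuous_on_gk' continuous_intros cg dest: nz)
  have cbsi: "continuous_on (cbox 0 1) (\<lambda>u. cross3 (gk (g u - y)) (g' u))" if "y \<in> \<Omega>" for y
    using nz[OF that]
    by (auto intro!: continuous_on_cross3 continuous_on_gk continuous_intros closed_curve_continuous[OF g] closed_curve_continuous'[OF g])
  define B' where "B' y = integral (cbox 0 1) (F y)" for y
  have der: "(bs g g' has_derivative blinfun_apply (B' y)) (at y)" if y: "y \<in> \<Omega>" for y
  proof -
    obtain e where e: "e > 0" "ball y e \<subseteq> \<Omega>" using op y openE by blast
    have "((\<lambda>y. integral (cbox 0 1) (\<lambda>u. cross3 (gk (g u - y)) (g' u))) has_derivative integral (cbox 0 1) (F y)) (at y within ball y e)"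
    proof (rule leibniz_rule)
      fix z :: "real^3" and u :: real assume z: "z \<in> ball y e"
      have nz': "g u - z \<noteq> 0" using nz z e by blast
      have "((\<lambda>z. gk (g u - z)) has_derivative (\<lambda>h. gk' (g u - z) (- h))) (at z within ball y e)"
        by (rule has_derivative_compose[where f="\<lambda>z. g u - z" and f'="\<lambda>h. - h", OF _ gk_has_derivative[OF nz']])
          (auto intro!: derivative_eq_intros)
      then show "((\<lambda>y. cross3 (gk (g u - y)) (g' u)) has_derivative blinfun_apply (F z u)) (at z within ball y e)"
        unfolding F
        by (rule bounded_linear.has_derivative[OF bounded_bilinear.bounded_linear_left[OF bounded_bilinear_cross3]])
    next
      fix z assume "z \<in> ball y e"
      then show "(\<lambda>u. cross3 (gk (g u - z)) (g' u)) integrable_on cbox 0 1"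
        using cbsi e by (intro integrable_continuous) auto
    next
      show "continuous_on (ball y e \<times> cbox 0 1) (\<lambda>(x, t). F x t)"
        by (rule continuous_on_subset[OF cF]) (use e in auto)
    qed (use e in auto)
    then show ?thesis
      using e by (simp add: bs_def[abs_def] B'_def at_within_open[of y "ball y e"])
  qed
  have cont: "continuous_on \<Omega> B'"
    unfolding B'_def[abs_def] by (rule integral_continuous_on_param[OF cF])
  have sym: "B' y a \<bullet> b = B' y b \<bullet> a" if y: "y \<in> \<Omega>" for y a b
  proof -
    have int: "F y integrable_on cbox 0 1"
    proof (rule integrable_continuous)
      show "continuous_on (cbox 0 1) (F y)"
        using continuous_on_compose2[OF cF continuous_on_Pair[OF continuous_on_const[of "cbox 0 1" y] continuous_on_id]] y
        by auto
    qed
    have int2: "(\<lambda>u. blinfun_apply (F y u) a) integrable_on cbox 0 1" for a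
      using int by (rule integrable_linear[OF _ blinfun.bounded_linear_left, unfolded o_def]) 
    have *: "B' y a \<bullet> b = integral (cbox 0 1) (\<lambda>u. F y u a \<bullet> b)" for a b
    proof -
      have "B' y a = integral (cbox 0 1) (\<lambda>u. F y u a)"
        unfolding B'_def by (rule blinfun_apply_integral[OF int])
      then show ?thesis
        using integral_linear[OF int2 bounded_linear_inner_left[of b]] by (simp add: o_def)
    qed
    have int3: "(\<lambda>u. F y u a \<bullet> b) integrable_on cbox 0 1" for a b
      using integrable_linear[OF int2 bounded_linear_inner_left] by (simp add: o_def)
    have eq: "F y u a \<bullet> b - F y u b \<bullet> a = - (gk' (g u - y) (g' u) \<bullet> cross3 a b)" for u
    proof -
      have "gk' (g u - y) a \<bullet> cross3 (g' u) b + gk' (g u - y) (g' u) \<bullet> cross3 b a + gk' (g u - y) b \<bullet> cross3 a (g' u) = 0"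
        by (rule gk'_trace[OF nz[OF y]])
      moreover have "cross3 (gk' (g u - y) (- a)) (g' u) \<bullet> b = - (gk' (g u - y) a \<bullet> cross3 (g' u) b)" for a b
        by (simp add: linear_neg[OF linear_gk']) (simp add: cross3_def inner_vec_def sum_3 vector_3 algebra_simps)
      ultimately show ?thesis
        by (simp add: F) (simp add: cross_skew[of b a] cross_skew[of "g' u" a] )
    qed
    have "((\<lambda>u. gk' (g u - y) (g' u) \<bullet> cross3 a b) has_integral
        (gk (g 1 - y) \<bullet> cross3 a b) - (gk (g 0 - y) \<bullet> cross3 a b)) {0..1}"
    proof (rule fundamental_theorem_of_calculus)
      fix u :: real
      have "(g has_vector_derivative g' u) (at u)" using g by (simp add: closed_curve_def)
      from has_vector_derivative_diff[OF has_vector_derivative_at_within[OF this] has_vector_derivative_const]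
      have "((\<lambda>u. g u - y) has_vector_derivative g' u) (at u within {0..1})" by simp
      then have "((\<lambda>u. gk (g u - y)) has_derivative (\<lambda>h. gk' (g u - y) (h *\<^sub>R g' u))) (at u within {0..1})"
        unfolding has_vector_derivative_def
        by (rule has_derivative_compose[where f="\<lambda>u. g u - y", OF _ gk_has_derivative[OF nz[OF y]]])
      then have "((\<lambda>u. gk (g u - y)) has_vector_derivative gk' (g u - y) (g' u)) (at u within {0..1})"
        by (simp add: has_vector_derivative_def linear_cmul[OF linear_gk'])
      then show "((\<lambda>u. gk (g u - y) \<bullet> cross3 a b) has_vector_derivative gk' (g u - y) (g' u) \<bullet> cross3 a b) (at u within {0..1})"
        by (rule bounded_linear.has_vector_derivative[OF bounded_linear_inner_left])
    qed auto
    moreover have "g 1 = g 0" using g unfolding closed_curve_def by (metis add_0)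
    ultimately have "((\<lambda>u. gk' (g u - y) (g' u) \<bullet> cross3 a b) has_integral 0) {0..1}" by simp
    from has_integral_neg[OF this]
    have z: "((\<lambda>u. - (gk' (g u - y) (g' u) \<bullet> cross3 a b)) has_integral 0) (cbox 0 1)" by simp
    have "B' y a \<bullet> b - B' y b \<bullet> a = integral (cbox 0 1) (\<lambda>u. F y u a \<bullet> b - F y u b \<bullet> a)"
      unfolding * by (rule integral_diff[OF int3 int3, symmetric])
    also have "\<dots> = 0" unfolding eq using z by (rule integral_unique)
    finally show ?thesis by simp
  qed
  show ?thesis using der cont sym unfolding \<Omega>_def by blast
qed

lemma norm_cross3_le: "norm (cross3 x y) \<le> norm x * norm y"
  by (rule power2_le_imp_le) (auto simp: power_mult_distrib norm_cross)

text \<open>For \<open>norm y \<ge> 2 * R\<close> the curve stays at distance at least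
  \<open>norm y / 2\<close>, which makes the kernel at most 4 over the square of
  \<open>norm y\<close>. The constant is four times the maximal speed, so it is fixed before
  \<open>R\<close>.\<close>

lemma bs_decay:
  assumes g: "closed_curve g g'"
  obtains C where "C \<ge> 0" "\<And>y R. R > 0 \<Longrightarrow> (\<And>u. norm (g u) \<le> R) \<Longrightarrow> norm y \<ge> 2 * R \<Longrightarrow> norm (bs g g' y) \<le> C / norm y ^ 2"
proof -
  have "bounded (g' ` {0..1})"
    using closed_curve_continuous'[OF g] compact_continuous_image compact_imp_bounded by blast
  then obtain G where G: "G > 0" "\<And>u. u \<in> {0..1} \<Longrightarrow> norm (g' u) \<le> G"
    by (auto simp: bounded_pos)
  have "norm (bs g g' y) \<le> (4 * G) / norm y ^ 2"
    if R: "R > 0" "\<And>u. norm (g u) \<le> R" "norm y \<ge> 2 * R" for y R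
  proof -
    have y: "norm y > 0" using R by linarith
    have far: "norm (g u - y) \<ge> norm y / 2" for u
      using norm_triangle_ineq3[of "y" "g u"] R(2)[of u] R(3) norm_minus_commute[of y "g u"] by linarith
    have nz: "g u - y \<noteq> 0" for u using far[of u] y by auto
    have b: "norm (cross3 (gk (g u - y)) (g' u)) \<le> (4 * G) / norm y ^ 2" if "u \<in> {0..1}" for u
    proof -
      have "norm (gk (g u - y)) = 1 / norm (g u - y) ^ 2"
        using nz[of u] by (simp add: gk_def power_numeral_reduce)
      also have "\<dots> \<le> 1 / (norm y / 2) ^ 2"
        using far[of u] y by (intro divide_left_mono power_mono mult_pos_pos) auto
      finally have 1: "norm (gk (g u - y)) \<le> 4 / norm y ^ 2" by (simp add: power_divide)
      have "norm (cross3 (gk (g u - y)) (g' u)) \<le> norm (gk (g u - y)) * norm (g' u)"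
        by (rule norm_cross3_le)
      also have "\<dots> \<le> (4 / norm y ^ 2) * G"
        by (intro mult_mono 1 G that) auto
      finally show ?thesis by simp
    qed
    have "norm (integral (cbox 0 1) (\<lambda>u. cross3 (gk (g u - y)) (g' u))) \<le> (4 * G) / norm y ^ 2 * measure lborel (cbox (0::real) 1)"
      by (rule integrable_bound)
        (use b G nz in \<open>auto intro!: integrable_continuous_interval continuous_on_cross3 continuous_on_gk continuous_intros closed_curve_continuous[OF g] closed_curve_continuous'[OF g]\<close>)
    then show ?thesis by (simp add: bs_def)
  qed
  then show thesis using that[of "4 * G"] G by simp
qed

lemma gauss_integrand_continuous:
  assumes g: "closed_curve g g'" and h: "closed_curve h h'" and disj: "range g \<inter> range h = {}"
  shows "continuous_on S (\<lambda>(u, v). gk (g u - h v) \<bullet> cross3 (g' u) (h' v))"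
proof -
  have "g u - h v \<noteq> 0" for u v using disj by auto
  then show ?thesis
    unfolding case_prod_beta
    by (auto intro!: continuous_intros continuous_on_gk continuous_on_cross3
        continuous_on_compose2[OF closed_curve_continuous[OF g, of UNIV]]
        continuous_on_compose2[OF closed_curve_continuous[OF h, of UNIV]]
        continuous_on_compose2[OF closed_curve_continuous'[OF g, of UNIV]]
        continuous_on_compose2[OF closed_curve_continuous'[OF h, of UNIV]])
qed

lemma linking_number_gk:
  assumes g: "closed_curve g g'" and h: "closed_curve h h'"
  shows "linking_number g h = 1 / (4 * pi) *
    integral (cbox (0, 0) (1, 1)) (\<lambda>(u, v). gk (g u - h v) \<bullet> cross3 (g' u) (h' v))"
proof -
  have "vector_derivative g (at u) = g' u" "vector_derivative h (at u) = h' u" for u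
    using g h by (auto simp: closed_curve_def vector_derivative_at)
  then show ?thesis
    by (simp add: linking_number_def gk_def)
qed

text \<open>Integrating over the first curve first leaves the circulation of its field along the
  second. This opens the way to potentials and periods.\<close>

lemma linking_number_bs:
  assumes g: "closed_curve g g'" and h: "closed_curve h h'" and disj: "range g \<inter> range h = {}"
  shows "linking_number g h = 1 / (4 * pi) * integral {0..1} (\<lambda>v. bs g g' (h v) \<bullet> h' v)"
proof -
  note c = gauss_integrand_continuous[OF g h disj]
  let ?G = "\<lambda>u v. gk (g u - h v) \<bullet> cross3 (g' u) (h' v)"
  have "integral (cbox (0, 0) (1, 1)) (\<lambda>(u, v). ?G u v) = integral (cbox 0 1) (\<lambda>u. integral (cbox 0 1) (\<lambda>v. ?G u v))"
    using integral_prod_continuous[OF c] by simp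
  also have "\<dots> = integral (cbox 0 1) (\<lambda>v. integral (cbox 0 1) (\<lambda>u. ?G u v))"
    by (rule integral_swap_continuous[OF c])
  also have "\<dots> = integral (cbox 0 1) (\<lambda>v. bs g g' (h v) \<bullet> h' v)"
  proof (rule integral_cong)
    fix v
    have nz: "g u - h v \<noteq> 0" for u using disj by auto
    have int: "(\<lambda>u. cross3 (gk (g u - h v)) (g' u)) integrable_on {0..1}"
      by (rule integrable_continuous_interval)
        (use nz in \<open>auto intro!: continuous_on_cross3 continuous_on_gk continuous_intros closed_curve_continuous[OF g] closed_curve_continuous'[OF g]\<close>)
    have "?G u v = cross3 (gk (g u - h v)) (g' u) \<bullet> h' v" for u
      by (simp add: cross3_def inner_vec_def sum_3 vector_3 algebra_simps)
    then show "integral (cbox 0 1) (\<lambda>u. ?G u v) = bs g g' (h v) \<bullet> h' v"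
      using integral_linear[OF int bounded_linear_inner_left[of "h' v"]] by (simp add: o_def bs_def)
  qed
  finally show ?thesis by (simp add: linking_number_gk[OF g h])
qed

text \<open>Exchanging the curves changes the sign of the kernel and of the cross product.\<close>

lemma linking_number_commute:
  assumes g: "closed_curve g g'" and h: "closed_curve h h'" and disj: "range g \<inter> range h = {}"
  shows "linking_number g h = linking_number h g"
proof -
  note c = gauss_integrand_continuous[OF g h disj]
  have disj': "range h \<inter> range g = {}" using disj by auto
  note c' = gauss_integrand_continuous[OF h g disj']
  let ?G = "\<lambda>u v. gk (g u - h v) \<bullet> cross3 (g' u) (h' v)"
  let ?H = "\<lambda>v u. gk (h v - g u) \<bullet> cross3 (h' v) (g' u)"
  have GH: "?G u v = ?H v u" for u v
    by (simp add: gk_def norm_minus_commute[of "g u"]) (simp add: cross3_def inner_vec_def sum_3 vector_3 algebra_simps)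
  have "integral (cbox (0, 0) (1, 1)) (\<lambda>(u, v). ?G u v) = integral (cbox 0 1) (\<lambda>u. integral (cbox 0 1) (\<lambda>v. ?G u v))"
    using integral_prod_continuous[OF c] by simp
  also have "\<dots> = integral (cbox 0 1) (\<lambda>v. integral (cbox 0 1) (\<lambda>u. ?G u v))"
    by (rule integral_swap_continuous[OF c])
  also have "\<dots> = integral (cbox 0 1) (\<lambda>v. integral (cbox 0 1) (\<lambda>u. ?H v u))"
    by (simp add: GH)
  also have "\<dots> = integral (cbox (0, 0) (1, 1)) (\<lambda>(u, v). ?H u v)"
    using integral_prod_continuous[OF c'] by simp
  finally show ?thesis by (simp add: linking_number_gk[OF g h] linking_number_gk[OF h g])
qed

subsection \<open>The collar of an embedded torus\<close>

locale embedded_torus =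
  fixes f :: "real \<times> real \<Rightarrow> real^3"
  assumes emb: "torus_smooth_embedding f"
begin

abbreviation nrm :: "real \<times> real \<Rightarrow> real^3" where "nrm \<equiv> unit_normal f"

definition \<Phi> :: "(real \<times> real) \<times> real \<Rightarrow> real^3" where
  "\<Phi> z = f (fst z) + snd z *\<^sub>R nrm (fst z)"

definition D :: "(real \<times> real) \<times> real \<Rightarrow> (real \<times> real) \<times> real \<Rightarrow> real^3" where
  "D z h = frechet_derivative \<Phi> (at z) h"

abbreviation "\<Phi>s z \<equiv> D z ((1, 0), 0)"
abbreviation "\<Phi>t z \<equiv> D z ((0, 1), 0)"

lemma shift_eq: "shift f r x = \<Phi> (x, r)"
  by (simp add: shift_def \<Phi>_def)

lemma f_eq: "f x = \<Phi> (x, 0)"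
  by (simp add: \<Phi>_def)

lemma ck_f: "ck k f"
  using emb by (simp add: torus_smooth_embedding_def smooth_map_ck)

lemma cross_nz: "cross3 (d_s f p) (d_t f p) \<noteq> 0"
  using emb unfolding torus_smooth_embedding_def by blast

lemma ck_nrm: "ck k nrm"
proof -
  have 1: "ck k (d_s f)" "ck k (d_t f)"
    using ck_Suc_derivative[OF ck_f[of "Suc k"]] by (simp_all add: d_s_def[abs_def] d_t_def[abs_def])
  have 2: "ck k (\<lambda>p. cross3 (d_s f p) (d_t f p))"
    by (rule ck_bilinear[OF bounded_bilinear_cross3 1])
  show ?thesis
    unfolding unit_normal_def[abs_def] divide_inverse mult_1
    by (intro ck_bilinear[OF bounded_bilinear_scaleR] ck_inverse ck_norm 2 cross_nz) (simp add: cross_nz)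
qed

lemma ck_\<Phi>: "ck k \<Phi>"
  unfolding \<Phi>_def[abs_def]
  by (intro ck_add ck_bilinear[OF bounded_bilinear_scaleR] ck_linear bounded_linear_snd
      ck_compose_linear[OF bounded_linear_fst] ck_f ck_nrm)

lemma D_has_derivative: "(\<Phi> has_derivative D z) (at z)"
  unfolding D_def[abs_def] by (rule ck_Suc_has_derivative[OF ck_\<Phi>])

lemma D_linear: "linear (D z)"
  using has_derivative_linear[OF D_has_derivative] .

lemma continuous_on_\<Phi>: "continuous_on S g \<Longrightarrow> continuous_on S (\<lambda>x. \<Phi> (g x))"
  using continuous_on_compose2[OF ck_continuous[OF ck_\<Phi>]] by blast

lemma continuous_on_D: "continuous_on S g \<Longrightarrow> continuous_on S (\<lambda>x. D (g x) h)"
  unfolding D_def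
  using continuous_on_compose2[OF ck_continuous[OF ck_Suc_derivative[OF ck_\<Phi>]]] by blast

lemma f_periodic: "f (s + 1, t) = f (s, t)" "f (s, t + 1) = f (s, t)"
  using emb by (auto simp: torus_smooth_embedding_def torus_periodic_def)

lemma nrm_periodic: "nrm (s + 1, t) = nrm (s, t)" "nrm (s, t + 1) = nrm (s, t)"
proof -
  have e: "f (x + (1, 0)) = f x" "f (x + (0, 1)) = f x" for x
    using f_periodic by (cases x; simp)+
  have 1: "frechet_derivative f (at (s + 1, t)) = frechet_derivative f (at (s, t))"
    using frechet_derivative_periodic[where f=f and e="(1,0)" and x="(s,t)", OF e(1)] by simp
  have 2: "frechet_derivative f (at (s, t + 1)) = frechet_derivative f (at (s, t))"
    using frechet_derivative_periodic[where f=f and e="(0,1)" and x="(s,t)", OF e(2)] by simp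
  show "nrm (s + 1, t) = nrm (s, t)" "nrm (s, t + 1) = nrm (s, t)"
    by (simp_all add: unit_normal_def d_s_def d_t_def 1 2)
qed

lemma \<Phi>_periodic: "\<Phi> ((s + 1, t), r) = \<Phi> ((s, t), r)" "\<Phi> ((s, t + 1), r) = \<Phi> ((s, t), r)"
  by (simp_all add: \<Phi>_def f_periodic nrm_periodic)

lemma \<Phi>_int: "\<Phi> ((s + of_int m, t + of_int n), r) = \<Phi> ((s, t), r)"
  using periodic_int_shift[of "\<lambda>s. \<Phi> ((s, t + of_int n), r)" 0 s m]
    periodic_int_shift[of "\<lambda>t. \<Phi> ((s, t), r)" 0 t n] \<Phi>_periodic by simp

lemma D_int: "D ((s + of_int m, t + of_int n), r) = D ((s, t), r)"
proof -
  have e: "\<Phi> (x + ((of_int m, of_int n), 0)) = \<Phi> x" for x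
    using \<Phi>_int by (cases x; cases "fst x"; simp)
  show ?thesis
    unfolding D_def[abs_def]
    using frechet_derivative_periodic[where f=\<Phi> and e="((of_int m, of_int n), 0)" and x="((s,t),r)", OF e] by simp
qed

lemma \<Phi>_frac: "\<Phi> ((s, t), r) = \<Phi> ((frac s, frac t), r)"
  using \<Phi>_int[of "frac s" "\<lfloor>s\<rfloor>" "frac t" "\<lfloor>t\<rfloor>" r] by (simp add: frac_def)

lemma D_frac: "D ((s, t), r) = D ((frac s, frac t), r)"
  using D_int[of "frac s" "\<lfloor>s\<rfloor>" "frac t" "\<lfloor>t\<rfloor>" r] by (simp add: frac_def)

lemma norm_nrm: "norm (nrm x) = 1"
  using cross_nz by (simp add: unit_normal_def)

lemma nrm_inner: "nrm x \<bullet> nrm x = 1"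
  by (simp add: dot_square_norm norm_nrm)

lemma D_expand:
  "D (x, r) h = frechet_derivative f (at x) (fst h) + r *\<^sub>R frechet_derivative nrm (at x) (fst h) + snd h *\<^sub>R nrm x"
proof -
  have 1: "((\<lambda>z. f (fst z)) has_derivative (\<lambda>h. frechet_derivative f (at x) (fst h))) (at (x, r))"
    by (rule has_derivative_compose[where f=fst and g=f])
      (use ck_Suc_has_derivative[OF ck_f] in \<open>auto intro!: derivative_eq_intros\<close>)
  have 2: "((\<lambda>z. nrm (fst z)) has_derivative (\<lambda>h. frechet_derivative nrm (at x) (fst h))) (at (x, r))"
    by (rule has_derivative_compose[where f=fst and g=nrm])
      (use ck_Suc_has_derivative[OF ck_nrm] in \<open>auto intro!: derivative_eq_intros\<close>)
  have "((\<lambda>z. snd z *\<^sub>R nrm (fst z)) has_derivative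
      (\<lambda>h. snd (x, r) *\<^sub>R frechet_derivative nrm (at x) (fst h) + snd h *\<^sub>R nrm (fst (x, r)))) (at (x, r))"
    by (rule has_derivative_scaleR[OF _ 2]) (auto intro!: derivative_eq_intros)
  from has_derivative_add[OF 1 this]
  have "(\<Phi> has_derivative (\<lambda>h. frechet_derivative f (at x) (fst h) + (r *\<^sub>R frechet_derivative nrm (at x) (fst h) + snd h *\<^sub>R nrm x))) (at (x, r))"
    by (simp add: \<Phi>_def[abs_def])
  from has_derivative_unique[OF D_has_derivative this]
  show ?thesis by (metis (no_types, lifting) add.assoc)
qed

lemma D_r: "D z ((0, 0), 1) = nrm (fst z)"
  using D_expand[of "fst z" "snd z" "((0,0),1)"]
    linear_0[OF has_derivative_linear[OF ck_Suc_has_derivative[OF ck_f]]]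
    linear_0[OF has_derivative_linear[OF ck_Suc_has_derivative[OF ck_nrm]]]
  by (simp add: zero_prod_def)

text \<open>At level 0 this is the definition of the normal. Other levels add a multiple of a
  derivative of \<open>nrm\<close>, which is tangential since \<open>nrm\<close> has constant
  length.\<close>

lemma D_normal: "nrm (fst z) \<bullet> D z ((a, b), 0) = 0"
proof -
  obtain x r where z: "z = (x, r)" by (cases z)
  have lin: "linear (frechet_derivative f (at x))"
    using has_derivative_linear[OF ck_Suc_has_derivative[OF ck_f]] .
  have "frechet_derivative f (at x) (a, b) = frechet_derivative f (at x) (a *\<^sub>R (1, 0) + b *\<^sub>R (0, 1))" by simp
  also have "\<dots> = a *\<^sub>R d_s f x + b *\<^sub>R d_t f x"
    by (simp only: linear_add[OF lin] linear_cmul[OF lin] d_s_def d_t_def)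
  finally have 1: "nrm x \<bullet> frechet_derivative f (at x) (a, b) = 0"
    by (simp add: unit_normal_def inner_add_right dot_cross_self)
  have d: "(nrm has_derivative frechet_derivative nrm (at x)) (at x)"
    by (rule ck_Suc_has_derivative[OF ck_nrm])
  have "((\<lambda>x. nrm x \<bullet> nrm x) has_derivative (\<lambda>h. nrm x \<bullet> frechet_derivative nrm (at x) h + frechet_derivative nrm (at x) h \<bullet> nrm x)) (at x)"
    by (rule has_derivative_inner[OF d d])
  then have "((\<lambda>x. 1::real) has_derivative (\<lambda>h. nrm x \<bullet> frechet_derivative nrm (at x) h + frechet_derivative nrm (at x) h \<bullet> nrm x)) (at x)"
    by (simp only: nrm_inner)
  from has_derivative_unique[OF this has_derivative_const]
  have 2: "nrm x \<bullet> frechet_derivative nrm (at x) (a, b) = 0"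
    by (simp add: inner_commute fun_eq_iff)
  show ?thesis
    by (simp add: z D_expand inner_add_right 1 2)
qed

text \<open>The determinant of \<open>D z\<close>, whose third column is the normal.\<close>

definition Jac :: "(real \<times> real) \<times> real \<Rightarrow> real" where
  "Jac z = cross3 (\<Phi>s z) (\<Phi>t z) \<bullet> nrm (fst z)"

lemma D_split: "D z ((a, b), c) = a *\<^sub>R \<Phi>s z + b *\<^sub>R \<Phi>t z + c *\<^sub>R nrm (fst z)"
proof -
  have "D z ((a, b), c) = D z (a *\<^sub>R ((1,0),0) + b *\<^sub>R ((0,1),0) + c *\<^sub>R ((0,0),1))" by simp
  also have "\<dots> = a *\<^sub>R \<Phi>s z + b *\<^sub>R \<Phi>t z + c *\<^sub>R nrm (fst z)"
    by (simp only: linear_add[OF D_linear] linear_cmul[OF D_linear] D_r)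
  finally show ?thesis .
qed

lemma cross_Jac: "cross3 (\<Phi>s z) (\<Phi>t z) = Jac z *\<^sub>R nrm (fst z)"
proof -
  let ?n = "nrm (fst z)" and ?c = "cross3 (\<Phi>s z) (\<Phi>t z)"
  have "cross3 ?n ?c = (?n \<bullet> \<Phi>t z) *\<^sub>R \<Phi>s z - (?n \<bullet> \<Phi>s z) *\<^sub>R \<Phi>t z"
    by (rule Lagrange)
  then have "cross3 ?n ?c = 0" by (simp add: D_normal)
  moreover have "cross3 ?n (cross3 ?n ?c) = (?n \<bullet> ?c) *\<^sub>R ?n - (?n \<bullet> ?n) *\<^sub>R ?c"
    by (rule Lagrange)
  ultimately show ?thesis
    by (simp add: nrm_inner Jac_def inner_commute)
qed

lemma D_inj: assumes "Jac z \<noteq> 0" shows "inj (D z)"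
proof (rule linear_injective_0[OF D_linear, THEN iffD2], intro allI impI)
  fix h assume h: "D z h = 0"
  obtain a b c where abc: "h = ((a, b), c)" by (cases h; cases "fst h") auto
  have eq: "a *\<^sub>R \<Phi>s z + b *\<^sub>R \<Phi>t z + c *\<^sub>R nrm (fst z) = 0"
    using h abc D_split[of z a b c] by simp
  have "c = nrm (fst z) \<bullet> (a *\<^sub>R \<Phi>s z + b *\<^sub>R \<Phi>t z + c *\<^sub>R nrm (fst z))"
    by (simp add: inner_add_right D_normal nrm_inner)
  then have c: "c = 0" by (simp add: eq)
  have "a *\<^sub>R cross3 (\<Phi>s z) (\<Phi>t z) = cross3 (a *\<^sub>R \<Phi>s z + b *\<^sub>R \<Phi>t z + c *\<^sub>R nrm (fst z)) (\<Phi>t z)"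
    by (simp add: c cross_add_left cross_mult_left)
  then have "a *\<^sub>R cross3 (\<Phi>s z) (\<Phi>t z) = 0" by (simp add: eq)
  moreover have "b *\<^sub>R cross3 (\<Phi>s z) (\<Phi>t z) = cross3 (\<Phi>s z) (a *\<^sub>R \<Phi>s z + b *\<^sub>R \<Phi>t z + c *\<^sub>R nrm (fst z))"
    by (simp add: c cross_add_right cross_mult_right)
  then have "b *\<^sub>R cross3 (\<Phi>s z) (\<Phi>t z) = 0" by (simp add: eq)
  ultimately have "a = 0 \<and> b = 0"
    using assms by (auto simp: Jac_def)
  then show "h = 0" by (simp add: abc c zero_prod_def)
qed

lemma Jac_0: "Jac (x, 0) > 0"
proof -
  have "\<Phi>s (x, 0) = d_s f x" "\<Phi>t (x, 0) = d_t f x"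
    by (simp_all add: D_expand d_s_def d_t_def)
  then show ?thesis
    using cross_nz[of x] by (simp add: Jac_def unit_normal_def power2_norm_eq_inner[symmetric])
qed

lemma continuous_on_nrm: "continuous_on S g \<Longrightarrow> continuous_on S (\<lambda>x. nrm (g x))"
  using continuous_on_compose2[OF ck_continuous[OF ck_nrm]] by blast

lemma continuous_on_Jac: "continuous_on S Jac"
  unfolding Jac_def
  by (intro continuous_intros continuous_on_cross3 continuous_on_D continuous_on_nrm)

text \<open>The Jacobian is positive on the compact unit square at level 0, hence on a uniform
  neighbourhood of it; periodicity carries this to all parameters.\<close>

lemma Jac_pos_near: "\<exists>\<delta>>0. \<forall>s t r. \<bar>r\<bar> < \<delta> \<longrightarrow> Jac ((s, t), r) > 0"
proof -
  let ?K = "({0..1::real} \<times> {0..1::real}) \<times> {0::real}" and ?U = "{z. Jac z > 0}"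
  have "open ?U"
    using open_Collect_less[OF continuous_on_const continuous_on_Jac[of UNIV]] .
  moreover have "compact ?K" by (intro compact_Times) auto
  moreover have "?K \<subseteq> ?U" using Jac_0 by auto
  moreover have "?K \<noteq> {}" by auto
  ultimately obtain e where e: "e > 0" "{x. infdist x ?K \<le> e} \<subseteq> ?U"
    using compact_in_open_separated[of ?K ?U] by blast
  have "Jac ((s, t), r) > 0" if r: "\<bar>r\<bar> < e" for s t r
  proof -
    have "infdist ((frac s, frac t), r) ?K \<le> dist ((frac s, frac t), r) ((frac s, frac t), 0)"
      by (rule infdist_le) (auto simp: frac_lt_1 less_imp_le)
    also have "\<dots> \<le> e" using r by (simp add: dist_Pair_Pair)
    finally have "Jac ((frac s, frac t), r) > 0" using e by auto
    moreover have "nrm (frac s, frac t) = D ((frac s, frac t), r) ((0,0),1)" "nrm (s, t) = D ((s, t), r) ((0,0),1)"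
      by (simp_all add: D_r)
    ultimately show ?thesis by (simp add: Jac_def D_frac[of s t r])
  qed
  then show ?thesis using e by blast
qed

lemma \<Phi>_locally_inj: obtains \<rho> where "\<rho> > 0" "inj_on \<Phi> (ball (x, 0) \<rho>)"
proof -
  have J: "Jac (x, 0) \<noteq> 0" using Jac_0[of x] by simp
  obtain G where G: "linear G" "G \<circ> D (x, 0) = id"
    using linear_injective_left_inverse[OF D_linear D_inj[OF J]] by blast
  have bl: "bounded_linear (D z)" for z using has_derivative_bounded_linear[OF D_has_derivative] .
  have c: "continuous_on UNIV (\<lambda>z. Blinfun (D z))"
    by (rule continuous_on_blinfun_componentwise)
      (auto simp: bounded_linear_Blinfun_apply[OF bl] intro!: continuous_on_D continuous_intros)
  show thesis
  proof (rule has_derivative_locally_injective[of "(x, 0)" UNIV G D \<Phi>])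
    fix e :: real assume "e > 0"
    then obtain d where d: "d > 0" "\<And>z. dist z (x, 0) < d \<Longrightarrow> dist (Blinfun (D z)) (Blinfun (D (x, 0))) < e"
      using c[unfolded continuous_on_iff] by (metis UNIV_I)
    have "onorm (\<lambda>v. D z v - D (x, 0) v) < e" if "dist (x, 0) z < d" for z
    proof -
      have "onorm (\<lambda>v. D z v - D (x, 0) v) = norm (Blinfun (D z) - Blinfun (D (x, 0)))"
        by (simp add: norm_blinfun.rep_eq minus_blinfun.rep_eq bounded_linear_Blinfun_apply[OF bl])
      then show ?thesis using d(2)[of z] that by (metis dist_commute dist_norm)
    qed
    then show "\<exists>d>0. \<forall>z. dist (x, 0) z < d \<longrightarrow> onorm (\<lambda>v. D z v - D (x, 0) v) < e"
      using d by blast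
  next
      show "bounded_linear G" using G(1) linear_conv_bounded_linear by blast
  qed (use G that D_has_derivative in auto)
qed

text \<open>Otherwise two sequences of colliding points would converge to points of the torus with the same image,
  hence, after a lattice translation, to the same point, where \<open>\<Phi>\<close> is locally injective.\<close>
lemma \<Phi>_inj_near:
  "\<exists>\<delta>>0. \<forall>s t r s' t' r'. \<bar>r\<bar> < \<delta> \<and> \<bar>r'\<bar> < \<delta> \<and> \<Phi> ((s, t), r) = \<Phi> ((s', t'), r')
      \<longrightarrow> s - s' \<in> \<int> \<and> t - t' \<in> \<int> \<and> r = r'"
proof (rule ccontr)
  assume neg: "\<not> ?thesis"
  have "\<exists>s t r s' t' r'. \<bar>r\<bar> < inverse (Suc k) \<and> \<bar>r'\<bar> < inverse (Suc k) \<and> \<Phi> ((s, t), r) = \<Phi> ((s', t'), r')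
      \<and> \<not> (s - s' \<in> \<int> \<and> t - t' \<in> \<int> \<and> r = r')" for k :: nat
  proof -
    have "inverse (real (Suc k)) > 0" by simp
    then show ?thesis using neg by blast
  qed
  then obtain s t r s' t' r' where *: "\<And>k. \<bar>r k\<bar> < inverse (Suc k)" "\<And>k. \<bar>r' k\<bar> < inverse (Suc k)"
      "\<And>k::nat. \<Phi> ((s k, t k), r k) = \<Phi> ((s' k, t' k), r' k)"
      "\<And>k. \<not> (s k - s' k \<in> \<int> \<and> t k - t' k \<in> \<int> \<and> r k = r' k)"
    by metis
  \<comment> \<open>Passing to fractional parts keeps the images under \<open>\<Phi>\<close> and
    confines both sequences to a compact box.\<close>
  define a where "a k = ((frac (s k), frac (t k)), r k)" for k
  define a' where "a' k = ((frac (s' k), frac (t' k)), r' k)" for k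
  let ?C = "({0..1::real} \<times> {0..1::real}) \<times> {-1..1::real}"
  have "inverse (real (Suc k)) \<le> 1" for k by (simp add: field_simps)
  then have aC: "(a k, a' k) \<in> ?C \<times> ?C" for k
    using *(1,2)[of k] unfolding a_def a'_def
    by (auto simp: frac_lt_1 less_imp_le abs_less_iff) (smt (verit, best))+
  have "compact (?C \<times> ?C)" by (intro compact_Times) auto
  then obtain L \<phi> where L: "L \<in> ?C \<times> ?C" "strict_mono (\<phi> :: nat \<Rightarrow> nat)" "((\<lambda>k. (a k, a' k)) \<circ> \<phi>) \<longlonglongrightarrow> L"
    using aC unfolding compact_def by meson
  obtain l l' where ll: "L = (l, l')" by (cases L)
  have lim: "(\<lambda>k. a (\<phi> k)) \<longlonglongrightarrow> l" "(\<lambda>k. a' (\<phi> k)) \<longlonglongrightarrow> l'"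
    using tendsto_fst[OF L(3)] tendsto_snd[OF L(3)] by (simp_all add: ll o_def)
  have inv0: "(\<lambda>k. inverse (real (Suc (\<phi> k)))) \<longlonglongrightarrow> 0"
    using LIMSEQ_subseq_LIMSEQ[OF LIMSEQ_inverse_real_of_nat L(2)] by (simp add: o_def)
  have "(\<lambda>k. r (\<phi> k)) \<longlonglongrightarrow> 0" "(\<lambda>k. r' (\<phi> k)) \<longlonglongrightarrow> 0"
    by (rule tendsto_rabs_zero_cancel, rule tendsto_sandwich[OF _ _ tendsto_const inv0];
        use *(1,2) in \<open>auto intro!: always_eventually less_imp_le\<close>)+
  then have l0: "snd l = 0" "snd l' = 0"
    using tendsto_snd[OF lim(1)] tendsto_snd[OF lim(2)] LIMSEQ_unique by (fastforce simp: a_def a'_def)+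
  have \<Phi>a: "\<Phi> (a k) = \<Phi> (a' k)" for k
    using *(3)[of k] by (simp add: a_def a'_def \<Phi>_frac[of "s k"] \<Phi>_frac[of "s' k"])
  have cont: "isCont \<Phi> z" for z
    using ck_continuous[OF ck_\<Phi>] continuous_on_eq_continuous_at open_UNIV by blast
  have "(\<lambda>k. \<Phi> (a (\<phi> k))) \<longlonglongrightarrow> \<Phi> l" "(\<lambda>k. \<Phi> (a' (\<phi> k))) \<longlonglongrightarrow> \<Phi> l'"
    using isCont_tendsto_compose[OF cont] lim by blast+
  then have "\<Phi> l = \<Phi> l'" using LIMSEQ_unique by (simp add: \<Phi>a)
  then have "f (fst l) = f (fst l')" by (simp add: \<Phi>_def l0)
  then have "fst (fst l) - fst (fst l') \<in> \<int> \<and> snd (fst l) - snd (fst l') \<in> \<int>"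
    using emb unfolding torus_smooth_embedding_def by (metis prod.collapse)
  then obtain m n :: int where mn: "fst (fst l) - fst (fst l') = of_int m" "snd (fst l) - snd (fst l') = of_int n"
    by (auto elim!: Ints_cases)
  define e where "e = ((real_of_int m, real_of_int n), 0::real)"
  have "l' + e = l" using mn l0 by (cases l; cases l'; auto simp: e_def)
  then have lim2: "(\<lambda>k. a' (\<phi> k) + e) \<longlonglongrightarrow> l" using tendsto_add[OF lim(2) tendsto_const[of e]] by simp
  have \<Phi>e: "\<Phi> (z + e) = \<Phi> z" for z
    using \<Phi>_int by (cases z; cases "fst z"; simp add: e_def)
  obtain \<rho> where \<rho>: "\<rho> > 0" "inj_on \<Phi> (ball l \<rho>)"
    using \<Phi>_locally_inj[of "fst l"] l0 by (metis prod.collapse)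
  have "\<forall>\<^sub>F k in sequentially. dist (a (\<phi> k)) l < \<rho> \<and> dist (a' (\<phi> k) + e) l < \<rho>"
    by (intro eventually_conj tendstoD lim(1) lim2 \<rho>)
  then obtain k where k: "dist (a (\<phi> k)) l < \<rho>" "dist (a' (\<phi> k) + e) l < \<rho>"
    using eventually_sequentially by auto
  have "a (\<phi> k) = a' (\<phi> k) + e"
    using \<rho>(2) k \<Phi>a[of "\<phi> k"] by (auto simp: inj_on_def \<Phi>e dist_commute)
  then have "frac (s (\<phi> k)) - frac (s' (\<phi> k)) = of_int m" "frac (t (\<phi> k)) - frac (t' (\<phi> k)) = of_int n" "r (\<phi> k) = r' (\<phi> k)"
    by (auto simp: a_def a'_def e_def)
  moreover have "x - y = of_int (\<lfloor>x\<rfloor> - \<lfloor>y\<rfloor>) + (frac x - frac y)" for x y :: real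
    by (simp add: frac_def)
  ultimately show False using *(4)[of "\<phi> k"] by (metis Ints_add Ints_of_int)
qed

definition tube :: "real \<Rightarrow> bool" where
  "tube \<delta> \<longleftrightarrow> \<delta> > 0 \<and> (\<forall>s t r. \<bar>r\<bar> < \<delta> \<longrightarrow> Jac ((s, t), r) > 0) \<and>
    (\<forall>s t r s' t' r'. \<bar>r\<bar> < \<delta> \<and> \<bar>r'\<bar> < \<delta> \<and> \<Phi> ((s, t), r) = \<Phi> ((s', t'), r')
      \<longrightarrow> s - s' \<in> \<int> \<and> t - t' \<in> \<int> \<and> r = r')"

lemma tube_exists: "\<exists>\<delta>. tube \<delta>"
proof -
  obtain d1 where "d1 > 0" "\<forall>s t r. \<bar>r\<bar> < d1 \<longrightarrow> Jac ((s, t), r) > 0"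
    using Jac_pos_near by blast
  moreover obtain d2 where "d2 > 0" "\<forall>s t r s' t' r'. \<bar>r\<bar> < d2 \<and> \<bar>r'\<bar> < d2 \<and> \<Phi> ((s, t), r) = \<Phi> ((s', t'), r')
      \<longrightarrow> s - s' \<in> \<int> \<and> t - t' \<in> \<int> \<and> r = r'"
    using \<Phi>_inj_near by blast
  ultimately have "tube (min d1 d2)"
    unfolding tube_def min_less_iff_conj by (intro conjI allI impI; blast)
  then show ?thesis by blast
qed

end

subsection \<open>The linking form\<close>

locale torus_collar = embedded_torus +
  fixes \<delta> :: real
  assumes tube: "tube \<delta>"
begin

lemma \<delta>_pos: "\<delta> > 0" using tube by (simp add: tube_def)

lemma Jac_pos: "\<bar>r\<bar> < \<delta> \<Longrightarrow> Jac ((s, t), r) > 0" using tube by (simp add: tube_def)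

lemma \<Phi>_inj:
  "\<bar>r\<bar> < \<delta> \<Longrightarrow> \<bar>r'\<bar> < \<delta> \<Longrightarrow> \<Phi> ((s, t), r) = \<Phi> ((s', t'), r') \<Longrightarrow> s - s' \<in> \<int> \<and> t - t' \<in> \<int> \<and> r = r'"
  using tube[unfolded tube_def, THEN conjunct2, THEN conjunct2, THEN spec[of _ s], THEN spec[of _ t], THEN spec[of _ r],
      THEN spec[of _ s'], THEN spec[of _ t'], THEN spec[of _ r']] by simp

definition cv :: "real \<times> real \<Rightarrow> int \<times> int \<Rightarrow> real \<Rightarrow> real \<Rightarrow> real^3" where
  "cv x c r u = \<Phi> (x + u *\<^sub>R (of_int (fst c), of_int (snd c)), r)"

definition cv' :: "real \<times> real \<Rightarrow> int \<times> int \<Rightarrow> real \<Rightarrow> real \<Rightarrow> real^3" where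
  "cv' x c r u = D (x + u *\<^sub>R (of_int (fst c), of_int (snd c)), r) ((of_int (fst c), of_int (snd c)), 0)"

lemma closed_curve_cv: "closed_curve (cv x c r) (cv' x c r)"
proof -
  let ?c = "((real_of_int (fst c), real_of_int (snd c)), 0::real)"
  have eq: "(x + u *\<^sub>R (real_of_int (fst c), real_of_int (snd c)), r) = (x, r) + u *\<^sub>R ?c" for u by simp
  have "(cv x c r has_vector_derivative cv' x c r u) (at u)" for u
    using ck_has_vector_derivative_line[OF ck_\<Phi>, of "(x, r)" ?c u UNIV]
    by (simp only: cv_def[abs_def] cv'_def D_def eq)
  moreover have "continuous_on UNIV (cv' x c r)"
    unfolding cv'_def[abs_def] by (intro continuous_on_D continuous_intros)
  moreover have "cv x c r (u + 1) = cv x c r u" for u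
    using \<Phi>_int[of "fst x + u * real_of_int (fst c)" "fst c" "snd x + u * real_of_int (snd c)" "snd c" r]
    by (cases x) (simp add: cv_def algebra_simps)
  ultimately show ?thesis by (simp add: closed_curve_def)
qed

lemma \<Phi>_notin_cv: "\<bar>r\<bar> < \<delta> \<Longrightarrow> \<bar>r'\<bar> < \<delta> \<Longrightarrow> r \<noteq> r' \<Longrightarrow> \<Phi> (y, r) \<notin> range (cv x c r')"
proof
  assume r: "\<bar>r\<bar> < \<delta>" "\<bar>r'\<bar> < \<delta>" "r \<noteq> r'" and "\<Phi> (y, r) \<in> range (cv x c r')"
  then obtain u where "\<Phi> (y, r) = cv x c r' u" by blast
  then obtain z where "\<Phi> (y, r) = \<Phi> (z, r')" unfolding cv_def by blast
  then show False using \<Phi>_inj[OF r(1,2)] r(3) by (cases y; cases z) blast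
qed

lemma cv_disjoint: "\<bar>r\<bar> < \<delta> \<Longrightarrow> \<bar>r'\<bar> < \<delta> \<Longrightarrow> r \<noteq> r' \<Longrightarrow> range (cv x c r) \<inter> range (cv y d r') = {}"
proof (rule equals0I)
  fix z assume r: "\<bar>r\<bar> < \<delta>" "\<bar>r'\<bar> < \<delta>" "r \<noteq> r'" and z: "z \<in> range (cv x c r) \<inter> range (cv y d r')"
  then obtain u where "z = cv x c r u" by blast
  then show False using \<Phi>_notin_cv[OF r, of _ y d] z unfolding cv_def[of x c r] by blast
qed

text \<open>The level \<open>\<rho>\<close> of the curve cuts the collar in two, and its field is
  regular on each piece. The periods of a potential there are \<open>4 * pi\<close> times linking
  numbers, which are therefore linear in \<open>d\<close> and blind to \<open>y\<close> and
  \<open>\<sigma>\<close>.\<close>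

lemma cv_potential:
  assumes \<rho>: "\<bar>\<rho>\<bar> < \<delta>" and I: "-\<delta> \<le> lo" "hi \<le> \<delta>" "hi \<le> \<rho> \<or> \<rho> \<le> lo"
  shows "\<exists>a b p. torus_potential (bs (cv x c \<rho>) (cv' x c \<rho>)) \<Phi> lo hi a b p \<and>
    (\<forall>y d \<sigma>. lo < \<sigma> \<and> \<sigma> < hi \<longrightarrow>
      linking_number (cv x c \<rho>) (cv y d \<sigma>) = (of_int (fst d) * a + of_int (snd d) * b) / (4 * pi))"
proof -
  let ?B = "bs (cv x c \<rho>) (cv' x c \<rho>)"
  from bs_field[OF closed_curve_cv[of x c \<rho>]]
  obtain B' where B': "\<forall>y\<in>- range (cv x c \<rho>). (?B has_derivative blinfun_apply (B' y)) (at y)"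
    "continuous_on (- range (cv x c \<rho>)) B'"
    "\<forall>y\<in>- range (cv x c \<rho>). \<forall>a b. B' y a \<bullet> b = B' y b \<bullet> a"
    by (elim exE conjE) (rule that)
  have sub: "\<Phi> ((s, t), r) \<in> - range (cv x c \<rho>)" if "lo < r" "r < hi" for s t r
  proof -
    have "\<bar>r\<bar> < \<delta>" "r \<noteq> \<rho>" using that I by auto
    then show ?thesis using \<Phi>_notin_cv[OF _ \<rho>] by blast
  qed
  obtain a b p where p: "torus_potential ?B \<Phi> lo hi a b p"
    using torus_potential_exists[OF bspec[OF B'(1)] B'(2) B'(3)[rule_format] ck_\<Phi> \<Phi>_periodic sub] by blast
  have "linking_number (cv x c \<rho>) (cv y d \<sigma>) = (of_int (fst d) * a + of_int (snd d) * b) / (4 * pi)"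
    if "lo < \<sigma>" "\<sigma> < hi" for y d \<sigma>
  proof -
    have "linking_number (cv x c \<rho>) (cv y d \<sigma>) = 1 / (4 * pi) * integral {0..1} (\<lambda>v. ?B (cv y d \<sigma> v) \<bullet> cv' y d \<sigma> v)"
      by (rule linking_number_bs[OF closed_curve_cv closed_curve_cv cv_disjoint]) (use \<rho> I that in auto)
    moreover have "integral {0..1} (\<lambda>v. ?B (cv y d \<sigma> v) \<bullet> cv' y d \<sigma> v) = of_int (fst d) * a + of_int (snd d) * b"
      using integral_unique[OF torus_potential_period[OF p that, of y "fst d" "snd d"]]
      by (simp add: cv_def cv'_def D_def)
    ultimately show ?thesis by simp
  qed
  then show ?thesis using p by blast
qed

text \<open>Any two levels of the collar, the first above the second, would give the same number.\<close>
definition lnk :: "int \<times> int \<Rightarrow> int \<times> int \<Rightarrow> real" where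
  "lnk b c = linking_number (cv 0 b (\<delta> / 2)) (cv 0 c 0)"

text \<open>\<open>cv_potential\<close> moves the second curve; the symmetry of the linking number
  transfers this to the first one.\<close>

lemma linking_cv_left:
  assumes "-\<delta> < \<sigma>" "\<sigma> < \<rho>" "\<rho> < \<delta>" "\<sigma> < \<rho>'" "\<rho>' < \<delta>"
  shows "linking_number (cv x b \<rho>) (cv y c \<sigma>) = linking_number (cv x' b \<rho>') (cv y c \<sigma>)"
proof -
  have 1: "linking_number (cv z b r) (cv y c \<sigma>) = linking_number (cv y c \<sigma>) (cv z b r)" if "\<sigma> < r" "r < \<delta>" for z r
    by (rule linking_number_commute[OF closed_curve_cv closed_curve_cv cv_disjoint]) (use that assms in auto)
  have "\<bar>\<sigma>\<bar> < \<delta>" "-\<delta> \<le> \<sigma>" using assms by auto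
  then obtain a a' where "\<And>x d r. \<sigma> < r \<Longrightarrow> r < \<delta> \<Longrightarrow>
      linking_number (cv y c \<sigma>) (cv x d r) = (of_int (fst d) * a + of_int (snd d) * a') / (4 * pi)"
    using cv_potential[of \<sigma> \<sigma> \<delta> y c] by blast
  then show ?thesis using 1 assms by simp
qed

lemma linking_cv_right:
  assumes "-\<delta> < \<sigma>" "\<sigma> < \<rho>" "\<rho> < \<delta>" "-\<delta> < \<sigma>'" "\<sigma>' < \<rho>"
  shows "linking_number (cv x b \<rho>) (cv y c \<sigma>) = linking_number (cv x b \<rho>) (cv y' c \<sigma>')"
proof -
  have "\<bar>\<rho>\<bar> < \<delta>" "\<rho> \<le> \<delta>" using assms by auto
  then obtain a a' where "\<And>x' d r. -\<delta> < r \<Longrightarrow> r < \<rho> \<Longrightarrow>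
      linking_number (cv x b \<rho>) (cv x' d r) = (of_int (fst d) * a + of_int (snd d) * a') / (4 * pi)"
    using cv_potential[of \<rho> "-\<delta>" \<rho> x b] by blast
  then show ?thesis using assms by simp
qed

lemma linking_cv:
  assumes "-\<delta> < \<sigma>" "\<sigma> < \<rho>" "\<rho> < \<delta>"
  shows "linking_number (cv x b \<rho>) (cv y c \<sigma>) = lnk b c"
proof -
  \<comment> \<open>The lower curve can go to level 0 only below the upper one, so the upper one is
    first raised to at least \<open>\<delta> / 2\<close>.\<close>
  have "linking_number (cv x b \<rho>) (cv y c \<sigma>) = linking_number (cv 0 b (max \<rho> (\<delta>/2))) (cv y c \<sigma>)"
    by (rule linking_cv_left) (use assms \<delta>_pos in auto)
  also have "\<dots> = linking_number (cv 0 b (max \<rho> (\<delta>/2))) (cv 0 c 0)"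
    by (rule linking_cv_right) (use assms \<delta>_pos in auto)
  also have "\<dots> = lnk b c"
    unfolding lnk_def by (rule linking_cv_left) (use assms \<delta>_pos in auto)
  finally show ?thesis .
qed

lemma lnk_linear_right: "lnk b c = of_int (fst c) * lnk b (1, 0) + of_int (snd c) * lnk b (0, 1)"
proof -
  have "\<bar>\<delta>/2\<bar> < \<delta>" "\<delta>/2 \<le> \<delta>" using \<delta>_pos by auto
  then obtain a a' where *: "\<And>y d r. -\<delta> < r \<Longrightarrow> r < \<delta>/2 \<Longrightarrow>
      linking_number (cv 0 b (\<delta>/2)) (cv y d r) = (of_int (fst d) * a + of_int (snd d) * a') / (4 * pi)"
    using cv_potential[of "\<delta>/2" "-\<delta>" "\<delta>/2" 0 b] by blast
  have "lnk b d = (of_int (fst d) * a + of_int (snd d) * a') / (4 * pi)" for d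
    unfolding lnk_def using *[of 0 0 d] \<delta>_pos by simp
  then show ?thesis by (simp add: add_divide_distrib)
qed

lemma lnk_linear_left: "lnk b c = of_int (fst b) * lnk (1, 0) c + of_int (snd b) * lnk (0, 1) c"
proof -
  have "\<bar>0\<bar> < \<delta>" "- \<delta> \<le> 0" using \<delta>_pos by auto
  then obtain a a' where *: "\<And>y d r. 0 < r \<Longrightarrow> r < \<delta> \<Longrightarrow>
      linking_number (cv 0 c 0) (cv y d r) = (of_int (fst d) * a + of_int (snd d) * a') / (4 * pi)"
    using cv_potential[of "0" "0" "\<delta>" 0 c] by blast
  have "lnk d c = (of_int (fst d) * a + of_int (snd d) * a') / (4 * pi)" for d
    unfolding lnk_def
    using *[of "\<delta>/2" 0 d] \<delta>_pos linking_number_commute[OF closed_curve_cv closed_curve_cv cv_disjoint, of "\<delta>/2" 0] by simp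
  then show ?thesis by (simp add: add_divide_distrib)
qed

text \<open>The pushed-off cycle \<open>c\<close> lies on the positive side and becomes the upper
  curve, the first argument of \<open>lnk\<close>: hence the exchange.\<close>

lemma seifert_lk_eq:
  assumes "0 < eps" "eps < \<delta>"
  shows "seifert_lk f eps b c = lnk c b"
proof -
  have 1: "f \<circ> torus_loop b = cv 0 b 0" "shift f eps \<circ> torus_loop c = cv 0 c eps"
    by (auto simp: fun_eq_iff torus_loop_def cv_def shift_eq f_eq mult.commute)
  have "linking_number (cv 0 b 0) (cv 0 c eps) = linking_number (cv 0 c eps) (cv 0 b 0)"
    by (rule linking_number_commute[OF closed_curve_cv closed_curve_cv cv_disjoint]) (use assms in auto)
  then show ?thesis
    unfolding seifert_lk_def 1 using linking_cv assms \<delta>_pos by simp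
qed

end

subsection \<open>Integrality of the Gauss integral\<close>

text \<open>\<open>\<psi>\<psi>\<^sup>\<dagger> = k (|x| + x\<cdot>\<sigma>)\<close> with the Pauli matrices \<open>\<sigma>\<close>, for the spinor \<open>\<psi> = (p, q)\<close>.\<close>
lemma spinor_exists:
  fixes x :: "real^3"
  assumes "x \<noteq> 0"
  shows "\<exists>p q k. k > 0 \<and> p * cnj p = of_real (k * (norm x + x$3)) \<and> q * cnj q = of_real (k * (norm x - x$3))
    \<and> p * cnj q = of_real k * Complex (x$1) (- x$2)"
proof -
  have n: "norm x ^ 2 = (x$1)^2 + (x$2)^2 + (x$3)^2"
    using dot_square_norm[of x] by (simp add: inner_vec_def sum_3 power2_eq_square)
  have le: "\<bar>x$3\<bar> \<le> norm x" by (rule component_le_norm_cart)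
  show ?thesis
  proof (cases "norm x + x$3 = 0")
    \<comment> \<open>On the negative third axis the spinor of the generic case vanishes; the
      spin-down spinor \<open>(0, 1)\<close> replaces it.\<close>
    case True
    then have "x$3 = - norm x" by simp
    with n have "(x$1)^2 + (x$2)^2 = 0" by simp
    then have 0: "x$1 = 0" "x$2 = 0" by (simp_all add: sum_power2_eq_zero_iff)
    have "norm x > 0" using assms by simp
    with True 0 show ?thesis
      by (intro exI[of _ 0] exI[of _ 1] exI[of _ "1 / (2 * norm x)"])
        (auto simp: complex_eq_iff field_simps)
  next
    case False
    with le have pos: "norm x + x$3 > 0" by linarith
    have "(norm x + x$3) * (norm x - x$3) = (x$1)^2 + (x$2)^2"
      using n by (simp add: algebra_simps power2_eq_square)
    with pos show ?thesis
      by (intro exI[of _ "of_real (norm x + x$3)"] exI[of _ "Complex (x$1) (x$2)"] exI[of _ "norm x + x$3"])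
        (auto simp: complex_eq_iff power2_eq_square)
  qed
qed

text \<open>Denominator and numerator of the van Oosterom-Strackee formula for the tangent of half
  the solid angle, as real and imaginary part.\<close>

definition tri :: "real^3 \<Rightarrow> real^3 \<Rightarrow> real^3 \<Rightarrow> complex" where
  "tri a b c = Complex (norm a * norm b * norm c + (a \<bullet> b) * norm c + (b \<bullet> c) * norm a + (c \<bullet> a) * norm b)
    (a \<bullet> cross3 b c)"

text \<open>\<open>tri a b c\<close> has half the solid angle of the triangle as its argument; it is the holonomy around the triangle
  of the link phases \<open>l\<close>.\<close>
lemma link_phases:
  obtains l :: "real^3 \<Rightarrow> real^3 \<Rightarrow> complex" where
    "\<And>a b. l b a = cnj (l a b)"
    "\<And>a b c. a \<noteq> 0 \<Longrightarrow> b \<noteq> 0 \<Longrightarrow> c \<noteq> 0 \<Longrightarrow> \<exists>k>0. l a b * l b c * l c a = of_real k * tri a b c"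
proof -
  obtain p q k where *: "\<And>x::real^3. x \<noteq> 0 \<Longrightarrow> k x > 0 \<and> p x * cnj (p x) = of_real (k x * (norm x + x$3))
      \<and> q x * cnj (q x) = of_real (k x * (norm x - x$3))
      \<and> p x * cnj (q x) = of_real (k x) * Complex (x$1) (- x$2)"
    using spinor_exists by metis
  define l where "l a b = cnj (p a) * p b + cnj (q a) * q b" for a b
  have "\<exists>k>0. l a b * l b c * l c a = of_real k * tri a b c" if nz: "a \<noteq> 0" "b \<noteq> 0" "c \<noteq> 0" for a b c
  proof -
    have pp: "p x * cnj (p x) = of_real (k x * (norm x + x$3))" and qq: "q x * cnj (q x) = of_real (k x * (norm x - x$3))"
      and pq: "p x * cnj (q x) = of_real (k x) * Complex (x$1) (- x$2)" if "x \<noteq> 0" for x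
      using *[OF that] by auto
    have qp: "q x * cnj (p x) = of_real (k x) * Complex (x$1) (x$2)" if "x \<noteq> 0" for x
    proof -
      have "q x * cnj (p x) = cnj (p x * cnj (q x))" by simp
      also have "\<dots> = of_real (k x) * Complex (x$1) (x$2)"
        using *[OF that] by (simp add: complex_eq_iff)
      finally show ?thesis .
    qed
    \<comment> \<open>The product is the trace of the product of the three rank-one matrices built
      from the spinors. In terms of Pauli matrices this trace is twice \<open>tri a b c\<close>, up
      to the three normalising factors.\<close>
    have "l a b * l b c * l c a =
        (p a * cnj (p a)) * (p b * cnj (p b)) * (p c * cnj (p c)) + (q a * cnj (p a)) * (p b * cnj (p b)) * (p c * cnj (q c))
      + (p a * cnj (p a)) * (p b * cnj (q b)) * (q c * cnj (p c)) + (q a * cnj (p a)) * (p b * cnj (q b)) * (q c * cnj (q c))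
      + (p a * cnj (q a)) * (q b * cnj (p b)) * (p c * cnj (p c)) + (q a * cnj (q a)) * (q b * cnj (p b)) * (p c * cnj (q c))
      + (p a * cnj (q a)) * (q b * cnj (q b)) * (q c * cnj (p c)) + (q a * cnj (q a)) * (q b * cnj (q b)) * (q c * cnj (q c))"
      unfolding l_def by (simp add: algebra_simps)
    also have "\<dots> = of_real (2 * k a * k b * k c) * tri a b c"
      unfolding pp[OF nz(1)] pp[OF nz(2)] pp[OF nz(3)] pq[OF nz(1)] pq[OF nz(2)] pq[OF nz(3)]
        qq[OF nz(1)] qq[OF nz(2)] qq[OF nz(3)] qp[OF nz(1)] qp[OF nz(2)] qp[OF nz(3)]
      by (simp add: tri_def complex_eq_iff inner_vec_def sum_3 cross3_def vector_3) (intro conjI; algebra)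
    finally show ?thesis
      using *[OF nz(1)] *[OF nz(2)] *[OF nz(3)] by (intro exI[of _ "2 * k a * k b * k c"]) auto
  qed
  moreover have "l b a = cnj (l a b)" for a b by (simp add: l_def)
  ultimately show thesis using that by blast
qed

text \<open>Only in the right half-plane is \<open>arctan\<close> the argument. This is why the grid
  has to be so fine that all its triangles have positive real part.\<close>

lemma sgn_eq_cis_arctan:
  assumes "Re z > 0"
  shows "sgn z = cis (arctan (Im z / Re z))"
proof -
  let ?y = "Im z / Re z"
  have "cmod z = Re z * sqrt (1 + ?y^2)"
  proof -
    have "(Re z)^2 + (Im z)^2 = (Re z)^2 * (1 + ?y^2)"
      using assms by (simp add: field_simps power2_eq_square)
    then show ?thesis using assms by (simp add: cmod_def real_sqrt_mult)
  qed
  moreover have "sqrt (1 + ?y^2) > 0" by (simp add: add_pos_nonneg)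
  ultimately show ?thesis
    using assms by (auto simp: complex_eq_iff cos_arctan sin_arctan sgn_div_norm field_simps)
qed

lemma telescope_quotient:
  fixes h :: "nat \<Rightarrow> complex"
  assumes "\<And>j. h j \<noteq> 0"
  shows "(\<Prod>j<N. h j / h (Suc j)) = h 0 / h N"
  by (induction N) (use assms in \<open>auto simp: field_simps\<close>)

text \<open>Each edge of the periodic grid is traversed once in either direction, so that the link phases cancel.\<close>
lemma grid_holonomy:
  fixes x :: "nat \<Rightarrow> nat \<Rightarrow> real^3"
  assumes per: "\<And>j. x N j = x 0 j" "\<And>i. x i N = x i 0" and nz: "\<And>i j. x i j \<noteq> 0"
    and pos: "\<And>i j. Re (tri (x i j) (x (Suc i) j) (x (Suc i) (Suc j))) > 0"
      "\<And>i j. Re (tri (x i j) (x (Suc i) (Suc j)) (x i (Suc j))) > 0"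
  defines "\<theta> \<equiv> \<lambda>z. arctan (Im z / Re z)"
  shows "(\<Sum>i<N. \<Sum>j<N. \<theta> (tri (x i j) (x (Suc i) j) (x (Suc i) (Suc j)))
      + \<theta> (tri (x i j) (x (Suc i) (Suc j)) (x i (Suc j)))) / (2 * pi) \<in> \<int>"
proof -
  obtain l where l: "\<And>a b. l b a = cnj (l a b)"
    "\<And>a b c. a \<noteq> 0 \<Longrightarrow> b \<noteq> 0 \<Longrightarrow> c \<noteq> 0 \<Longrightarrow> \<exists>k>0. l a b * l b c * l c a = of_real k * tri a b c"
    using link_phases by blast
  have cyc: "sgn (l a b) * sgn (l b c) * sgn (l c a) = cis (\<theta> (tri a b c))" "l a b \<noteq> 0" "l b c \<noteq> 0" "l c a \<noteq> 0"
    if "a \<noteq> 0" "b \<noteq> 0" "c \<noteq> 0" "Re (tri a b c) > 0" for a b c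
  proof -
    obtain k where k: "k > 0" "l a b * l b c * l c a = of_real k * tri a b c" using l(2) \<open>a \<noteq> 0\<close> \<open>b \<noteq> 0\<close> \<open>c \<noteq> 0\<close> by blast
    have "sgn (l a b) * sgn (l b c) * sgn (l c a) = sgn (l a b * l b c * l c a)" by (simp add: sgn_mult)
    also have "\<dots> = sgn (tri a b c)" using k by (simp add: sgn_mult sgn_of_real)
    finally show "sgn (l a b) * sgn (l b c) * sgn (l c a) = cis (\<theta> (tri a b c))"
      using sgn_eq_cis_arctan[OF that(4)] by (simp add: \<theta>_def)
    have "tri a b c \<noteq> 0" using that(4) by auto
    then show "l a b \<noteq> 0" "l b c \<noteq> 0" "l c a \<noteq> 0" using k by auto
  qed
  have inv: "sgn (l b a) = inverse (sgn (l a b))" if "l a b \<noteq> 0" for a b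
  proof -
    have "sgn (l b a) = cnj (sgn (l a b))" using l(1)[of b a] by (simp add: sgn_eq)
    then have "sgn (l a b) * sgn (l b a) = 1"
      using that complex_norm_square[of "sgn (l a b)"] by (simp add: norm_sgn)
    then show ?thesis using that by (metis inverse_unique)
  qed
  define h where "h i j = sgn (l (x i j) (x (Suc i) j))" for i j
  define v where "v i j = sgn (l (x i j) (x i (Suc j)))" for i j
  let ?T1 = "\<lambda>i j. \<theta> (tri (x i j) (x (Suc i) j) (x (Suc i) (Suc j)))"
  let ?T2 = "\<lambda>i j. \<theta> (tri (x i j) (x (Suc i) (Suc j)) (x i (Suc j)))"
  have h0: "l (x i j) (x (Suc i) j) \<noteq> 0" "l (x (Suc i) j) (x (Suc i) (Suc j)) \<noteq> 0"
     "l (x i j) (x (Suc i) (Suc j)) \<noteq> 0" "l (x (Suc i) (Suc j)) (x i (Suc j)) \<noteq> 0" for i j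
    using cyc(2,3)[OF nz nz nz pos(1)] cyc(2,3)[OF nz nz nz pos(2)] by auto
  have v0: "l (x i j) (x i (Suc j)) \<noteq> 0" for i j
    using cyc(4)[OF nz nz nz pos(2)[of i j]] l(1)[of "x i (Suc j)" "x i j"] by simp
  \<comment> \<open>The diagonal of the cell is an edge of both triangles, in opposite directions,
    so its phase cancels. What remains are quotients of phases of opposite sides, which telescope
    along rows and columns.\<close>
  have cell: "cis (?T1 i j + ?T2 i j) = (h i j / h i (Suc j)) * (v (Suc i) j / v i j)" for i j
  proof -
    have "cis (?T1 i j + ?T2 i j) = cis (?T1 i j) * cis (?T2 i j)" by (simp add: cis_mult)
    also have "\<dots> = (sgn (l (x i j) (x (Suc i) j)) * sgn (l (x (Suc i) j) (x (Suc i) (Suc j))) * sgn (l (x (Suc i) (Suc j)) (x i j)))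
       * (sgn (l (x i j) (x (Suc i) (Suc j))) * sgn (l (x (Suc i) (Suc j)) (x i (Suc j))) * sgn (l (x i (Suc j)) (x i j)))"
      using cyc(1)[OF nz nz nz pos(1)] cyc(1)[OF nz nz nz pos(2)] by simp
    also have "\<dots> = (h i j / h i (Suc j)) * (v (Suc i) j / v i j)"
      using h0[of i j] h0(1)[of i "Suc j"] v0[of i j]
      by (simp add: h_def v_def inv[OF h0(3)] inv[OF h0(1)] inv[OF v0] sgn_zero_iff field_simps)
    finally show ?thesis .
  qed
  have hv: "h i j \<noteq> 0" "v i j \<noteq> 0" for i j
    using h0 v0 by (simp_all add: h_def v_def sgn_zero_iff)
  have "cis (\<Sum>i<N. \<Sum>j<N. ?T1 i j + ?T2 i j) = (\<Prod>i<N. \<Prod>j<N. cis (?T1 i j + ?T2 i j))"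
    by (simp add: cis_conv_exp exp_sum sum_distrib_left)
  also have "\<dots> = (\<Prod>i<N. \<Prod>j<N. h i j / h i (Suc j)) * (\<Prod>i<N. \<Prod>j<N. v (Suc i) j / v i j)"
    unfolding cell by (simp only: prod.distrib)
  also have "(\<Prod>i<N. \<Prod>j<N. h i j / h i (Suc j)) = 1"
    using hv by (simp add: telescope_quotient) (simp add: h_def per)
  also have "(\<Prod>i<N. \<Prod>j<N. v (Suc i) j / v i j) = inverse (\<Prod>j<N. \<Prod>i<N. v i j / v (Suc i) j)"
    by (subst prod.swap) (simp add: prod_inversef[symmetric] flip: prod_inversef)
  also have "(\<Prod>j<N. \<Prod>i<N. v i j / v (Suc i) j) = 1"
    using hv telescope_quotient[of "\<lambda>i. v i _"] by (simp add: v_def per)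
  finally have "cis (\<Sum>i<N. \<Sum>j<N. ?T1 i j + ?T2 i j) = 1" by simp
  then obtain n :: int where "(\<Sum>i<N. \<Sum>j<N. ?T1 i j + ?T2 i j) = of_int n * 2 * pi"
    unfolding cis_conv_exp by (auto simp: exp_eq_1)
  then show ?thesis by simp
qed

section \<open>Riemann sums whose integrand depends on the mesh\<close>

lemma riemann_sum_error:
  fixes \<phi> :: "real \<Rightarrow> real"
  assumes N: "N > 0" and \<phi>: "continuous_on {0..1} \<phi>"
    and close: "\<And>i t. i < N \<Longrightarrow> real i / N \<le> t \<Longrightarrow> t \<le> real (Suc i) / N \<Longrightarrow> \<bar>\<phi> t - c i\<bar> \<le> e"
  shows "\<bar>integral {0..1} \<phi> - (\<Sum>i<N. c i) / N\<bar> \<le> e"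
proof -
  have "k \<le> N \<Longrightarrow> \<bar>integral {0..real k / N} \<phi> - (\<Sum>i<k. c i) / N\<bar> \<le> e * k / N" for k
  proof (induction k)
    case (Suc k)
    let ?a = "real k / N" and ?b = "real (Suc k) / N"
    have ab: "0 \<le> ?a" "?a \<le> ?b" "?b \<le> 1" using Suc.prems N by (simp_all add: field_simps)
    have int: "\<phi> integrable_on {0..?b}" "\<phi> integrable_on {?a..?b}"
      by (rule integrable_continuous_interval, rule continuous_on_subset[OF \<phi>],
          simp only: atLeastatMost_subset_iff, use ab in linarith)+
    have split: "integral {0..?a} \<phi> + integral {?a..?b} \<phi> = integral {0..?b} \<phi>"
      by (rule Henstock_Kurzweil_Integration.integral_combine[OF ab(1,2) int(1)])
    have "norm (integral (cbox ?a ?b) (\<lambda>t. \<phi> t - c k)) \<le> e * measure lborel (cbox ?a ?b)"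
    proof (rule integrable_bound)
      show "0 \<le> e" using close[of k ?a] Suc.prems ab by (smt (verit) Suc_le_lessD)
      show "(\<lambda>t. \<phi> t - c k) integrable_on cbox ?a ?b" using int(2) by (intro integrable_diff) auto
      fix t assume "t \<in> cbox ?a ?b"
      then show "norm (\<phi> t - c k) \<le> e" using close[of k t] Suc.prems by auto
    qed
    moreover have "integral (cbox ?a ?b) (\<lambda>t. \<phi> t - c k) = integral {?a..?b} \<phi> - c k / N"
    proof -
      have "integral {?a..?b} (\<lambda>t. \<phi> t - c k) = integral {?a..?b} \<phi> - integral {?a..?b} (\<lambda>t. c k)"
        using int(2) by (intro integral_diff) auto
      moreover have "?b - ?a = 1 / N" using N by (simp add: field_simps)
      ultimately show ?thesis using ab by simp
    qed
    moreover have "measure lborel (cbox ?a ?b) = 1 / N" using ab N by (simp add: field_simps)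
    ultimately have "\<bar>integral {?a..?b} \<phi> - c k / N\<bar> \<le> e / N" by simp
    moreover have "\<bar>integral {0..?a} \<phi> - (\<Sum>i<k. c i) / N\<bar> \<le> e * k / N" using Suc by simp
    moreover have "(\<Sum>i<Suc k. c i) / N = (\<Sum>i<k. c i) / N + c k / N" by (simp add: add_divide_distrib)
    moreover have "e * real (Suc k) / N = e * k / N + e / N" by (simp add: distrib_left add_divide_distrib)
    ultimately show ?case unfolding split[symmetric] by linarith
  qed simp
  from this[of N] N show ?thesis by simp
qed

text \<open>The third argument of \<open>F\<close> is the mesh width. Uniform continuity on the
  compact box, down to width 0, allows it to vary together with the sample points.\<close>

lemma riemann_sum_2:
  fixes F :: "real \<times> real \<times> real \<Rightarrow> real"
  assumes d0: "d0 > 0" and F: "continuous_on ({0..1} \<times> {0..1} \<times> {0..d0}) F"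
  shows "(\<lambda>N. (\<Sum>i<N. \<Sum>j<N. F (real i / N, real j / N, 1 / N)) / real N ^ 2)
    \<longlonglongrightarrow> integral {0..1} (\<lambda>u. integral {0..1} (\<lambda>v. F (u, v, 0)))" (is "?X \<longlonglongrightarrow> ?L")
proof (rule LIMSEQ_I)
  fix r :: real assume r: "r > 0"
  let ?K = "{0..1::real} \<times> {0..1::real} \<times> {0..d0}"
  have "uniformly_continuous_on ?K F"
    by (rule compact_uniformly_continuous[OF F]) (intro compact_Times compact_Icc)
  then obtain d where d: "d > 0" "\<And>p q. p \<in> ?K \<Longrightarrow> q \<in> ?K \<Longrightarrow> dist q p < d \<Longrightarrow> dist (F q) (F p) < r / 2"
    unfolding uniformly_continuous_on_def using r by (metis half_gt_zero)
  \<comment> \<open>A third of \<open>d\<close> for each of the three coordinates, which all move by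
    at most \<open>1 / N\<close>; the bound \<open>d0\<close> keeps the samples in the domain of
    \<open>F\<close>.\<close>
  obtain N0 :: nat where N0: "N0 > 0" "1 / N0 < d / 3" "1 / N0 < d0"
  proof -
    have "min (d / 3) d0 > 0" using d d0 by simp
    then obtain n where "inverse (real (Suc n)) < min (d / 3) d0" using reals_Archimedean by blast
    then show thesis using that[of "Suc n"] by (simp add: inverse_eq_divide)
  qed
  have "norm (?X N - ?L) < r"
    if N: "N \<ge> N0" for N
  proof -
    have N': "N > 0" "1 / N \<le> 1 / N0" using N N0(1) by (auto simp: frac_le)
    have small: "1 / N < d / 3" "1 / N < d0" using N' N0 by linarith+
    have close: "\<bar>F (u, v, 0) - F (real i / N, real j / N, 1 / N)\<bar> \<le> r / 2"
      if "i < N" "j < N" "real i / N \<le> u" "u \<le> real (Suc i) / N" "real j / N \<le> v" "v \<le> real (Suc j) / N" for i j u v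
    proof -
      have 1: "real (Suc i) / N \<le> 1" "real (Suc j) / N \<le> 1" using that N' by auto
      have 2: "real (Suc i) / N = real i / N + 1 / N" "real (Suc j) / N = real j / N + 1 / N"
        by (simp_all add: add_divide_distrib)
      have 3: "0 \<le> real i / N" "0 \<le> real j / N" "0 < 1 / real N" using N' by auto
      have "dist (u, v, 0) (real i / N, real j / N, 1 / N) \<le> dist u (real i / N) + (dist v (real j / N) + dist 0 (1 / N))"
        unfolding dist_Pair_Pair by (rule order_trans[OF sqrt_sum_squares_le_sum]) (auto intro!: sqrt_sum_squares_le_sum)
      also have "\<dots> < d"
      proof -
        have "dist u (real i / N) \<le> 1 / N" "dist v (real j / N) \<le> 1 / N" "dist 0 (1 / real N) = 1 / N"
          using that(3-6) 3(3) unfolding 2 by (auto simp: dist_real_def)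
        then show ?thesis using small by linarith
      qed
      finally have "dist (F (u, v, 0)) (F (real i / N, real j / N, 1 / N)) < r / 2"
      proof (intro d(2))
        have "0 \<le> u" "u \<le> 1" "0 \<le> v" "v \<le> 1"
          using order_trans[OF 3(1) that(3)] order_trans[OF that(4) 1(1)] order_trans[OF 3(2) that(5)] order_trans[OF that(6) 1(2)]
          by blast+
        moreover have "real i / N \<le> 1" "real j / N \<le> 1" using that(1,2) by auto
        ultimately show "(real i / N, real j / N, 1 / N) \<in> ?K" "(u, v, 0) \<in> ?K"
          unfolding mem_Times_iff fst_conv snd_conv atLeastAtMost_iff
          using 3 less_imp_le[OF small(2)] less_imp_le[OF 3(3)] less_imp_le[OF d0] by blast+
      qed
      then show ?thesis by (simp add: dist_real_def)
    qed
    have cF: "continuous_on {0..1} (\<lambda>v. F (u, v, 0))" if "u \<in> {0..1}" for u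
      by (rule continuous_on_compose2[OF F]) (use that d0 in \<open>auto intro!: continuous_intros\<close>)
    have inner: "\<bar>integral {0..1} (\<lambda>v. F (u, v, 0)) - (\<Sum>j<N. F (real i / N, real j / N, 1 / N)) / N\<bar> \<le> r / 2"
      if i: "i < N" "real i / N \<le> u" "u \<le> real (Suc i) / N" for i u
    proof (rule riemann_sum_error[OF N'(1)])
      have 1: "0 \<le> real i / N" "real (Suc i) / N \<le> 1" using i(1) by auto
      have "u \<in> {0..1}"
        unfolding atLeastAtMost_iff using order_trans[OF 1(1) i(2)] order_trans[OF i(3) 1(2)] by blast
      then show "continuous_on {0..1} (\<lambda>v. F (u, v, 0))" by (rule cF)
    next
      fix j v assume j: "j < N" "real j / N \<le> v" "v \<le> real (Suc j) / N"
      show "\<bar>F (u, v, 0) - F (real i / N, real j / N, 1 / N)\<bar> \<le> r / 2"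
        by (rule close[OF i(1) j(1) i(2,3) j(2,3)])
    qed
    have co: "continuous_on {0..1} (\<lambda>u. integral {0..1} (\<lambda>v. F (u, v, 0)))"
    proof -
      have "continuous_on ({0..1} \<times> cbox 0 1) (\<lambda>(u, v). F (u, v, 0))"
        unfolding case_prod_beta
        by (rule continuous_on_compose2[OF F]) (use d0 in \<open>auto intro!: continuous_intros\<close>)
      from integral_continuous_on_param[OF this] show ?thesis by simp
    qed
    have "\<bar>integral {0..1} (\<lambda>u. integral {0..1} (\<lambda>v. F (u, v, 0))) - (\<Sum>i<N. (\<Sum>j<N. F (real i / N, real j / N, 1 / N)) / N) / N\<bar> \<le> r / 2"
      by (rule riemann_sum_error[OF N'(1) co inner])
    moreover have "(\<Sum>i<N. (\<Sum>j<N. F (real i / N, real j / N, 1 / N)) / N) / N = (\<Sum>i<N. \<Sum>j<N. F (real i / N, real j / N, 1 / N)) / real N ^ 2"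
      by (simp add: sum_divide_distrib[symmetric] power2_eq_square)
    ultimately show ?thesis using r by (simp add: abs_minus_commute)
  qed
  then show "\<exists>no. \<forall>n\<ge>no. norm (?X n - ?L) < r"
    by blast
qed

text \<open>The continuous extension of \<open>arctan y / y\<close>. An angle divided by the area of
  its grid cell thereby stays continuous as the mesh tends to 0.\<close>

definition atn_quot :: "real \<Rightarrow> real" where
  "atn_quot y = (if y = 0 then 1 else arctan y / y)"

lemma arctan_eq_atn_quot: "arctan y = y * atn_quot y"
  by (simp add: atn_quot_def)

lemma isCont_atn_quot: "isCont atn_quot y"
proof (cases "y = 0")
  case True
  have "(arctan has_field_derivative 1) (at 0)"
    using DERIV_arctan[of 0] by simp
  then have "((\<lambda>y. arctan y / y) \<longlongrightarrow> 1) (at 0)"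
    by (simp add: has_field_derivative_iff)
  then have "(atn_quot \<longlongrightarrow> 1) (at 0)"
    by (rule Lim_transform_eventually) (auto simp: eventually_at_filter atn_quot_def)
  then show ?thesis using True by (simp add: isCont_def atn_quot_def)
next
  case False
  have "\<forall>\<^sub>F x in nhds y. atn_quot x = arctan x / x"
    using t1_space_nhds[OF False] by eventually_elim (simp add: atn_quot_def)
  from isCont_cong[OF this] show ?thesis
    using False by (auto intro!: continuous_intros)
qed

lemma continuous_on_tri:
  "continuous_on S a \<Longrightarrow> continuous_on S b \<Longrightarrow> continuous_on S c \<Longrightarrow> continuous_on S (\<lambda>x. Re (tri (a x) (b x) (c x)))"
  unfolding tri_def by (auto intro!: continuous_intros)

text \<open>\<open>\<beta> u d\<close> is the mean velocity over a step of length \<open>d\<close>.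
  As an integral of \<open>g'\<close> it is jointly continuous even at \<open>d = 0\<close>, for a
  curve that is merely of class C^1.\<close>

lemma closed_curve_difference_quotient:
  assumes g: "closed_curve g g'"
  obtains \<beta> where "continuous_on UNIV (\<lambda>(u, d). \<beta> u d)" "\<And>u d. g (u + d) = g u + d *\<^sub>R \<beta> u d" "\<And>u. \<beta> u 0 = g' u"
proof -
  define \<beta> where "\<beta> u d = integral (cbox 0 1) (\<lambda>l. g' (u + l * d))" for u d
  have "continuous_on (UNIV \<times> cbox 0 1) (\<lambda>(p, l). g' (fst p + l * snd p))"
    unfolding case_prod_beta
    by (rule continuous_on_compose2[OF closed_curve_continuous'[OF g, of UNIV]]) (auto intro!: continuous_intros)
  from integral_continuous_on_param[OF this]
  have "continuous_on UNIV (\<lambda>(u, d). \<beta> u d)" by (simp add: \<beta>_def case_prod_beta)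
  moreover have "g (u + d) = g u + d *\<^sub>R \<beta> u d" for u d
  proof -
    have "((\<lambda>l. d *\<^sub>R g' (u + l * d)) has_integral g (u + 1 * d) - g (u + 0 * d)) {0..1}"
    proof (rule fundamental_theorem_of_calculus)
      fix l :: real
      have 1: "(g has_vector_derivative g' (u + l * d)) (at (u + l * d))" using g by (simp add: closed_curve_def)
      have "((\<lambda>l. u + l * d) has_vector_derivative d) (at l within {0..1})"
        by (auto intro!: derivative_eq_intros simp: has_vector_derivative_def)
      from vector_diff_chain_within[OF this has_vector_derivative_at_within[OF 1]]
      show "((\<lambda>l. g (u + l * d)) has_vector_derivative d *\<^sub>R g' (u + l * d)) (at l within {0..1})"
        by (simp add: o_def)
    qed simp
    from integral_unique[OF this] have "integral {0..1} (\<lambda>l. d *\<^sub>R g' (u + l * d)) = g (u + d) - g u" by simp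
    then show ?thesis by (simp add: \<beta>_def)
  qed
  moreover have "\<beta> u 0 = g' u" for u by (simp add: \<beta>_def)
  ultimately show thesis using that by blast
qed

text \<open>The four corners of a cell form a parallelogram, so its two triangles span the same
  volume with the origin.\<close>

lemma tri_shift:
  "Im (tri a (a + d *\<^sub>R b) (a + d *\<^sub>R b + d *\<^sub>R c)) = d^2 * (a \<bullet> cross3 b c)"
  "Im (tri a (a + d *\<^sub>R b + d *\<^sub>R c) (a + d *\<^sub>R c)) = d^2 * (a \<bullet> cross3 b c)"
  by (simp_all add: tri_def cross3_def inner_vec_def sum_3 vector_3; algebra)+

lemma Re_tri_same: "Re (tri a a a) = 4 * norm a ^ 3"
  by (simp add: tri_def dot_square_norm power_numeral_reduce)

text \<open>\<open>F\<close> is the sum of the half solid angles of the two triangles of a cell,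
  divided by the squared mesh width; at width 0 it becomes a multiple of the Gauss integrand. By
  \<open>grid_holonomy\<close> its Riemann sums over \<open>2 * pi\<close> are integers once the
  mesh is fine, and the limit is an integer because the integers are closed.\<close>

theorem linking_number_integer:
  assumes g: "closed_curve g g'" and h: "closed_curve h h'" and disj: "range g \<inter> range h = {}"
  shows "linking_number g h \<in> \<int>"
proof -
  obtain \<beta> where \<beta>: "continuous_on UNIV (\<lambda>(u, d). \<beta> u d)" "\<And>u d. g (u + d) = g u + d *\<^sub>R \<beta> u d" "\<And>u. \<beta> u 0 = g' u"
    using closed_curve_difference_quotient[OF g] by blast
  obtain \<kappa> where \<kappa>: "continuous_on UNIV (\<lambda>(u, d). \<kappa> u d)" "\<And>u d. h (u + d) = h u + d *\<^sub>R \<kappa> u d" "\<And>u. \<kappa> u 0 = h' u"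
    using closed_curve_difference_quotient[OF h] by blast
  define a where "a p = g (fst p) - h (fst (snd p))" for p :: "real \<times> real \<times> real"
  define b where "b p = \<beta> (fst p) (snd (snd p))" for p :: "real \<times> real \<times> real"
  define c where "c p = - \<kappa> (fst (snd p)) (snd (snd p))" for p :: "real \<times> real \<times> real"
  define T1 where "T1 p = tri (a p) (a p + snd (snd p) *\<^sub>R b p) (a p + snd (snd p) *\<^sub>R b p + snd (snd p) *\<^sub>R c p)" for p
  define T2 where "T2 p = tri (a p) (a p + snd (snd p) *\<^sub>R b p + snd (snd p) *\<^sub>R c p) (a p + snd (snd p) *\<^sub>R c p)" for p
  have anz: "a p \<noteq> 0" for p using disj by (auto simp: a_def)
  have ca: "continuous_on S a" for S
    unfolding a_def
    by (intro continuous_intros continuous_on_compose2[OF closed_curve_continuous[OF g, of UNIV]]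
        continuous_on_compose2[OF closed_curve_continuous[OF h, of UNIV]]) auto
  have cb: "continuous_on S b" for S
  proof -
    have "continuous_on S (\<lambda>p::real \<times> real \<times> real. (fst p, snd (snd p)))" by (intro continuous_intros)
    from continuous_on_compose2[OF \<beta>(1) this] show ?thesis by (simp add: b_def[abs_def])
  qed
  have cc: "continuous_on S c" for S
  proof -
    have "continuous_on S (\<lambda>p::real \<times> real \<times> real. (fst (snd p), snd (snd p)))" by (intro continuous_intros)
    from continuous_on_compose2[OF \<kappa>(1) this] show ?thesis
      by (auto simp: c_def[abs_def] case_prod_beta intro!: continuous_on_minus)
  qed
  have cT: "continuous_on S (\<lambda>p. Re (T1 p))" "continuous_on S (\<lambda>p. Re (T2 p))" for S
    unfolding T1_def T2_def by (intro continuous_on_tri continuous_intros ca cb cc)+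
  \<comment> \<open>At width 0 the triangles degenerate to points and \<open>Re_tri_same\<close>
    gives positive real parts; compactness extends this to all widths up to some
    \<open>d0\<close>.\<close>
  define K where "K = {0..1::real} \<times> {0..1::real} \<times> {0::real}"
  define U where "U = {p. Re (T1 p) > 0 \<and> Re (T2 p) > 0}"
  have "open U"
    unfolding U_def
    by (intro open_Collect_conj open_Collect_less continuous_on_const cT)
  moreover have "compact K" unfolding K_def by (intro compact_Times) auto
  moreover have "K \<noteq> {}" by (auto simp: K_def)
  moreover have "K \<subseteq> U"
    using anz by (auto simp: K_def U_def T1_def T2_def Re_tri_same)
  ultimately obtain d0 where d0: "d0 > 0" "{p. infdist p K \<le> d0} \<subseteq> U"
    using compact_in_open_separated[of K U] by blast
  have pos: "Re (T1 (u, v, d)) > 0 \<and> Re (T2 (u, v, d)) > 0" if "u \<in> {0..1}" "v \<in> {0..1}" "0 \<le> d" "d \<le> d0" for u v d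
  proof -
    have "infdist (u, v, d) K \<le> dist (u, v, d) (u, v, 0)"
      by (rule infdist_le) (use that in \<open>auto simp: K_def\<close>)
    also have "\<dots> \<le> d0" using that by (simp add: dist_Pair_Pair)
    finally show ?thesis using d0 by (auto simp: U_def)
  qed
  define X1 where "X1 p = (a p \<bullet> cross3 (b p) (c p)) / Re (T1 p)" for p
  define X2 where "X2 p = (a p \<bullet> cross3 (b p) (c p)) / Re (T2 p)" for p
  define F where "F p = X1 p * atn_quot (snd (snd p) ^ 2 * X1 p) + X2 p * atn_quot (snd (snd p) ^ 2 * X2 p)" for p
  let ?K = "{0..1::real} \<times> {0..1::real} \<times> {0..d0}"
  have catn: "continuous_on S (\<lambda>p. atn_quot (q p))" if "continuous_on S q" for S and q :: "real \<times> real \<times> real \<Rightarrow> real"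
    by (rule continuous_on_compose2[OF _ that, of UNIV]) (auto simp: continuous_on_eq_continuous_at isCont_atn_quot)
  have cX: "continuous_on ?K X1" "continuous_on ?K X2"
    unfolding X1_def X2_def
    by (intro continuous_intros continuous_on_cross3 ca cb cc cT; use pos in force)+
  have cF: "continuous_on ?K F"
    unfolding F_def by (intro continuous_intros catn cX)
  have F_angle: "d^2 * F (u, v, d) = arctan (Im (T1 (u, v, d)) / Re (T1 (u, v, d))) + arctan (Im (T2 (u, v, d)) / Re (T2 (u, v, d)))" for u v d
  proof -
    let ?p = "(u, v, d)"
    have 1: "Im (T1 ?p) = d^2 * (a ?p \<bullet> cross3 (b ?p) (c ?p))" "Im (T2 ?p) = d^2 * (a ?p \<bullet> cross3 (b ?p) (c ?p))"
      by (simp_all only: T1_def T2_def snd_conv tri_shift)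
    show ?thesis
      unfolding F_def X1_def X2_def arctan_eq_atn_quot 1 snd_conv by (simp add: distrib_left)
  qed
  have shift1: "g (u + 1) = g u" "h (u + 1) = h u" for u using g h by (simp_all add: closed_curve_def)
  have int: "(\<Sum>i<N. \<Sum>j<N. F (real i / N, real j / N, 1 / N)) / real N ^ 2 / (2 * pi) \<in> \<int>"
    if N: "N > 0" "1 / N \<le> d0" for N
  proof -
    define x where "x i j = g (real i / N) - h (real j / N)" for i j
    have xa: "a (real i / N, real j / N, 1 / N) = x i j" for i j by (simp add: a_def x_def)
    have Suc_N: "real (Suc i) / N = real i / N + 1 / N" for i by (simp add: add_divide_distrib)
    have xb: "x i j + (1 / N) *\<^sub>R b (real i / N, real j / N, 1 / N) = x (Suc i) j" for i j
      unfolding x_def Suc_N \<beta>(2) b_def by simp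
    have xc: "x i j + (1 / N) *\<^sub>R c (real i / N, real j / N, 1 / N) = x i (Suc j)" for i j
      unfolding x_def Suc_N \<kappa>(2) c_def by simp
    have xbc: "x (Suc i) j + (1 / N) *\<^sub>R c (real i / N, real j / N, 1 / N) = x (Suc i) (Suc j)" for i j
      unfolding x_def Suc_N \<kappa>(2) c_def by simp
    have T1x: "T1 (real i / N, real j / N, 1 / N) = tri (x i j) (x (Suc i) j) (x (Suc i) (Suc j))" for i j
      unfolding T1_def snd_conv xa xb xbc ..
    have T2x: "T2 (real i / N, real j / N, 1 / N) = tri (x i j) (x (Suc i) (Suc j)) (x i (Suc j))" for i j
      unfolding T2_def snd_conv xa xb xc xbc ..
    have posx': "Re (tri (x i j) (x (Suc i) j) (x (Suc i) (Suc j))) > 0"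
      "Re (tri (x i j) (x (Suc i) (Suc j)) (x i (Suc j))) > 0" if "i < N" "j < N" for i j
      using pos[of "real i / N" "real j / N" "1 / N"] that N by (auto simp: T1x T2x)
    have xper: "x (i + k * N) (j + m * N) = x i j" for i j k m
      using periodic_int_shift[of g 0 "real i / N" "int k"] periodic_int_shift[of h 0 "real j / N" "int m"] shift1 N
      by (simp add: x_def add_divide_distrib)
    \<comment> \<open>\<open>grid_holonomy\<close> asks for positivity at all indices, which reduces
      to one period by \<open>xper\<close>.\<close>
    have posx: "Re (tri (x i j) (x (Suc i) j) (x (Suc i) (Suc j))) > 0"
      "Re (tri (x i j) (x (Suc i) (Suc j)) (x i (Suc j))) > 0" for i j
      using posx'[of "i mod N" "j mod N"] N xper[of "i mod N" "i div N" "j mod N" "j div N"]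
        xper[of "Suc (i mod N)" "i div N" "j mod N" "j div N"] xper[of "i mod N" "i div N" "Suc (j mod N)" "j div N"]
        xper[of "Suc (i mod N)" "i div N" "Suc (j mod N)" "j div N"]
      by (simp_all add: mod_div_mult_eq)
    have "(\<Sum>i<N. \<Sum>j<N. F (real i / N, real j / N, 1 / N)) / real N ^ 2 = (\<Sum>i<N. \<Sum>j<N. (1 / real N)^2 * F (real i / N, real j / N, 1 / N))"
      by (simp add: sum_divide_distrib power_divide)
    also have "\<dots> = (\<Sum>i<N. \<Sum>j<N. arctan (Im (tri (x i j) (x (Suc i) j) (x (Suc i) (Suc j))) / Re (tri (x i j) (x (Suc i) j) (x (Suc i) (Suc j))))
      + arctan (Im (tri (x i j) (x (Suc i) (Suc j)) (x i (Suc j))) / Re (tri (x i j) (x (Suc i) (Suc j)) (x i (Suc j)))))" (is "_ = ?S")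
      unfolding F_angle T1x T2x ..
    finally have eq: "(\<Sum>i<N. \<Sum>j<N. F (real i / N, real j / N, 1 / N)) / real N ^ 2 = ?S" .
    show ?thesis
      unfolding eq
    proof (rule grid_holonomy)
      show "x N j = x 0 j" "x i N = x i 0" for i j
        using shift1[of 0] N by (simp_all add: x_def)
      show "x i j \<noteq> 0" for i j using anz xa by metis
    qed (use posx in auto)
  qed
  have "(\<lambda>N. (\<Sum>i<N. \<Sum>j<N. F (real i / N, real j / N, 1 / N)) / real N ^ 2 / (2 * pi))
      \<longlonglongrightarrow> integral {0..1} (\<lambda>u. integral {0..1} (\<lambda>v. F (u, v, 0))) / (2 * pi)"
    by (intro tendsto_divide riemann_sum_2[OF d0(1) cF] tendsto_const) auto
  moreover have "\<forall>\<^sub>F N in sequentially. (\<Sum>i<N. \<Sum>j<N. F (real i / N, real j / N, 1 / N)) / real N ^ 2 / (2 * pi) \<in> \<int>"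
  proof -
    have "(\<lambda>N. 1 / real N) \<longlonglongrightarrow> 0" by (rule lim_1_over_n)
    from order_tendstoD(2)[OF this d0(1)] eventually_gt_at_top[of 0]
    show ?thesis by eventually_elim (rule int; simp)
  qed
  ultimately have lim: "integral {0..1} (\<lambda>u. integral {0..1} (\<lambda>v. F (u, v, 0))) / (2 * pi) \<in> \<int>"
    by (intro Lim_in_closed_set[OF closed_Ints]) auto
  \<comment> \<open>Each of the two triangles contributes the triple product over
    \<open>4 * norm (a p) ^ 3\<close>, whence the factor one half; the sign comes from the second
    curve being subtracted.\<close>
  have "F (u, v, 0) = - (1 / 2) * (gk (g u - h v) \<bullet> cross3 (g' u) (h' v))" for u v
    by (simp add: F_def X1_def X2_def T1_def T2_def Re_tri_same atn_quot_def a_def b_def c_def \<beta>(3) \<kappa>(3) gk_def)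
  then have "integral {0..1} (\<lambda>u. integral {0..1} (\<lambda>v. F (u, v, 0)))
     = - (1 / 2) * integral {0..1} (\<lambda>u. integral {0..1} (\<lambda>v. gk (g u - h v) \<bullet> cross3 (g' u) (h' v)))"
    by simp
  also have "integral {0..1} (\<lambda>u. integral {0..1} (\<lambda>v. gk (g u - h v) \<bullet> cross3 (g' u) (h' v))) = 4 * pi * linking_number g h"
    using integral_prod_continuous[OF gauss_integrand_continuous[OF g h disj, of "cbox (0,0) (1,1)"]]
    by (simp add: linking_number_gk[OF g h])
  finally have "- linking_number g h \<in> \<int>" using lim by simp
  then show ?thesis by simp
qed

subsection \<open>The jump of the linking form across the torus\<close>

lemma continuous_on_curried3:
  assumes "continuous_on (X \<times> Y \<times> Z) (\<lambda>(x, y, z). f x y z)"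
    "continuous_on S a" "continuous_on S b" "continuous_on S c" "\<And>s. s \<in> S \<Longrightarrow> a s \<in> X \<and> b s \<in> Y \<and> c s \<in> Z"
  shows "continuous_on S (\<lambda>s. f (a s) (b s) (c s))"
  using continuous_on_compose2[OF assms(1) continuous_on_Pair[OF assms(2) continuous_on_Pair[OF assms(3,4)]]] assms(5)
  by (auto simp: image_subset_iff)

lemma integral_triple_swap:
  fixes f :: "real \<Rightarrow> real \<Rightarrow> real \<Rightarrow> real"
  assumes c: "continuous_on (cbox a1 b1 \<times> cbox a2 b2 \<times> cbox a3 b3) (\<lambda>(x, y, z). f x y z)"
  shows "integral (cbox a1 b1) (\<lambda>x. integral (cbox a2 b2) (\<lambda>y. integral (cbox a3 b3) (\<lambda>z. f x y z)))
       = integral (cbox a1 b1) (\<lambda>x. integral (cbox a3 b3) (\<lambda>z. integral (cbox a2 b2) (\<lambda>y. f x y z)))" (is ?A)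
    and "integral (cbox a1 b1) (\<lambda>x. integral (cbox a2 b2) (\<lambda>y. integral (cbox a3 b3) (\<lambda>z. f x y z)))
       = integral (cbox a2 b2) (\<lambda>y. integral (cbox a3 b3) (\<lambda>z. integral (cbox a1 b1) (\<lambda>x. f x y z)))" (is ?B)
proof -
  show ?A
  proof (rule integral_cong)
    fix x assume x: "x \<in> cbox a1 b1"
    have "continuous_on (cbox (a2, a3) (b2, b3)) (\<lambda>(y, z). f x y z)"
      unfolding case_prod_beta
      by (rule continuous_on_curried3[OF c]) (use x in \<open>auto simp: cbox_Pair_eq intro!: continuous_intros\<close>)
    from integral_swap_continuous[OF this]
    show "integral (cbox a2 b2) (\<lambda>y. integral (cbox a3 b3) (\<lambda>z. f x y z))
      = integral (cbox a3 b3) (\<lambda>z. integral (cbox a2 b2) (\<lambda>y. f x y z))" .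
  qed
  have 1: "continuous_on (cbox (a1, a2) (b1, b2)) (\<lambda>(x, y). integral (cbox a3 b3) (\<lambda>z. f x y z))"
  proof -
    have "continuous_on ((cbox a1 b1 \<times> cbox a2 b2) \<times> cbox a3 b3) (\<lambda>(p, z). f (fst p) (snd p) z)"
      unfolding case_prod_beta
      by (rule continuous_on_curried3[OF c]) (auto intro!: continuous_intros)
    from integral_continuous_on_param[OF this] show ?thesis by (simp add: case_prod_beta cbox_Pair_eq)
  qed
  have "integral (cbox a1 b1) (\<lambda>x. integral (cbox a2 b2) (\<lambda>y. integral (cbox a3 b3) (\<lambda>z. f x y z)))
      = integral (cbox a2 b2) (\<lambda>y. integral (cbox a1 b1) (\<lambda>x. integral (cbox a3 b3) (\<lambda>z. f x y z)))"
    by (rule integral_swap_continuous[OF 1])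
  also have "\<dots> = integral (cbox a2 b2) (\<lambda>y. integral (cbox a3 b3) (\<lambda>z. integral (cbox a1 b1) (\<lambda>x. f x y z)))"
  proof (rule integral_cong)
    fix y assume y: "y \<in> cbox a2 b2"
    have "continuous_on (cbox (a1, a3) (b1, b3)) (\<lambda>(x, z). f x y z)"
      unfolding case_prod_beta
      by (rule continuous_on_curried3[OF c]) (use y in \<open>auto simp: cbox_Pair_eq intro!: continuous_intros\<close>)
    from integral_swap_continuous[OF this]
    show "integral (cbox a1 b1) (\<lambda>x. integral (cbox a3 b3) (\<lambda>z. f x y z))
      = integral (cbox a3 b3) (\<lambda>z. integral (cbox a1 b1) (\<lambda>x. f x y z))" .
  qed
  finally show ?B .
qed

lemma integral_triple_add:
  fixes f g :: "real \<Rightarrow> real \<Rightarrow> real \<Rightarrow> real"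
  assumes f: "continuous_on (cbox a1 b1 \<times> cbox a2 b2 \<times> cbox a3 b3) (\<lambda>(x, y, z). f x y z)"
    and g: "continuous_on (cbox a1 b1 \<times> cbox a2 b2 \<times> cbox a3 b3) (\<lambda>(x, y, z). g x y z)"
  shows "integral (cbox a1 b1) (\<lambda>x. integral (cbox a2 b2) (\<lambda>y. integral (cbox a3 b3) (\<lambda>z. f x y z + g x y z)))
       = integral (cbox a1 b1) (\<lambda>x. integral (cbox a2 b2) (\<lambda>y. integral (cbox a3 b3) (\<lambda>z. f x y z)))
       + integral (cbox a1 b1) (\<lambda>x. integral (cbox a2 b2) (\<lambda>y. integral (cbox a3 b3) (\<lambda>z. g x y z)))"
proof -
  let ?X = "cbox a1 b1" and ?Y = "cbox a2 b2" and ?Z = "cbox a3 b3"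
  have iz: "(\<lambda>z. h x y z) integrable_on ?Z" if h: "continuous_on (?X \<times> ?Y \<times> ?Z) (\<lambda>(x, y, z). h x y z)" and xy: "x \<in> ?X" "y \<in> ?Y" for h :: "real \<Rightarrow> real \<Rightarrow> real \<Rightarrow> real" and x y
  proof (rule integrable_continuous)
    show "continuous_on ?Z (\<lambda>z. h x y z)"
      by (rule continuous_on_curried3[OF h]) (use xy in \<open>auto intro!: continuous_intros\<close>)
  qed
  have c2: "continuous_on (?X \<times> ?Y) (\<lambda>(x, y). integral ?Z (\<lambda>z. h x y z))" if h: "continuous_on (?X \<times> ?Y \<times> ?Z) (\<lambda>(x, y, z). h x y z)" for h :: "real \<Rightarrow> real \<Rightarrow> real \<Rightarrow> real"
  proof -
    have "continuous_on ((?X \<times> ?Y) \<times> ?Z) (\<lambda>(p, z). h (fst p) (snd p) z)"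
      unfolding case_prod_beta
      by (rule continuous_on_curried3[OF h]) (auto intro!: continuous_intros)
    from integral_continuous_on_param[OF this] show ?thesis by (simp add: case_prod_beta)
  qed
  have iy: "(\<lambda>y. integral ?Z (\<lambda>z. h x y z)) integrable_on ?Y" if h: "continuous_on (?X \<times> ?Y \<times> ?Z) (\<lambda>(x, y, z). h x y z)" and x: "x \<in> ?X" for h :: "real \<Rightarrow> real \<Rightarrow> real \<Rightarrow> real" and x
  proof (rule integrable_continuous)
    show "continuous_on ?Y (\<lambda>y. integral ?Z (\<lambda>z. h x y z))"
      using continuous_on_compose2[OF c2[OF h] continuous_on_Pair[OF continuous_on_const[of ?Y x] continuous_on_id]] x
      by (auto simp: image_subset_iff)
  qed
  have ix: "(\<lambda>x. integral ?Y (\<lambda>y. integral ?Z (\<lambda>z. h x y z))) integrable_on ?X" if h: "continuous_on (?X \<times> ?Y \<times> ?Z) (\<lambda>(x, y, z). h x y z)" for h :: "real \<Rightarrow> real \<Rightarrow> real \<Rightarrow> real"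
    by (rule integrable_continuous) (rule integral_continuous_on_param[OF c2[OF h]])
  have "integral ?X (\<lambda>x. integral ?Y (\<lambda>y. integral ?Z (\<lambda>z. f x y z + g x y z)))
    = integral ?X (\<lambda>x. integral ?Y (\<lambda>y. integral ?Z (\<lambda>z. f x y z)) + integral ?Y (\<lambda>y. integral ?Z (\<lambda>z. g x y z)))"
  proof (rule integral_cong)
    fix x assume x: "x \<in> ?X"
    have "integral ?Y (\<lambda>y. integral ?Z (\<lambda>z. f x y z + g x y z)) = integral ?Y (\<lambda>y. integral ?Z (\<lambda>z. f x y z) + integral ?Z (\<lambda>z. g x y z))"
      by (rule integral_cong) (rule integral_add[OF iz[OF f x] iz[OF g x]])
    also have "\<dots> = integral ?Y (\<lambda>y. integral ?Z (\<lambda>z. f x y z)) + integral ?Y (\<lambda>y. integral ?Z (\<lambda>z. g x y z))"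
      by (rule integral_add[OF iy[OF f x] iy[OF g x]])
    finally show "integral ?Y (\<lambda>y. integral ?Z (\<lambda>z. f x y z + g x y z)) = \<dots>" .
  qed
  also have "\<dots> = integral ?X (\<lambda>x. integral ?Y (\<lambda>y. integral ?Z (\<lambda>z. f x y z))) + integral ?X (\<lambda>x. integral ?Y (\<lambda>y. integral ?Z (\<lambda>z. g x y z)))"
    by (rule integral_add[OF ix[OF f] ix[OF g]])
  finally show ?thesis .
qed

text \<open>Each term is integrated first in its own direction by the fundamental theorem. The
  statement serves both the homotopy of strands in parameter space and the large cubes in
  space.\<close>

lemma box_divergence:
  fixes P Q R P1 Q2 R3 :: "real \<Rightarrow> real \<Rightarrow> real \<Rightarrow> real"
  assumes le: "a1 \<le> b1" "a2 \<le> b2" "a3 \<le> b3"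
    and P: "\<And>x y z. x \<in> {a1..b1} \<Longrightarrow> y \<in> {a2..b2} \<Longrightarrow> z \<in> {a3..b3} \<Longrightarrow> ((\<lambda>x. P x y z) has_real_derivative P1 x y z) (at x within {a1..b1})"
    and Q: "\<And>x y z. x \<in> {a1..b1} \<Longrightarrow> y \<in> {a2..b2} \<Longrightarrow> z \<in> {a3..b3} \<Longrightarrow> ((\<lambda>y. Q x y z) has_real_derivative Q2 x y z) (at y within {a2..b2})"
    and R: "\<And>x y z. x \<in> {a1..b1} \<Longrightarrow> y \<in> {a2..b2} \<Longrightarrow> z \<in> {a3..b3} \<Longrightarrow> ((\<lambda>z. R x y z) has_real_derivative R3 x y z) (at z within {a3..b3})"
    and cP: "continuous_on ({a1..b1} \<times> {a2..b2} \<times> {a3..b3}) (\<lambda>(x, y, z). P1 x y z)"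
    and cQ: "continuous_on ({a1..b1} \<times> {a2..b2} \<times> {a3..b3}) (\<lambda>(x, y, z). Q2 x y z)"
    and cR: "continuous_on ({a1..b1} \<times> {a2..b2} \<times> {a3..b3}) (\<lambda>(x, y, z). R3 x y z)"
  shows "integral {a1..b1} (\<lambda>x. integral {a2..b2} (\<lambda>y. integral {a3..b3} (\<lambda>z. P1 x y z + Q2 x y z + R3 x y z)))
    = integral {a2..b2} (\<lambda>y. integral {a3..b3} (\<lambda>z. P b1 y z - P a1 y z))
    + integral {a1..b1} (\<lambda>x. integral {a3..b3} (\<lambda>z. Q x b2 z - Q x a2 z))
    + integral {a1..b1} (\<lambda>x. integral {a2..b2} (\<lambda>y. R x y b3 - R x y a3))"
proof -
  have FTC: "integral {a..b} f' = f b - f a" if "a \<le> b" "\<And>x. x \<in> {a..b} \<Longrightarrow> (f has_real_derivative f' x) (at x within {a..b})" for a b and f f' :: "real \<Rightarrow> real"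
    using fundamental_theorem_of_calculus[OF that(1)] that(2)
    by (intro integral_unique) (auto simp: has_real_derivative_iff_has_vector_derivative)
  note c = cP[folded cbox_interval] cQ[folded cbox_interval] cR[folded cbox_interval]
  have cPQ: "continuous_on (cbox a1 b1 \<times> cbox a2 b2 \<times> cbox a3 b3) (\<lambda>(x, y, z). P1 x y z + Q2 x y z)"
    using continuous_on_add[OF c(1,2)] by (simp add: case_prod_beta)
  have "integral (cbox a1 b1) (\<lambda>x. integral (cbox a2 b2) (\<lambda>y. integral (cbox a3 b3) (\<lambda>z. P1 x y z + Q2 x y z + R3 x y z)))
    = integral (cbox a1 b1) (\<lambda>x. integral (cbox a2 b2) (\<lambda>y. integral (cbox a3 b3) (\<lambda>z. P1 x y z)))
    + integral (cbox a1 b1) (\<lambda>x. integral (cbox a2 b2) (\<lambda>y. integral (cbox a3 b3) (\<lambda>z. Q2 x y z)))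
    + integral (cbox a1 b1) (\<lambda>x. integral (cbox a2 b2) (\<lambda>y. integral (cbox a3 b3) (\<lambda>z. R3 x y z)))"
    unfolding integral_triple_add[OF cPQ c(3)] integral_triple_add[OF c(1,2)] ..
  also have "integral (cbox a1 b1) (\<lambda>x. integral (cbox a2 b2) (\<lambda>y. integral (cbox a3 b3) (\<lambda>z. P1 x y z)))
      = integral (cbox a2 b2) (\<lambda>y. integral (cbox a3 b3) (\<lambda>z. integral (cbox a1 b1) (\<lambda>x. P1 x y z)))"
    by (rule integral_triple_swap(2)[OF c(1)])
  also have "\<dots> = integral {a2..b2} (\<lambda>y. integral {a3..b3} (\<lambda>z. P b1 y z - P a1 y z))"
    unfolding cbox_interval
    by (intro integral_cong FTC[OF le(1)] P)
  also have "integral (cbox a1 b1) (\<lambda>x. integral (cbox a2 b2) (\<lambda>y. integral (cbox a3 b3) (\<lambda>z. Q2 x y z)))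
      = integral (cbox a1 b1) (\<lambda>x. integral (cbox a3 b3) (\<lambda>z. integral (cbox a2 b2) (\<lambda>y. Q2 x y z)))"
    by (rule integral_triple_swap(1)[OF c(2)])
  also have "\<dots> = integral {a1..b1} (\<lambda>x. integral {a3..b3} (\<lambda>z. Q x b2 z - Q x a2 z))"
    unfolding cbox_interval
    by (intro integral_cong FTC[OF le(2)] Q)
  also have "integral (cbox a1 b1) (\<lambda>x. integral (cbox a2 b2) (\<lambda>y. integral (cbox a3 b3) (\<lambda>z. R3 x y z)))
      = integral {a1..b1} (\<lambda>x. integral {a2..b2} (\<lambda>y. R x y b3 - R x y a3))"
    unfolding cbox_interval
    by (intro integral_cong FTC[OF le(3)] R)
  finally show ?thesis by simp
qed

lemma gk_inner_has_derivative:
  assumes "(F has_vector_derivative F') (at x within S)" "(w has_vector_derivative w') (at x within S)" "F x \<noteq> 0"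
  shows "((\<lambda>x. gk (F x) \<bullet> w x) has_real_derivative gk' (F x) F' \<bullet> w x + gk (F x) \<bullet> w') (at x within S)"
proof -
  have "((\<lambda>x. gk (F x)) has_derivative (\<lambda>h. gk' (F x) (h *\<^sub>R F'))) (at x within S)"
    using assms(1) unfolding has_vector_derivative_def
    by (rule has_derivative_compose[where f=F, OF _ gk_has_derivative[OF assms(3)]])
  then have 1: "((\<lambda>x. gk (F x)) has_vector_derivative gk' (F x) F') (at x within S)"
    by (simp add: has_vector_derivative_def linear_cmul[OF linear_gk'])
  from bounded_bilinear.has_vector_derivative[OF bounded_bilinear_inner this assms(2)]
  show ?thesis
    by (simp add: has_real_derivative_iff_has_vector_derivative add.commute)
qed

text \<open>Straight-line homotopies: the pull-back of the closed solid-angle form to \<open>[0,1] \<times> [-\<eta>,\<eta>]\<^sup>2\<close> is divergence free.\<close>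
lemma gauss_straight_homotopy:
  fixes A A' B B' C C' E E' :: "real \<Rightarrow> real^3"
  assumes der: "\<And>u. (A has_vector_derivative A' u) (at u)" "\<And>u. (B has_vector_derivative B' u) (at u)"
      "\<And>u. (C has_vector_derivative C' u) (at u)" "\<And>u. (E has_vector_derivative E' u) (at u)"
    and cont: "continuous_on UNIV A'" "continuous_on UNIV B'" "continuous_on UNIV C'" "continuous_on UNIV E'"
    and \<eta>: "\<eta> \<ge> 0"
    and F: "\<And>x y z. F x y z = (1 - x) *\<^sub>R (A y - C z) + x *\<^sub>R (B y - E z)"
    and G: "\<And>x y. G x y = (1 - x) *\<^sub>R A' y + x *\<^sub>R B' y"
    and H: "\<And>x z. H x z = (1 - x) *\<^sub>R C' z + x *\<^sub>R E' z"
    and X: "\<And>y z. X y z = (B y - A y) - (E z - C z)"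
    and nz: "\<And>x y z. x \<in> {0..1} \<Longrightarrow> y \<in> {-\<eta>..\<eta>} \<Longrightarrow> z \<in> {-\<eta>..\<eta>} \<Longrightarrow> F x y z \<noteq> 0"
    and P: "\<And>x y z. P x y z = gk (F x y z) \<bullet> cross3 (G x y) (H x z)"
    and Q: "\<And>x y z. Q x y z = gk (F x y z) \<bullet> cross3 (H x z) (X y z)"
    and R: "\<And>x y z. R x y z = gk (F x y z) \<bullet> cross3 (G x y) (X y z)"
  shows "integral {-\<eta>..\<eta>} (\<lambda>y. integral {-\<eta>..\<eta>} (\<lambda>z. P 1 y z - P 0 y z))
    + integral {0..1} (\<lambda>x. integral {-\<eta>..\<eta>} (\<lambda>z. Q x \<eta> z - Q x (-\<eta>) z))
    + integral {0..1} (\<lambda>x. integral {-\<eta>..\<eta>} (\<lambda>y. R x y \<eta> - R x y (-\<eta>))) = 0"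
proof -
  let ?I = "{-\<eta>..\<eta>}"
  note d = der[THEN has_vector_derivative_at_within]
  have c0: "continuous_on UNIV A" "continuous_on UNIV B" "continuous_on UNIV C" "continuous_on UNIV E"
    using der by (auto intro!: continuous_at_imp_continuous_on has_vector_derivative_continuous)
  note cc = c0[THEN continuous_on_compose2] cont[THEN continuous_on_compose2]
  let ?G' = "\<lambda>y. B' y - A' y" and ?H' = "\<lambda>z. E' z - C' z"
  define P1 where "P1 x y z = gk' (F x y z) (X y z) \<bullet> cross3 (G x y) (H x z)
     + gk (F x y z) \<bullet> (cross3 (G x y) (?H' z) + cross3 (?G' y) (H x z))" for x y z
  define Q2 where "Q2 x y z = gk' (F x y z) (G x y) \<bullet> cross3 (H x z) (X y z)
     + gk (F x y z) \<bullet> cross3 (H x z) (?G' y)" for x y z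
  \<comment> \<open>\<open>F\<close> varies with \<open>z\<close> in the direction
    \<open>- H x z\<close>. This sign is the reason that \<open>R\<close> pairs with
    \<open>G\<close> before \<open>X\<close>, against the cyclic order.\<close>
  define R3 where "R3 x y z = gk' (F x y z) (- H x z) \<bullet> cross3 (G x y) (X y z)
     + gk (F x y z) \<bullet> cross3 (G x y) (- ?H' z)" for x y z
  \<comment> \<open>The terms with \<open>gk'\<close> cancel because the Coulomb field is divergence
    free, the others because mixed derivatives of \<open>F\<close> commute.\<close>
  have zero: "P1 x y z + Q2 x y z + R3 x y z = 0" if "x \<in> {0..1}" "y \<in> ?I" "z \<in> ?I" for x y z
  proof -
    have 1: "gk' (F x y z) (X y z) \<bullet> cross3 (G x y) (H x z) + gk' (F x y z) (G x y) \<bullet> cross3 (H x z) (X y z)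
        + gk' (F x y z) (H x z) \<bullet> cross3 (X y z) (G x y) = 0"
      by (rule gk'_trace[OF nz[OF that]])
    have 2: "cross3 (G x y) (?H' z) + cross3 (?G' y) (H x z) + cross3 (H x z) (?G' y) + cross3 (G x y) (- ?H' z) = 0"
      by (simp add: cross3_def vec_eq_iff forall_3 vector_3 algebra_simps)
    have "P1 x y z + Q2 x y z + R3 x y z
      = (gk' (F x y z) (X y z) \<bullet> cross3 (G x y) (H x z) + gk' (F x y z) (G x y) \<bullet> cross3 (H x z) (X y z)
        + gk' (F x y z) (H x z) \<bullet> cross3 (X y z) (G x y))
      + gk (F x y z) \<bullet> (cross3 (G x y) (?H' z) + cross3 (?G' y) (H x z) + cross3 (H x z) (?G' y) + cross3 (G x y) (- ?H' z))"
      unfolding P1_def Q2_def R3_def linear_neg[OF linear_gk'] cross_skew[of "X y z" "G x y"]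
      by (simp only: inner_add_right inner_minus_left inner_minus_right)
    then show ?thesis unfolding 1 2 by simp
  qed
  have "integral {0..1} (\<lambda>x. integral ?I (\<lambda>y. integral ?I (\<lambda>z. P1 x y z + Q2 x y z + R3 x y z)))
    = integral ?I (\<lambda>y. integral ?I (\<lambda>z. P 1 y z - P 0 y z))
    + integral {0..1} (\<lambda>x. integral ?I (\<lambda>z. Q x \<eta> z - Q x (-\<eta>) z))
    + integral {0..1} (\<lambda>x. integral ?I (\<lambda>y. R x y \<eta> - R x y (-\<eta>)))"
  proof (rule box_divergence)
    fix x y z :: real assume xyz: "x \<in> {0..1}" "y \<in> ?I" "z \<in> ?I"
    note nz' = nz[OF xyz]
    have Fx: "((\<lambda>x. F x y z) has_vector_derivative X y z) (at x within S)" for S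
      unfolding F[abs_def] X
      by (auto intro!: derivative_eq_intros simp: has_vector_derivative_def algebra_simps)
    have Fy: "((\<lambda>y. F x y z) has_vector_derivative G x y) (at y within S)" for S
      unfolding F[abs_def] G
      by (auto intro!: derivative_eq_intros d)
    have Fz: "((\<lambda>z. F x y z) has_vector_derivative - H x z) (at z within S)" for S
      unfolding F[abs_def] H
      by (auto intro!: derivative_eq_intros d)
    have Gx: "((\<lambda>x. G x y) has_vector_derivative ?G' y) (at x within S)" for S
      unfolding G[abs_def]
      by (auto intro!: derivative_eq_intros simp: has_vector_derivative_def algebra_simps)
    have Hx: "((\<lambda>x. H x z) has_vector_derivative ?H' z) (at x within S)" for S
      unfolding H[abs_def]
      by (auto intro!: derivative_eq_intros simp: has_vector_derivative_def algebra_simps)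
    have Xy: "((\<lambda>y. X y z) has_vector_derivative ?G' y) (at y within S)" for S
      unfolding X[abs_def] by (auto intro!: derivative_eq_intros d)
    have Xz: "((\<lambda>z. X y z) has_vector_derivative - ?H' z) (at z within S)" for S
      unfolding X[abs_def] by (auto intro!: derivative_eq_intros d)
    note cr = bounded_bilinear.has_vector_derivative[OF bounded_bilinear_cross3]
    show "((\<lambda>x. P x y z) has_real_derivative P1 x y z) (at x within {0..1})"
      unfolding P[abs_def] P1_def
      by (rule gk_inner_has_derivative[where F="\<lambda>x. F x y z", OF Fx cr[OF Gx Hx] nz'])
    show "((\<lambda>y. Q x y z) has_real_derivative Q2 x y z) (at y within ?I)"
      unfolding Q[abs_def] Q2_def
      using gk_inner_has_derivative[where F="\<lambda>y. F x y z", OF Fy cr[OF has_vector_derivative_const[of "H x z"] Xy] nz', of ?I]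
      by simp
    show "((\<lambda>z. R x y z) has_real_derivative R3 x y z) (at z within ?I)"
      unfolding R[abs_def] R3_def
      using gk_inner_has_derivative[where F="\<lambda>z. F x y z", OF Fz cr[OF has_vector_derivative_const[of "G x y"] Xz] nz', of ?I]
      by simp
  next
    let ?S = "{0..1::real} \<times> ?I \<times> ?I"
    have cF: "continuous_on ?S (\<lambda>p. F (fst p) (fst (snd p)) (snd (snd p)))"
      unfolding F by (intro continuous_intros cc) auto
    have cG: "continuous_on ?S (\<lambda>p. G (fst p) (fst (snd p)))"
      unfolding G by (intro continuous_intros cc) auto
    have cH: "continuous_on ?S (\<lambda>p. H (fst p) (snd (snd p)))"
      unfolding H by (intro continuous_intros cc) auto
    have cX: "continuous_on ?S (\<lambda>p. X (fst (snd p)) (snd (snd p)))"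
      unfolding X by (intro continuous_intros cc) auto
    have cG': "continuous_on ?S (\<lambda>p. ?G' (fst (snd p)))" and cH': "continuous_on ?S (\<lambda>p. ?H' (snd (snd p)))"
      by (intro continuous_intros cc; auto)+
    have nzS: "F (fst p) (fst (snd p)) (snd (snd p)) \<noteq> 0" if "p \<in> ?S" for p using that nz by auto
    show "continuous_on ?S (\<lambda>(x, y, z). P1 x y z)"
      unfolding P1_def case_prod_beta
      by (intro continuous_on_add continuous_on_inner continuous_on_gk continuous_on_gk' continuous_on_cross3 cF cG cH cX cG' cH' nzS)
    show "continuous_on ?S (\<lambda>(x, y, z). Q2 x y z)"
      unfolding Q2_def case_prod_beta
      by (intro continuous_on_add continuous_on_inner continuous_on_gk continuous_on_gk' continuous_on_cross3 cF cG cH cX cG' cH' nzS)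
    show "continuous_on ?S (\<lambda>(x, y, z). R3 x y z)"
      unfolding R3_def case_prod_beta
      by (intro continuous_on_add continuous_on_inner continuous_on_gk continuous_on_gk' continuous_on_cross3 cF cG cH cX cG' cH' nzS continuous_on_minus)
  qed (use \<eta> in auto)
  moreover have "integral {0..1} (\<lambda>x. integral ?I (\<lambda>y. integral ?I (\<lambda>z. P1 x y z + Q2 x y z + R3 x y z))) = integral {0..1::real} (\<lambda>x. integral ?I (\<lambda>y. integral ?I (\<lambda>z. 0)))"
    by (intro integral_cong zero)
  ultimately show ?thesis by simp
qed

section \<open>The solid angle of a square\<close>

lemma has_derivative_quotient_sqrt:
  fixes m z :: real
  assumes p: "m + z^2 > 0"
  shows "((\<lambda>z. z / sqrt (m + z^2)) has_real_derivative m / sqrt (m + z^2) ^ 3) (at z within S)"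
proof -
  define s where "s = sqrt (m + z^2)"
  have s: "s > 0" "s^2 = m + z^2" using p by (auto simp: s_def)
  have 1: "((\<lambda>z. m + z^2) has_real_derivative 2 * z) (at z within S)"
    by (auto intro!: derivative_eq_intros)
  have ds: "((\<lambda>z. sqrt (m + z^2)) has_real_derivative inverse s / 2 * (2 * z)) (at z within S)"
    unfolding s_def by (rule DERIV_chain2[OF DERIV_real_sqrt[OF p] 1])
  have "((\<lambda>z. z / sqrt (m + z^2)) has_real_derivative (1 * s - z * (inverse s / 2 * (2 * z))) / (s * s)) (at z within S)"
    using DERIV_divide[OF DERIV_ident ds] s(1) by (simp add: s_def)
  moreover have "(1 * s - z * (inverse s / 2 * (2 * z))) / (s * s) = m / s^3"
  proof -
    have "1 * s - z * (inverse s / 2 * (2 * z)) = (s^2 - z^2) / s"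
      using s(1) by (simp add: field_simps power2_eq_square)
    also have "s^2 - z^2 = m" using s by simp
    finally show ?thesis using s(1) by (simp add: field_simps power_numeral_reduce)
  qed
  ultimately show ?thesis by (simp add: s_def)
qed

text \<open>A square of side \<open>2 * \<eta>\<close>, seen from the signed height \<open>r\<close>
  above its centre. The value tends to \<open>2 * pi\<close> or \<open>- 2 * pi\<close> as
  \<open>r\<close> tends to 0 from above or below; this is the source of the jump.\<close>

lemma solid_angle_square:
  fixes \<eta> r :: real
  assumes \<eta>: "\<eta> > 0" and r: "r \<noteq> 0"
  shows "integral {-\<eta>..\<eta>} (\<lambda>y. integral {-\<eta>..\<eta>} (\<lambda>z. r / sqrt (y^2 + z^2 + r^2) ^ 3))
    = 4 * arctan (\<eta> / r * (\<eta> / sqrt (r^2 + \<eta>^2 + \<eta>^2)))"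
proof -
  have r2: "r^2 > 0" using r by simp
  have inner: "integral {-\<eta>..\<eta>} (\<lambda>z. r / sqrt (y^2 + z^2 + r^2) ^ 3) = 2 * \<eta> * r / ((y^2 + r^2) * sqrt (y^2 + r^2 + \<eta>^2))" for y
  proof -
    let ?m = "y^2 + r^2"
    have m: "?m > 0" using r2 by (simp add: add_nonneg_pos)
    have "((\<lambda>z. r / sqrt (y^2 + z^2 + r^2) ^ 3) has_integral
        (r / ?m * (\<eta> / sqrt (?m + \<eta>^2)) - r / ?m * (- \<eta> / sqrt (?m + (-\<eta>)^2)))) {-\<eta>..\<eta>}"
    proof (rule fundamental_theorem_of_calculus)
      fix z :: real
      have p: "?m + z^2 > 0" using m by (simp add: add_pos_nonneg)
      have "((\<lambda>z. r / ?m * (z / sqrt (?m + z^2))) has_real_derivative r / ?m * (?m / sqrt (?m + z^2) ^ 3)) (at z within {-\<eta>..\<eta>})"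
        by (rule DERIV_cmult[OF has_derivative_quotient_sqrt[OF p]])
      moreover have "r / ?m * (?m / sqrt (?m + z^2) ^ 3) = r / sqrt (y^2 + z^2 + r^2) ^ 3"
        using m by (simp add: add_ac)
      ultimately show "((\<lambda>z. r / ?m * (z / sqrt (?m + z^2))) has_vector_derivative r / sqrt (y^2 + z^2 + r^2) ^ 3) (at z within {-\<eta>..\<eta>})"
        by (simp only: has_real_derivative_iff_has_vector_derivative)
    qed (use \<eta> in simp)
    from integral_unique[OF this] show ?thesis by simp
  qed
  let ?c = "r^2 + \<eta>^2"
  have c: "?c > 0" using r2 by (simp add: add_pos_nonneg)
  have "((\<lambda>y. 2 * \<eta> * r / ((y^2 + r^2) * sqrt (y^2 + r^2 + \<eta>^2))) has_integral
     (2 * arctan (\<eta> / r * (\<eta> / sqrt (?c + \<eta>^2))) - 2 * arctan (\<eta> / r * (- \<eta> / sqrt (?c + (-\<eta>)^2))))) {-\<eta>..\<eta>}"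
  proof (rule fundamental_theorem_of_calculus)
    fix y :: real
    have p: "?c + y^2 > 0" using c by (simp add: add_pos_nonneg)
    define s where "s = sqrt (?c + y^2)"
    have s: "s > 0" "s^2 = ?c + y^2" using p by (auto simp: s_def)
    have "((\<lambda>y. 2 * arctan (\<eta> / r * (y / sqrt (?c + y^2)))) has_real_derivative
       2 * (inverse (1 + (\<eta> / r * (y / sqrt (?c + y^2)))^2) * (\<eta> / r * (?c / sqrt (?c + y^2) ^ 3)))) (at y within {-\<eta>..\<eta>})"
      by (rule DERIV_cmult[OF DERIV_chain2[OF DERIV_arctan DERIV_cmult[OF has_derivative_quotient_sqrt[OF p]]]])
    moreover have "2 * (inverse (1 + (\<eta> / r * (y / s))^2) * (\<eta> / r * (?c / s ^ 3))) = 2 * \<eta> * r / ((y^2 + r^2) * s)"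
    proof -
      have 2: "1 + (\<eta> / r * (y / s))^2 = (y^2 + r^2) * ?c / (r^2 * s^2)"
      proof -
        have "r^2 * s^2 + \<eta>^2 * y^2 = (y^2 + r^2) * ?c" unfolding s(2) by algebra
        moreover have "1 + (\<eta> / r * (y / s))^2 = (r^2 * s^2 + \<eta>^2 * y^2) / (r^2 * s^2)"
          using s(1) r by (simp add: divide_simps power_mult_distrib power_divide)
        ultimately show ?thesis by simp
      qed
      have yr: "y^2 + r^2 > 0" using r2 by (simp add: add_nonneg_pos)
      have "inverse ((y^2 + r^2) * ?c / (r^2 * s^2)) = r^2 * s^2 / ((y^2 + r^2) * ?c)"
        by (simp add: inverse_eq_divide)
      moreover have "2 * (r^2 * s^2 / (A * K) * (\<eta> / r * (K / s ^ 3))) = 2 * \<eta> * r / (A * s)" if "A > 0" "K > 0" for A K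
        using that s(1) r by (simp add: divide_simps power_numeral_reduce)
      ultimately show ?thesis unfolding 2 using yr c by simp
    qed
    moreover have "s = sqrt (y^2 + r^2 + \<eta>^2)" by (simp add: s_def add_ac)
    ultimately show "((\<lambda>y. 2 * arctan (\<eta> / r * (y / sqrt (?c + y^2)))) has_vector_derivative
      2 * \<eta> * r / ((y^2 + r^2) * sqrt (y^2 + r^2 + \<eta>^2))) (at y within {-\<eta>..\<eta>})"
      by (simp only: has_real_derivative_iff_has_vector_derivative s_def)
  qed (use \<eta> in simp)
  from integral_unique[OF this]
  show ?thesis
    unfolding inner by (simp add: arctan_minus)
qed

section \<open>Two strands that cross in the collar\<close>

context torus_collar
begin

text \<open>The generators are translated so that they cross at parameter \<open>1/2\<close>, inside
  the unit square, and meet nowhere else on it. The level of the second strand is the variable that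
  passes through 0.\<close>

definition crossA :: "real \<Rightarrow> real^3" where "crossA u = \<Phi> ((u, 1/2), 0)"
definition crossA' :: "real \<Rightarrow> real^3" where "crossA' u = \<Phi>s ((u, 1/2), 0)"
definition crossB :: "real \<Rightarrow> real \<Rightarrow> real^3" where "crossB r v = \<Phi> ((1/2, v), r)"
definition crossB' :: "real \<Rightarrow> real \<Rightarrow> real^3" where "crossB' r v = \<Phi>t ((1/2, v), r)"

lemma crossA_eq: "crossA = cv (0, 1/2) (1, 0) 0" "crossA' = cv' (0, 1/2) (1, 0) 0"
  by (auto simp: fun_eq_iff crossA_def crossA'_def cv_def cv'_def)

lemma crossB_eq: "crossB r = cv (1/2, 0) (0, 1) r" "crossB' r = cv' (1/2, 0) (0, 1) r"
  by (auto simp: fun_eq_iff crossB_def crossB'_def cv_def cv'_def)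

text \<open>A collision forces both parameters to differ from \<open>1/2\<close> by integers, which
  is impossible on \<open>{0..1}\<close> unless they equal \<open>1/2\<close>.\<close>

lemma cross_neq:
  assumes "\<bar>r\<bar> < \<delta>" "u \<in> {0..1}" "v \<in> {0..1}" "(u, v, r) \<noteq> (1/2, 1/2, 0)"
  shows "crossA u \<noteq> crossB r v"
proof
  assume "crossA u = crossB r v"
  then have *: "u - 1/2 \<in> \<int>" "1/2 - v \<in> \<int>" "0 = r"
    using \<Phi>_inj[of 0 r u "1/2" "1/2" v] assms(1) \<delta>_pos by (auto simp: crossA_def crossB_def)
  have half: "w = 0" if w: "w \<in> \<int>" "\<bar>w\<bar> \<le> 1/2" for w :: real
  proof -
    obtain k :: int where k: "w = of_int k" by (rule Ints_cases[OF w(1)])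
    with w(2) have "\<bar>k\<bar> < 1" by linarith
    then show ?thesis using k by simp
  qed
  have "\<bar>u - 1/2\<bar> \<le> 1/2" "\<bar>1/2 - v\<bar> \<le> 1/2"
    using assms(2,3) unfolding abs_le_iff atLeastAtMost_iff by linarith+
  then have "u - 1/2 = 0" "1/2 - v = 0"
    using half * by blast+
  then show False using assms(4) *(3) by auto
qed

lemma continuous_on_cross:
  assumes "continuous_on S r" "continuous_on S u" "continuous_on S v"
    "\<And>p. p \<in> S \<Longrightarrow> crossA (u p) \<noteq> crossB (r p) (v p)"
  shows "continuous_on S (\<lambda>p. gk (crossA (u p) - crossB (r p) (v p)) \<bullet> cross3 (crossA' (u p)) (crossB' (r p) (v p)))"
  unfolding crossA_def crossB_def crossA'_def crossB'_def
  by (intro continuous_on_inner continuous_on_gk continuous_on_cross3 continuous_on_D continuous_on_\<Phi> continuous_intros assms)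
    (use assms(4) in \<open>auto simp: crossA_def crossB_def\<close>)

text \<open>Near the crossing point \<open>(1/2, 1/2)\<close> of the two curves, the straight-line homotopy from the orthogonal pair of lines
  spanned by \<open>\<alpha>\<close> and \<open>\<beta>\<close> to the pair of curves avoids collisions.\<close>
lemma crossing_frame:
  "\<exists>\<alpha> \<beta> \<nu> d. d > 0 \<and> \<alpha> \<bullet> \<alpha> = 1 \<and> \<beta> \<bullet> \<beta> = 1 \<and> \<nu> \<bullet> \<nu> = 1 \<and> \<alpha> \<bullet> \<beta> = 0 \<and> \<alpha> \<bullet> \<nu> = 0 \<and> \<beta> \<bullet> \<nu> = 0 \<and> cross3 \<alpha> \<beta> = \<nu> \<and>
    (\<forall>x y z r. x \<in> {0..1} \<longrightarrow> (y, z, r) \<noteq> 0 \<longrightarrow> \<bar>y\<bar> + \<bar>z\<bar> + \<bar>r\<bar> < d \<longrightarrow>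
      (1 - x) *\<^sub>R (y *\<^sub>R \<alpha> - (z *\<^sub>R \<beta> + r *\<^sub>R \<nu>)) + x *\<^sub>R (crossA (1/2 + y) - crossB r (1/2 + z)) \<noteq> 0)"
proof -
  let ?p = "((1/2, 1/2), 0) :: (real \<times> real) \<times> real"
  define a where "a = \<Phi>s ?p"
  define b where "b = \<Phi>t ?p"
  define \<nu> where "\<nu> = nrm (1/2, 1/2)"
  have an: "a \<bullet> \<nu> = 0" "b \<bullet> \<nu> = 0"
    using D_normal[of ?p 1 0] D_normal[of ?p 0 1] by (simp_all add: a_def b_def \<nu>_def inner_commute)
  have nn: "\<nu> \<bullet> \<nu> = 1" by (simp add: \<nu>_def nrm_inner)
  have J: "cross3 a b \<bullet> \<nu> > 0" using Jac_0[of "(1/2, 1/2)"] by (simp add: Jac_def a_def b_def \<nu>_def)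
  then have a0: "norm a > 0" by auto
  \<comment> \<open>\<open>\<alpha>\<close> points along the first strand and \<open>\<beta>\<close>
    completes it to an oriented frame of the tangent plane. The second strand need not be orthogonal
    to the first.\<close>
  define \<alpha> where "\<alpha> = (1 / norm a) *\<^sub>R a"
  define \<beta> where "\<beta> = cross3 \<nu> \<alpha>"
  have \<alpha>: "\<alpha> \<bullet> \<alpha> = 1" "\<alpha> \<bullet> \<nu> = 0" "a = norm a *\<^sub>R \<alpha>"
    using a0 an by (simp_all add: \<alpha>_def dot_square_norm power2_eq_square)
  have \<beta>0: "\<beta> \<bullet> \<nu> = 0" "\<alpha> \<bullet> \<beta> = 0" by (simp_all add: \<beta>_def dot_cross_self)
  have \<beta>1: "\<beta> \<bullet> \<beta> = 1"
    using norm_cross[of \<nu> \<alpha>] \<alpha> nn by (simp add: \<beta>_def dot_square_norm inner_commute)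
  have cr: "cross3 \<alpha> \<beta> = \<nu>"
    unfolding \<beta>_def Lagrange using \<alpha> by (simp add: inner_commute)
  \<comment> \<open>The orientation of the collar puts the second strand on the same side as
    \<open>\<beta>\<close>, so that turning one into the other never makes it parallel to the
    first.\<close>
  have b\<beta>: "b \<bullet> \<beta> > 0"
  proof -
    have "b \<bullet> \<beta> = (1 / norm a) * (b \<bullet> cross3 \<nu> a)" by (simp add: \<beta>_def \<alpha>_def cross_mult_right)
    also have "b \<bullet> cross3 \<nu> a = cross3 a b \<bullet> \<nu>" using cross3_triple[of a b \<nu>] by (simp add: inner_commute)
    finally show ?thesis using J a0 by simp
  qed
  define L where "L q = fst q *\<^sub>R a - (fst (snd q) *\<^sub>R b + snd (snd q) *\<^sub>R \<nu>)" for q :: "real \<times> real \<times> real"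
  define L0 where "L0 q = fst q *\<^sub>R \<alpha> - (fst (snd q) *\<^sub>R \<beta> + snd (snd q) *\<^sub>R \<nu>)" for q :: "real \<times> real \<times> real"
  define M where "M x q = (1 - x) *\<^sub>R L0 q + x *\<^sub>R L q" for x q
  define W where "W q = crossA (1/2 + fst q) - crossB (snd (snd q)) (1/2 + fst (snd q))" for q
  \<comment> \<open>In the frame the linear model is triangular: its components along
    \<open>\<nu>\<close>, \<open>\<beta>\<close> and \<open>\<alpha>\<close> give
    \<open>r = 0\<close>, \<open>z = 0\<close> and \<open>y = 0\<close> in this order.\<close>
  have Mnz: "M x q \<noteq> 0" if x: "x \<in> {0..1}" and q: "q \<noteq> 0" for x q
  proof
    assume M0: "M x q = 0"
    obtain y z r where yzr: "q = (y, z, r)" by (metis surj_pair)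
    have "M x q \<bullet> \<nu> = - r"
      using an nn \<alpha> \<beta>0 by (simp add: M_def L_def L0_def yzr inner_add_left inner_diff_left algebra_simps)
    then have r: "r = 0" using M0 by simp
    have "M x q \<bullet> \<beta> = - z * ((1 - x) + x * (b \<bullet> \<beta>)) + x * y * (a \<bullet> \<beta>)"
      using \<alpha>(1,2) \<beta>0 \<beta>1 r by (simp add: M_def L_def L0_def yzr inner_add_left inner_diff_left algebra_simps)
    moreover have "a \<bullet> \<beta> = 0" using \<alpha>(3) \<beta>0(2) by (metis inner_scaleR_left mult_zero_right)
    moreover have "(1 - x) + x * t > 0" if "t > 0" for t
      using that x by (cases "x = 0") (auto intro!: add_nonneg_pos)
    ultimately have z: "z = 0" using M0 b\<beta> by (smt (verit) inner_zero_left mult_eq_0_iff mult_zero_right)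
    have "M x q \<bullet> \<alpha> = y * ((1 - x) + x * (a \<bullet> \<alpha>))"
      using \<alpha>(1,2) by (simp add: M_def L_def L0_def yzr r z inner_add_left inner_diff_left algebra_simps)
    moreover have "a \<bullet> \<alpha> = norm a" using \<alpha> by (metis inner_scaleR_left mult_1_right)
    ultimately have "y = 0"
      using M0 a0 \<open>\<And>t. t > 0 \<Longrightarrow> (1 - x) + x * t > 0\<close>[of "norm a"] by simp
    then show False using q r z yzr by (simp add: zero_prod_def)
  qed
  \<comment> \<open>Compactness of the unit sphere and of the homotopy parameter turns injectivity
    of the linear models into one lower bound. The strands deviate from their linearisation by at
    most half of it.\<close>
  obtain c where c: "c > 0" "\<And>x q. x \<in> {0..1} \<Longrightarrow> norm (M x q) \<ge> c * norm q"
  proof -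
    let ?S = "{0..1::real} \<times> sphere (0 :: real \<times> real \<times> real) 1"
    have "compact ?S" by (intro compact_Times compact_Icc compact_sphere)
    moreover have "(0, (1, 0, 0)) \<in> ?S" by (auto simp: dist_norm norm_Pair)
    moreover have "continuous_on ?S (\<lambda>p. norm (M (fst p) (snd p)))"
      unfolding M_def L_def L0_def by (intro continuous_intros)
    ultimately obtain p where p: "p \<in> ?S" "\<And>p'. p' \<in> ?S \<Longrightarrow> norm (M (fst p) (snd p)) \<le> norm (M (fst p') (snd p'))"
      using continuous_attains_inf[of ?S] by (metis (no_types, lifting) empty_iff)
    show thesis
    proof (rule that[of "norm (M (fst p) (snd p))"])
      have "norm (snd p) = 1" "fst p \<in> {0..1}" using p(1) by (auto simp: mem_Times_iff)
      then have "snd p \<noteq> 0" "fst p \<in> {0..1}" by force+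
      then show "norm (M (fst p) (snd p)) > 0" using Mnz[of "fst p" "snd p"] by simp
      fix x q assume x: "x \<in> {0..1::real}"
      show "norm (M (fst p) (snd p)) * norm q \<le> norm (M x q)"
      proof (cases "q = 0")
        case False
        have "L (k *\<^sub>R q) = k *\<^sub>R L q" "L0 (k *\<^sub>R q) = k *\<^sub>R L0 q" for k
          by (simp_all add: L_def L0_def scaleR_diff_right scaleR_add_right)
        then have "M x ((1 / norm q) *\<^sub>R q) = (1 / norm q) *\<^sub>R M x q"
          by (simp add: M_def scaleR_add_right mult.commute)
        then have "norm (M (fst p) (snd p)) \<le> norm (M x q) / norm q"
          using p(2)[of "(x, (1 / norm q) *\<^sub>R q)"] x False by simp
        then show ?thesis using False by (simp add: field_simps)
      qed simp
    qed
  qed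
  have "(W has_derivative L) (at 0)"
  proof -
    have 1: "((\<lambda>q::real \<times> real \<times> real. \<Phi> ((1/2 + fst q, 1/2), 0)) has_derivative (\<lambda>q. D ?p ((fst q, 0), 0))) (at 0)"
    proof (rule has_derivative_compose[where f="\<lambda>q. ((1/2 + fst q, 1/2), 0)" and f'="\<lambda>q. ((fst q, 0), 0)" and g=\<Phi> and g'="D ?p"])
      show "((\<lambda>q::real \<times> real \<times> real. ((1/2 + fst q, 1/2::real), 0::real)) has_derivative (\<lambda>q. ((fst q, 0), 0))) (at 0)"
        by (intro has_derivative_Pair) (auto intro!: derivative_eq_intros)
      show "(\<Phi> has_derivative D ?p) (at ((1/2 + fst (0 :: real \<times> real \<times> real), 1/2), 0))"
        using D_has_derivative[of ?p] by simp
    qed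
    have 2: "((\<lambda>q::real \<times> real \<times> real. \<Phi> ((1/2, 1/2 + fst (snd q)), snd (snd q))) has_derivative (\<lambda>q. D ?p ((0, fst (snd q)), snd (snd q)))) (at 0)"
    proof (rule has_derivative_compose[where f="\<lambda>q. ((1/2, 1/2 + fst (snd q)), snd (snd q))" and f'="\<lambda>q. ((0, fst (snd q)), snd (snd q))" and g=\<Phi> and g'="D ?p"])
      show "((\<lambda>q::real \<times> real \<times> real. ((1/2::real, 1/2 + fst (snd q)), snd (snd q))) has_derivative (\<lambda>q. ((0, fst (snd q)), snd (snd q)))) (at 0)"
        by (intro has_derivative_Pair) (auto intro!: derivative_eq_intros)
      show "(\<Phi> has_derivative D ?p) (at ((1/2, 1/2 + fst (snd (0 :: real \<times> real \<times> real))), snd (snd (0 :: real \<times> real \<times> real))))"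
        using D_has_derivative[of ?p] by simp
    qed
    have "(\<lambda>q::real \<times> real \<times> real. D ?p ((fst q, 0), 0) - D ?p ((0, fst (snd q)), snd (snd q))) = L"
    proof
      fix q :: "real \<times> real \<times> real"
      show "D ?p ((fst q, 0), 0) - D ?p ((0, fst (snd q)), snd (snd q)) = L q"
        using D_split[of ?p "fst q" 0 0] D_split[of ?p 0 "fst (snd q)" "snd (snd q)"]
        by (simp add: L_def a_def b_def \<nu>_def)
    qed
    with has_derivative_diff[OF 1 2] show ?thesis
      by (simp add: W_def[abs_def] crossA_def crossB_def)
  qed
  then obtain d where d: "d > 0" "\<And>q. norm q < d \<Longrightarrow> norm (W q - L q) \<le> c / 2 * norm q"
  proof -
    have W0: "W 0 = 0" by (simp add: W_def crossA_def crossB_def)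
    assume "(W has_derivative L) (at 0)"
    then have "\<forall>e>0. \<exists>d>0. \<forall>y. norm (y - 0) < d \<longrightarrow> norm (W y - W 0 - L (y - 0)) \<le> e * norm (y - 0)"
      unfolding has_derivative_at_alt by simp
    then obtain d where "d > 0" "\<forall>y. norm (y - 0) < d \<longrightarrow> norm (W y - W 0 - L (y - 0)) \<le> c / 2 * norm (y - 0)"
      using c(1) half_gt_zero by blast
    then show thesis using that[of d] unfolding W0 diff_zero by blast
  qed
  show ?thesis
  proof (intro exI conjI allI impI, fact d(1), fact \<alpha>(1), fact \<beta>1, fact nn, fact \<beta>0(2), fact \<alpha>(2), fact \<beta>0(1), fact cr)
    fix x y z r :: real assume x: "x \<in> {0..1}" and q: "(y, z, r) \<noteq> 0" and small: "\<bar>y\<bar> + \<bar>z\<bar> + \<bar>r\<bar> < d"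
    let ?q = "(y, z, r)"
    have "norm ?q \<le> norm y + norm (z, r)" by (rule norm_Pair_le)
    also have "norm (z, r) \<le> norm z + norm r" by (rule norm_Pair_le)
    finally have "norm ?q < d" using small by simp
    note dq = d(2)[OF this]
    have "(1 - x) *\<^sub>R L0 ?q + x *\<^sub>R W ?q = M x ?q + x *\<^sub>R (W ?q - L ?q)"
      by (simp add: M_def algebra_simps)
    moreover have "norm (x *\<^sub>R (W ?q - L ?q)) < norm (M x ?q)"
    proof -
      have "norm (x *\<^sub>R (W ?q - L ?q)) \<le> 1 * (c / 2 * norm ?q)"
        unfolding norm_scaleR using x dq by (intro mult_mono) auto
      also have "\<dots> < c * norm ?q" using c(1) q by simp
      also have "\<dots> \<le> norm (M x ?q)" by (rule c(2)[OF x])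
      finally show ?thesis .
    qed
    ultimately have "(1 - x) *\<^sub>R L0 ?q + x *\<^sub>R W ?q \<noteq> 0"
      by (metis add_eq_0_iff norm_minus_cancel less_irrefl)
    then show "(1 - x) *\<^sub>R (y *\<^sub>R \<alpha> - (z *\<^sub>R \<beta> + r *\<^sub>R \<nu>)) + x *\<^sub>R (crossA (1/2 + y) - crossB r (1/2 + z)) \<noteq> 0"
      by (simp add: L0_def W_def)
  qed
qed

text \<open>At the crossing point the two curves are homotoped to two orthogonal lines at distance \<open>r\<close>, whose Gauss integral
  jumps by the full solid angle as \<open>r\<close> passes through 0.  The remaining contributions are continuous in \<open>r\<close>.\<close>
lemma gauss_jump:
  "\<exists>K \<eta> \<epsilon>. \<eta> > 0 \<and> 0 < \<epsilon> \<and> \<epsilon> < \<delta> \<and> continuous_on {-\<epsilon>..\<epsilon>} K \<and>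
    (\<forall>r. r \<noteq> 0 \<and> \<bar>r\<bar> \<le> \<epsilon> \<longrightarrow>
       integral {0..1} (\<lambda>u. integral {0..1} (\<lambda>v. gk (crossA u - crossB r v) \<bullet> cross3 (crossA' u) (crossB' r v)))
       = K r - 4 * arctan (\<eta> / r * (\<eta> / sqrt (r^2 + \<eta>^2 + \<eta>^2))))"
proof -
  from crossing_frame obtain \<alpha> \<beta> \<nu> d where
    nz: "\<forall>x y z r. x \<in> {0..1} \<longrightarrow> (y, z, r) \<noteq> 0 \<longrightarrow> \<bar>y\<bar> + \<bar>z\<bar> + \<bar>r\<bar> < d \<longrightarrow>
      (1 - x) *\<^sub>R (y *\<^sub>R \<alpha> - (z *\<^sub>R \<beta> + r *\<^sub>R \<nu>)) + x *\<^sub>R (crossA (1/2 + y) - crossB r (1/2 + z)) \<noteq> 0"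
    and fr: "d > 0" "\<alpha> \<bullet> \<alpha> = 1" "\<beta> \<bullet> \<beta> = 1" "\<nu> \<bullet> \<nu> = 1" "\<alpha> \<bullet> \<beta> = 0" "\<alpha> \<bullet> \<nu> = 0" "\<beta> \<bullet> \<nu> = 0" "cross3 \<alpha> \<beta> = \<nu>"
    by (elim exE conjE) (rule that)
  \<comment> \<open>The three coordinates add up to at most \<open>3 * d / 4\<close>. The bound
    \<open>1 / 4\<close> keeps the small square inside the parameter square, and
    \<open>\<delta> / 2\<close> keeps the levels inside the collar.\<close>
  define \<eta> where "\<eta> = min (d / 4) (1 / 4)"
  define \<epsilon> where "\<epsilon> = min (d / 4) (\<delta> / 2)"
  have \<eta>: "\<eta> > 0" "\<eta> \<le> d / 4" "\<eta> \<le> 1 / 4" and \<epsilon>: "\<epsilon> > 0" "\<epsilon> \<le> d / 4" "\<epsilon> < \<delta>"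
    using fr(1) \<delta>_pos by (auto simp: \<eta>_def \<epsilon>_def)
  let ?I = "{-\<eta>..\<eta>}" and ?R = "{-\<epsilon>..\<epsilon>}"
  define F where "F r x y z = (1 - x) *\<^sub>R (y *\<^sub>R \<alpha> - (z *\<^sub>R \<beta> + r *\<^sub>R \<nu>)) + x *\<^sub>R (crossA (1/2 + y) - crossB r (1/2 + z))" for r x y z
  define G where "G x y = (1 - x) *\<^sub>R \<alpha> + x *\<^sub>R crossA' (1/2 + y)" for x y
  define H where "H r x z = (1 - x) *\<^sub>R \<beta> + x *\<^sub>R crossB' r (1/2 + z)" for r x z
  define c0 where "c0 = crossA (1/2)"
  define X where "X r y z = (crossA (1/2 + y) - c0 - y *\<^sub>R \<alpha>) - (crossB r (1/2 + z) - c0 - (z *\<^sub>R \<beta> + r *\<^sub>R \<nu>))" for r y z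
  define P where "P r x y z = gk (F r x y z) \<bullet> cross3 (G x y) (H r x z)" for r x y z
  define Q where "Q r x y z = gk (F r x y z) \<bullet> cross3 (H r x z) (X r y z)" for r x y z
  define R where "R r x y z = gk (F r x y z) \<bullet> cross3 (G x y) (X r y z)" for r x y z
  have Fnz: "F r x y z \<noteq> 0" if "r \<in> ?R" "x \<in> {0..1}" "y \<in> ?I" "z \<in> ?I" "(y, z, r) \<noteq> 0" for r x y z
    unfolding F_def by (rule nz[rule_format]) (use that \<eta> \<epsilon> fr(1) in auto)
  define bd where "bd r = integral {0..1} (\<lambda>x. integral ?I (\<lambda>z. Q r x \<eta> z - Q r x (-\<eta>) z))
    + integral {0..1} (\<lambda>x. integral ?I (\<lambda>y. R r x y \<eta> - R r x y (-\<eta>)))" for r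
  have cA: "continuous_on UNIV crossA'" "continuous_on UNIV (crossB' r)" for r
    unfolding crossA'_def[abs_def] crossB'_def[abs_def] by (intro continuous_on_D continuous_intros)+
  have hom: "integral ?I (\<lambda>y. integral ?I (\<lambda>z. P r 1 y z - P r 0 y z)) + bd r = 0" if r: "r \<in> ?R" "r \<noteq> 0" for r
    unfolding bd_def add.assoc[symmetric]
  proof (rule gauss_straight_homotopy[where A="\<lambda>y. y *\<^sub>R \<alpha>" and A'="\<lambda>y. \<alpha>" and C="\<lambda>z. z *\<^sub>R \<beta> + r *\<^sub>R \<nu>" and C'="\<lambda>z. \<beta>"
        and B="\<lambda>y. crossA (1/2 + y) - c0" and B'="\<lambda>y. crossA' (1/2 + y)" and E="\<lambda>z. crossB r (1/2 + z) - c0" and E'="\<lambda>z. crossB' r (1/2 + z)"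
        and F="F r" and G=G and H="H r" and X="X r"])
    show "((\<lambda>y. y *\<^sub>R \<alpha>) has_vector_derivative \<alpha>) (at u)" "((\<lambda>z. z *\<^sub>R \<beta> + r *\<^sub>R \<nu>) has_vector_derivative \<beta>) (at u)" for u
      by (auto intro!: derivative_eq_intros simp: has_vector_derivative_def)
    have sh: "((\<lambda>y. g (1/2 + y) - c0) has_vector_derivative g' (1/2 + u)) (at u)" if "closed_curve g g'" for g g' :: "real \<Rightarrow> real^3" and u
    proof -
      have 1: "(g has_vector_derivative g' (1/2 + u)) (at (1/2 + u))" using that by (simp add: closed_curve_def)
      have 2: "((\<lambda>u::real. 1/2 + u) has_vector_derivative 1) (at u)"
        by (auto intro!: derivative_eq_intros simp: has_vector_derivative_def)
      from vector_diff_chain_at[OF 2 1] have "((\<lambda>u. g (1/2 + u)) has_vector_derivative g' (1/2 + u)) (at u)" by (simp add: o_def)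
      from has_vector_derivative_diff[OF this has_vector_derivative_const] show ?thesis by simp
    qed
    show "((\<lambda>y. crossA (1/2 + y) - c0) has_vector_derivative crossA' (1/2 + u)) (at u)"
      "((\<lambda>z. crossB r (1/2 + z) - c0) has_vector_derivative crossB' r (1/2 + u)) (at u)" for u
      by (rule sh; simp add: crossA_eq crossB_eq closed_curve_cv)+
    show "continuous_on UNIV (\<lambda>y. crossA' (1/2 + y))" "continuous_on UNIV (\<lambda>z. crossB' r (1/2 + z))"
      by (rule continuous_on_compose2[OF cA(1)] continuous_on_compose2[OF cA(2)]; auto intro!: continuous_intros)+
    show "F r x y z \<noteq> 0" if "x \<in> {0..1}" "y \<in> ?I" "z \<in> ?I" for x y z
      using Fnz[OF r(1) that] r(2) by (simp add: zero_prod_def)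
  qed (use \<eta> in \<open>auto simp: F_def G_def H_def X_def P_def Q_def R_def\<close>)
  define Z where "Z r u v = gk (crossA u - crossB r v) \<bullet> cross3 (crossA' u) (crossB' r v)" for r u v
  have P1: "P r 1 y z = Z r (1/2 + y) (1/2 + z)" for r y z
    by (simp add: P_def F_def G_def H_def Z_def)
  have P0: "P r 0 y z = - (r / sqrt (y^2 + z^2 + r^2) ^ 3)" for r y z
  proof -
    let ?w = "y *\<^sub>R \<alpha> - (z *\<^sub>R \<beta> + r *\<^sub>R \<nu>)"
    have "?w \<bullet> ?w = y^2 + z^2 + r^2"
      using fr by (simp add: inner_diff_left inner_diff_right inner_add_left inner_add_right inner_commute power2_eq_square)
    then have n: "norm ?w = sqrt (y^2 + z^2 + r^2)" by (simp add: norm_eq_sqrt_inner)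
    have "?w \<bullet> \<nu> = - r" using fr by (simp add: inner_diff_left inner_add_left)
    then show ?thesis by (simp add: P_def F_def G_def H_def gk_def n fr(8))
  qed
  define T where "T a b c e r = integral {a..b} (\<lambda>u. integral {c..e} (\<lambda>v. Z r u v))" for a b c e r
  let ?l = "1/2 - \<eta>" and ?m = "1/2 + \<eta>"
  have lm: "0 \<le> ?l" "?l < 1/2" "1/2 < ?m" "?m \<le> 1" using \<eta> by auto
  have param: "continuous_on K (\<lambda>r. integral {a..b} (\<lambda>u. integral {c..e} (\<lambda>v. \<zeta> r u v)))"
    if "continuous_on (K \<times> {a..b} \<times> {c..e}) (\<lambda>(r, u, v). \<zeta> r u v)" for K :: "real set" and a b c e and \<zeta> :: "real \<Rightarrow> real \<Rightarrow> real \<Rightarrow> real"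
  proof -
    have "continuous_on ((K \<times> {a..b}) \<times> cbox c e) (\<lambda>(p, v). \<zeta> (fst p) (snd p) v)"
      unfolding case_prod_beta by (rule continuous_on_curried3[OF that]) (auto intro!: continuous_intros)
    from integral_continuous_on_param[OF this]
    have "continuous_on (K \<times> cbox a b) (\<lambda>(r, u). integral {c..e} (\<lambda>v. \<zeta> r u v))" by (simp add: case_prod_beta)
    from integral_continuous_on_param[OF this] show ?thesis by simp
  qed
  have cZ: "continuous_on (K \<times> {a..b} \<times> {c..e}) (\<lambda>(r, u, v). Z r u v)"
    if "K \<subseteq> ?R" "0 \<le> a" "b \<le> 1" "0 \<le> c" "e \<le> 1" "0 \<notin> K \<or> 1/2 \<notin> {a..b} \<or> 1/2 \<notin> {c..e}" for K a b c e
  proof -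
    have "crossA u \<noteq> crossB r v" if "r \<in> K" "u \<in> {a..b}" "v \<in> {c..e}" for r u v
    proof (rule cross_neq)
      have "r \<in> ?R" using that \<open>K \<subseteq> ?R\<close> by auto
      then show "\<bar>r\<bar> < \<delta>" using \<epsilon> by auto
    qed (use that \<open>0 \<le> a\<close> \<open>b \<le> 1\<close> \<open>0 \<le> c\<close> \<open>e \<le> 1\<close> \<open>0 \<notin> K \<or> 1/2 \<notin> {a..b} \<or> 1/2 \<notin> {c..e}\<close> in auto)
    then show ?thesis
      unfolding Z_def case_prod_beta by (intro continuous_on_cross continuous_intros) auto
  qed
  have cT: "continuous_on ?R (T a b c e)"
    if "0 \<le> a" "b \<le> 1" "0 \<le> c" "e \<le> 1" "1/2 \<notin> {a..b} \<or> 1/2 \<notin> {c..e}" for a b c e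
    unfolding T_def[abs_def] by (rule param, rule cZ) (use that in auto)
  have cFGHX: "continuous_on S (\<lambda>p. F (r p) (x p) (y p) (z p))" "continuous_on S (\<lambda>p. G (x p) (y p))"
      "continuous_on S (\<lambda>p. H (r p) (x p) (z p))" "continuous_on S (\<lambda>p. X (r p) (y p) (z p))"
    if "continuous_on S r" "continuous_on S x" "continuous_on S y" "continuous_on S z" for S :: "(real \<times> real \<times> real) set" and r x y z
    unfolding F_def G_def H_def X_def crossA_def crossB_def crossA'_def crossB'_def
    by (intro continuous_intros continuous_on_\<Phi> continuous_on_D that)+
  \<comment> \<open>On the sides of the square \<open>y\<close> or \<open>z\<close> equals
    \<open>\<eta>\<close> or \<open>- \<eta>\<close>, so \<open>F\<close> does not vanish even at
    \<open>r = 0\<close> and the boundary terms pass continuously through the crossing.\<close>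
  have cbd: "continuous_on ?R bd"
  proof -
    have "continuous_on (?R \<times> {0..1} \<times> ?I) (\<lambda>(r, x, z). Q r x \<eta> z - Q r x (-\<eta>) z)"
      unfolding Q_def case_prod_beta
      by (intro continuous_on_diff continuous_on_inner continuous_on_gk continuous_on_cross3 cFGHX continuous_intros Fnz)
        (use \<eta> in \<open>auto simp: zero_prod_def\<close>)
    moreover have "continuous_on (?R \<times> {0..1} \<times> ?I) (\<lambda>(r, x, y). R r x y \<eta> - R r x y (-\<eta>))"
      unfolding R_def case_prod_beta
      by (intro continuous_on_diff continuous_on_inner continuous_on_gk continuous_on_cross3 cFGHX continuous_intros Fnz)
        (use \<eta> in \<open>auto simp: zero_prod_def\<close>)
    ultimately show ?thesis unfolding bd_def[abs_def] by (intro continuous_on_add param)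
  qed
  \<comment> \<open>The four rectangles around the central square, where the strands stay apart even
    at \<open>r = 0\<close>, together with the boundary terms of the homotopy.\<close>
  define K where "K r = T 0 ?l 0 1 r + T ?l ?m 0 ?l r + T ?l ?m ?m 1 r + T ?m 1 0 1 r - bd r" for r
  have "continuous_on ?R K"
    unfolding K_def[abs_def] by (intro continuous_on_add continuous_on_diff cT cbd) (use lm in auto)
  moreover have "T 0 1 0 1 r = K r - 4 * arctan (\<eta> / r * (\<eta> / sqrt (r^2 + \<eta>^2 + \<eta>^2)))" if r: "r \<noteq> 0" "\<bar>r\<bar> \<le> \<epsilon>" for r
  proof -
    have rR: "r \<in> ?R" using r by auto
    have cr: "continuous_on ({r} \<times> {0..1} \<times> {0..1}) (\<lambda>(r, u, v). Z r u v)"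
      by (rule cZ) (use r in auto)
    have cu: "continuous_on {c..e} (\<lambda>v. Z r u v)" if "u \<in> {0..1}" "0 \<le> c" "e \<le> 1" for u c e
      by (rule continuous_on_curried3[OF cr]) (use that in \<open>auto intro!: continuous_intros\<close>)
    have c2: "continuous_on {a..b} (\<lambda>u. integral {c..e} (\<lambda>v. Z r u v))" if "0 \<le> a" "b \<le> 1" "0 \<le> c" "e \<le> 1" for a b c e
    proof -
      have "continuous_on ({a..b} \<times> cbox c e) (\<lambda>(u, v). Z r u v)"
        unfolding case_prod_beta
        by (rule continuous_on_curried3[OF cr]) (use that in \<open>auto intro!: continuous_intros\<close>)
      from integral_continuous_on_param[OF this] show ?thesis by simp
    qed
    have split1: "T a b c e r = T a w c e r + T w b c e r" if "0 \<le> a" "a \<le> w" "w \<le> b" "b \<le> 1" "0 \<le> c" "e \<le> 1" for a w b c e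
      unfolding T_def
      by (rule Henstock_Kurzweil_Integration.integral_combine[symmetric]) (use that c2 in \<open>auto intro!: integrable_continuous_interval\<close>)
    have split2: "T a b c e r = T a b c w r + T a b w e r" if "0 \<le> a" "b \<le> 1" "0 \<le> c" "c \<le> w" "w \<le> e" "e \<le> 1" for a b c w e
    proof -
      have "T a b c e r = integral {a..b} (\<lambda>u. integral {c..w} (\<lambda>v. Z r u v) + integral {w..e} (\<lambda>v. Z r u v))"
        unfolding T_def
        by (intro integral_cong Henstock_Kurzweil_Integration.integral_combine[symmetric] integrable_continuous_interval cu) (use that in auto)
      also have "\<dots> = T a b c w r + T a b w e r"
        unfolding T_def by (intro integral_add integrable_continuous_interval c2) (use that in auto)
      finally show ?thesis .
    qed
    have "T 0 1 0 1 r = T 0 ?l 0 1 r + (T ?l ?m 0 ?l r + (T ?l ?m ?l ?m r + T ?l ?m ?m 1 r) + T ?m 1 0 1 r)"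
      using split1[of 0 ?l 1 0 1] split1[of ?l ?m 1 0 1] split2[of ?l ?m 0 ?l 1] split2[of ?l ?m ?l ?m 1] lm by simp
    moreover have "T ?l ?m ?l ?m r = integral ?I (\<lambda>y. integral ?I (\<lambda>z. P r 1 y z))"
    proof -
      have s1: "integral ?I (\<lambda>z. Z r u (1/2 + z)) = integral {?l..?m} (\<lambda>v. Z r u v)" for u
        using integral_shift_Icc_real[of "-\<eta>" \<eta> "Z r u" "1/2"] by (simp add: o_def add.commute[of \<eta>])
      have s2: "integral ?I (\<lambda>y. W (1/2 + y)) = integral {?l..?m} W" for W :: "real \<Rightarrow> real"
        using integral_shift_Icc_real[of "-\<eta>" \<eta> W "1/2"] by (simp add: o_def add.commute[of \<eta>])
      show ?thesis unfolding P1 T_def s1 using s2[of "\<lambda>u. integral {?l..?m} (\<lambda>v. Z r u v)"] by simp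
    qed
    moreover have "integral ?I (\<lambda>y. integral ?I (\<lambda>z. P r 1 y z - P r 0 y z))
      = integral ?I (\<lambda>y. integral ?I (\<lambda>z. P r 1 y z)) - integral ?I (\<lambda>y. integral ?I (\<lambda>z. P r 0 y z))"
    proof -
      have cP: "continuous_on (?I \<times> ?I) (\<lambda>(y, z). P r x y z)" if "x \<in> {0..1}" for x
      proof -
        have "continuous_on ({x} \<times> ?I \<times> ?I) (\<lambda>(x, y, z). P r x y z)"
          unfolding P_def case_prod_beta
          by (intro continuous_on_inner continuous_on_gk continuous_on_cross3 cFGHX continuous_intros Fnz)
            (use r rR that in \<open>auto simp: zero_prod_def\<close>)
        then show ?thesis
          unfolding case_prod_beta[of "P r x"] by (rule continuous_on_curried3) (auto intro!: continuous_intros)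
      qed
      have i1: "(\<lambda>z. P r x y z) integrable_on ?I" if "x \<in> {0..1}" "y \<in> ?I" for x y
        using continuous_on_compose2[OF cP[OF that(1)] continuous_on_Pair[OF continuous_on_const[of ?I y] continuous_on_id]] that
        by (intro integrable_continuous_interval) (auto simp: image_subset_iff)
      have i2: "(\<lambda>y. integral ?I (\<lambda>z. P r x y z)) integrable_on ?I" if "x \<in> {0..1}" for x
        using integral_continuous_on_param[of ?I "-\<eta>" \<eta> "P r x"] cP[OF that]
        by (intro integrable_continuous_interval) simp
      have "integral ?I (\<lambda>y. integral ?I (\<lambda>z. P r 1 y z - P r 0 y z)) = integral ?I (\<lambda>y. integral ?I (\<lambda>z. P r 1 y z) - integral ?I (\<lambda>z. P r 0 y z))"
        by (intro integral_cong integral_diff i1) auto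
      also have "\<dots> = integral ?I (\<lambda>y. integral ?I (\<lambda>z. P r 1 y z)) - integral ?I (\<lambda>y. integral ?I (\<lambda>z. P r 0 y z))"
        by (intro integral_diff i2) auto
      finally show ?thesis .
    qed
    moreover have "integral ?I (\<lambda>y. integral ?I (\<lambda>z. P r 0 y z)) = - (4 * arctan (\<eta> / r * (\<eta> / sqrt (r^2 + \<eta>^2 + \<eta>^2))))"
      unfolding P0 using solid_angle_square[OF \<eta>(1) r(1)] by simp
    ultimately show ?thesis using hom[OF rR r(1)] unfolding K_def by linarith
  qed
  ultimately have "\<eta> > 0 \<and> 0 < \<epsilon> \<and> \<epsilon> < \<delta> \<and> continuous_on ?R K \<and>
    (\<forall>r. r \<noteq> 0 \<and> \<bar>r\<bar> \<le> \<epsilon> \<longrightarrow> T 0 1 0 1 r = K r - 4 * arctan (\<eta> / r * (\<eta> / sqrt (r^2 + \<eta>^2 + \<eta>^2))))"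
    using \<eta> \<epsilon> by blast
  then show ?thesis unfolding T_def Z_def by blast
qed

text \<open>For \<open>r > 0\<close> the second strand is the upper one, for \<open>r < 0\<close>
  the first, so the Gauss integral equals \<open>4 * pi\<close> times
  \<open>lnk (0, 1) (1, 0)\<close> and \<open>lnk (1, 0) (0, 1)\<close> respectively. In the
  difference the continuous part \<open>K\<close> drops out in the limit, and the arctangents
  contribute \<open>8 * (pi / 2)\<close>.\<close>

lemma lnk_jump: "lnk (1, 0) (0, 1) - lnk (0, 1) (1, 0) = 1"
proof -
  define g where "g = cv (0, 1/2) (1, 0) 0"
  define g' where "g' = cv' (0, 1/2) (1, 0) 0"
  define h where "h r = cv (1/2, 0) (0, 1) r" for r
  define h' where "h' r = cv' (1/2, 0) (0, 1) r" for r
  from gauss_jump obtain K \<eta> \<epsilon> where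
    K5: "\<forall>r. r \<noteq> 0 \<and> \<bar>r\<bar> \<le> \<epsilon> \<longrightarrow> integral {0..1} (\<lambda>u. integral {0..1} (\<lambda>v. gk (crossA u - crossB r v) \<bullet> cross3 (crossA' u) (crossB' r v)))
       = K r - 4 * arctan (\<eta> / r * (\<eta> / sqrt (r^2 + \<eta>^2 + \<eta>^2)))"
    and K: "\<eta> > 0" "0 < \<epsilon>" "\<epsilon> < \<delta>" "continuous_on {-\<epsilon>..\<epsilon>} K"
    by (elim exE conjE) (rule that)
  let ?at = "\<lambda>r. 4 * arctan (\<eta> / r * (\<eta> / sqrt (r^2 + \<eta>^2 + \<eta>^2)))"
  have cg: "closed_curve g g'" and ch: "closed_curve (h r) (h' r)" for r
    by (simp_all add: g_def g'_def h_def h'_def closed_curve_cv)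
  have lk: "4 * pi * linking_number g (h r) = K r - ?at r" if r: "r \<noteq> 0" "\<bar>r\<bar> \<le> \<epsilon>" for r
  proof -
    have disj: "range g \<inter> range (h r) = {}"
      unfolding g_def h_def by (rule cv_disjoint) (use r K \<delta>_pos in auto)
    have "integral {0..1} (\<lambda>u. integral {0..1} (\<lambda>v. gk (g u - h r v) \<bullet> cross3 (g' u) (h' r v))) = 4 * pi * linking_number g (h r)"
      using integral_prod_continuous[OF gauss_integrand_continuous[OF cg ch disj, of "cbox (0,0) (1,1)"]]
      by (simp add: linking_number_gk[OF cg ch])
    then show ?thesis using K5 r by (simp add: crossA_eq crossB_eq g_def g'_def h_def h'_def)
  qed
  have up: "K r - ?at r = 4 * pi * lnk (0, 1) (1, 0)" if "0 < r" "r \<le> \<epsilon>" for r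
  proof -
    have "linking_number g (h r) = linking_number (h r) g"
      unfolding g_def h_def
      by (rule linking_number_commute[OF closed_curve_cv closed_curve_cv cv_disjoint]) (use that K \<delta>_pos in auto)
    also have "\<dots> = lnk (0, 1) (1, 0)"
      unfolding g_def h_def by (rule linking_cv) (use that K \<delta>_pos in auto)
    finally show ?thesis using lk[of r] that by simp
  qed
  have dn: "K r - ?at r = 4 * pi * lnk (1, 0) (0, 1)" if "r < 0" "-\<epsilon> \<le> r" for r
  proof -
    have "linking_number g (h r) = lnk (1, 0) (0, 1)"
      unfolding g_def h_def by (rule linking_cv) (use that K \<delta>_pos in auto)
    then show ?thesis using lk[of r] that by simp
  qed
  have eq: "4 * pi * (lnk (1, 0) (0, 1) - lnk (0, 1) (1, 0)) = K (- r) - K r + 8 * arctan (\<eta> / r * (\<eta> / sqrt (r^2 + \<eta>^2 + \<eta>^2)))"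
    if r: "0 < r" "r \<le> \<epsilon>" for r
    using up[OF r] dn[of "- r"] r by (simp add: arctan_minus algebra_simps)
  have "((\<lambda>r. K (- r) - K r + 8 * arctan (\<eta> / r * (\<eta> / sqrt (r^2 + \<eta>^2 + \<eta>^2)))) \<longlongrightarrow> K 0 - K 0 + 8 * (pi / 2)) (at_right 0)"
  proof (intro tendsto_intros)
    have K0: "(K \<longlongrightarrow> K 0) (at 0 within {-\<epsilon>..\<epsilon>})" using K by (auto simp: continuous_on_def)
    have r0: "filterlim (\<lambda>r. r) (at 0 within {-\<epsilon>..\<epsilon>}) (at_right 0)" "filterlim (\<lambda>r. - r) (at 0 within {-\<epsilon>..\<epsilon>}) (at_right 0)"
      unfolding filterlim_at using K(2)
      by (auto intro!: tendsto_eq_intros simp: eventually_at_right_field intro: exI[of _ \<epsilon>])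
    show "((\<lambda>r. K (- r)) \<longlongrightarrow> K 0) (at_right 0)" "(K \<longlongrightarrow> K 0) (at_right 0)"
      using filterlim_compose[OF K0 r0(1)] filterlim_compose[OF K0 r0(2)] by auto
    have "filterlim (\<lambda>r. \<eta> / r * (\<eta> / sqrt (r^2 + \<eta>^2 + \<eta>^2))) at_top (at_right 0)"
    proof (rule filterlim_at_top_mult_tendsto_pos[where c="\<eta> / sqrt (0^2 + \<eta>^2 + \<eta>^2)"])
      show "((\<lambda>r. \<eta> / sqrt (r^2 + \<eta>^2 + \<eta>^2)) \<longlongrightarrow> \<eta> / sqrt (0^2 + \<eta>^2 + \<eta>^2)) (at_right 0)"
        using K(1) by (intro tendsto_intros) auto
      show "filterlim (\<lambda>r. \<eta> / r) at_top (at_right 0)"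
        using K(1) filterlim_tendsto_pos_mult_at_top[OF tendsto_const K(1) filterlim_inverse_at_top_right]
        by (simp add: divide_inverse)
    qed (use K(1) in \<open>auto simp: divide_simps\<close>)
    then show "((\<lambda>r. arctan (\<eta> / r * (\<eta> / sqrt (r^2 + \<eta>^2 + \<eta>^2)))) \<longlongrightarrow> pi / 2) (at_right 0)"
      by (rule filterlim_compose[OF tendsto_arctan_at_top])
  qed
  moreover have "\<forall>\<^sub>F r in at_right 0. K (- r) - K r + 8 * arctan (\<eta> / r * (\<eta> / sqrt (r^2 + \<eta>^2 + \<eta>^2))) = 4 * pi * (lnk (1, 0) (0, 1) - lnk (0, 1) (1, 0))"
    unfolding eventually_at_right_field by (intro exI[of _ \<epsilon>] conjI K(2) allI impI eq[symmetric]) auto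
  ultimately have "((\<lambda>r::real. 4 * pi * (lnk (1, 0) (0, 1) - lnk (0, 1) (1, 0))) \<longlongrightarrow> K 0 - K 0 + 8 * (pi / 2)) (at_right 0)"
    by (rule Lim_transform_eventually)
  then have "4 * pi * (lnk (1, 0) (0, 1) - lnk (0, 1) (1, 0)) = 4 * pi"
    by (simp add: tendsto_const_iff)
  then show ?thesis by simp
qed

end

subsection \<open>The Riemann bilinear relation\<close>

lemma has_derivative_restrict_s:
  assumes "(f has_derivative f') (at ((s, t), r))"
  shows "((\<lambda>s. f ((s, t), r)) has_vector_derivative f' ((1, 0), 0)) (at s within S)"
proof -
  have "((\<lambda>s. ((s, t), r)) has_derivative (\<lambda>h. ((h, 0), 0))) (at s within S)"
    by (intro has_derivative_Pair) (auto intro!: derivative_eq_intros)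
  from has_derivative_compose[OF this assms]
  have "((\<lambda>s. f ((s, t), r)) has_derivative (\<lambda>h. f' ((h, 0), 0))) (at s within S)" .
  moreover have "(\<lambda>h. f' ((h, 0), 0)) = (\<lambda>h. h *\<^sub>R f' ((1, 0), 0))"
  proof
    fix h show "f' ((h, 0), 0) = h *\<^sub>R f' ((1, 0), 0)"
      using linear_cmul[OF has_derivative_linear[OF assms], of h "((1, 0), 0)"] by simp
  qed
  ultimately show ?thesis by (simp only: has_vector_derivative_def)
qed

lemma has_derivative_restrict_t:
  assumes "(f has_derivative f') (at ((s, t), r))"
  shows "((\<lambda>t. f ((s, t), r)) has_vector_derivative f' ((0, 1), 0)) (at t within S)"
proof -
  have "((\<lambda>t. ((s, t), r)) has_derivative (\<lambda>h. ((0, h), 0))) (at t within S)"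
    by (intro has_derivative_Pair) (auto intro!: derivative_eq_intros)
  from has_derivative_compose[OF this assms]
  have "((\<lambda>t. f ((s, t), r)) has_derivative (\<lambda>h. f' ((0, h), 0))) (at t within S)" .
  moreover have "(\<lambda>h. f' ((0, h), 0)) = (\<lambda>h. h *\<^sub>R f' ((0, 1), 0))"
  proof
    fix h show "f' ((0, h), 0) = h *\<^sub>R f' ((0, 1), 0)"
      using linear_cmul[OF has_derivative_linear[OF assms], of h "((0, 1), 0)"] by simp
  qed
  ultimately show ?thesis by (simp only: has_vector_derivative_def)
qed

context torus_collar
begin

text \<open>\<open>B\<^sub>1 \<and> B\<^sub>2 = d(p\<^sub>1 B\<^sub>2)\<close> on the torus at level \<open>r\<close>, cut open along two loops.\<close>
lemma wedge_period:
  fixes B2' :: "real^3 \<Rightarrow> (real^3) \<Rightarrow>\<^sub>L (real^3)"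
  assumes p1: "torus_potential B1 \<Phi> lo hi a1 b1 p1" and p2: "torus_potential B2 \<Phi> lo hi a2 b2 p2"
    and r: "lo < r" "r < hi"
    and c1: "continuous_on \<Omega> B1"
    and d2: "\<forall>y\<in>\<Omega>. (B2 has_derivative blinfun_apply (B2' y)) (at y)" and c2: "continuous_on \<Omega> B2'"
    and sym: "\<forall>y\<in>\<Omega>. \<forall>a b. B2' y a \<bullet> b = B2' y b \<bullet> a"
    and sub: "\<And>s t. \<Phi> ((s, t), r) \<in> \<Omega>"
  shows "integral {0..1} (\<lambda>s. integral {0..1} (\<lambda>t.
      (B1 (\<Phi> ((s, t), r)) \<bullet> \<Phi>s ((s, t), r)) * (B2 (\<Phi> ((s, t), r)) \<bullet> \<Phi>t ((s, t), r))
    - (B1 (\<Phi> ((s, t), r)) \<bullet> \<Phi>t ((s, t), r)) * (B2 (\<Phi> ((s, t), r)) \<bullet> \<Phi>s ((s, t), r)))) = a1 * b2 - b1 * a2"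
proof -
  let ?es = "((1, 0), 0) :: (real \<times> real) \<times> real" and ?et = "((0, 1), 0) :: (real \<times> real) \<times> real"
  define DD where "DD k h z = frechet_derivative (\<lambda>z. D z h) (at z) k" for k h z
  define P1 where "P1 s t = B1 (\<Phi> ((s, t), r)) \<bullet> \<Phi>s ((s, t), r)" for s t
  define Q1 where "Q1 s t = B1 (\<Phi> ((s, t), r)) \<bullet> \<Phi>t ((s, t), r)" for s t
  define P2 where "P2 s t = B2 (\<Phi> ((s, t), r)) \<bullet> \<Phi>s ((s, t), r)" for s t
  define Q2 where "Q2 s t = B2 (\<Phi> ((s, t), r)) \<bullet> \<Phi>t ((s, t), r)" for s t
  define q where "q s t = p1 ((s, t), r)" for s t
  \<comment> \<open>The common value of the \<open>t\<close>-derivative of \<open>P2\<close> and the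
    \<open>s\<close>-derivative of \<open>Q2\<close>: the second form is closed.\<close>
  define M where "M s t = B2 (\<Phi> ((s, t), r)) \<bullet> DD ?es ?et ((s, t), r)
      + B2' (\<Phi> ((s, t), r)) (\<Phi>s ((s, t), r)) \<bullet> \<Phi>t ((s, t), r)" for s t
  have cD1: "ck (Suc 0) (\<lambda>z. D z h)" for h
    unfolding D_def by (rule ck_Suc_derivative[OF ck_\<Phi>])
  have DDd: "((\<lambda>z. D z h) has_derivative (\<lambda>k. DD k h z)) (at z)" for h z
    unfolding DD_def by (rule ck_Suc_has_derivative[OF cD1])
  have DDsym: "DD k h z = DD h k z" for h k z
    unfolding DD_def D_def by (rule ck_symmetric[OF ck_\<Phi>])
  have cDD: "continuous_on S (\<lambda>p. DD k h (g p))" if "continuous_on S g" for S k h and g :: "real \<times> real \<Rightarrow> (real \<times> real) \<times> real"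
  proof -
    have "ck 0 (\<lambda>z. DD k h z)"
      unfolding DD_def by (rule ck_Suc_derivative[OF cD1])
    then show ?thesis by (rule continuous_on_compose2[OF ck_continuous that]) auto
  qed
  have form: "((\<lambda>z. B2 (\<Phi> z) \<bullet> D z h) has_derivative (\<lambda>k. B2 (\<Phi> z) \<bullet> DD k h z + B2' (\<Phi> z) (D z k) \<bullet> D z h)) (at z)"
    if "\<Phi> z \<in> \<Omega>" for z h
    by (rule has_derivative_inner[OF has_derivative_compose[OF D_has_derivative] DDd]) (use d2 that in blast)
  have Q2s: "((\<lambda>s. Q2 s t) has_vector_derivative M s t) (at s within S)" for s t S
    unfolding Q2_def M_def by (rule has_derivative_restrict_s[OF form[where z="((s, t), r)" and h="?et", OF sub]])
  have P2t: "((\<lambda>t. P2 s t) has_vector_derivative M s t) (at t within S)" for s t S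
  proof -
    have "B2 (\<Phi> ((s, t), r)) \<bullet> DD ?et ?es ((s, t), r) + B2' (\<Phi> ((s, t), r)) (\<Phi>t ((s, t), r)) \<bullet> \<Phi>s ((s, t), r) = M s t"
      unfolding M_def using sym[rule_format, OF sub[of s t]] DDsym by simp
    then show ?thesis
      unfolding P2_def using has_derivative_restrict_t[OF form[where z="((s, t), r)" and h="?es", OF sub], of S] by simp
  qed
  have qd: "(p1 has_derivative (\<lambda>h. B1 (\<Phi> ((s, t), r)) \<bullet> D ((s, t), r) h)) (at ((s, t), r))" for s t
    using p1[unfolded torus_potential_def, THEN spec[of _ s], THEN spec[of _ t], THEN spec[of _ r]] r unfolding D_def by simp
  have qs: "((\<lambda>s. q s t) has_vector_derivative P1 s t) (at s within S)" for s t S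
    unfolding q_def P1_def by (rule has_derivative_restrict_s[OF qd])
  have qt: "((\<lambda>t. q s t) has_vector_derivative Q1 s t) (at t within S)" for s t S
    unfolding q_def Q1_def by (rule has_derivative_restrict_t[OF qd])
  have cB2: "continuous_on \<Omega> B2"
    using d2 by (meson continuous_at_imp_continuous_on has_derivative_continuous)
  have pair: "continuous_on S (\<lambda>p::real \<times> real. ((fst p, snd p), r))" for S by (intro continuous_intros)
  have c\<Phi>: "continuous_on S (\<lambda>p::real \<times> real. \<Phi> ((fst p, snd p), r))" for S by (rule continuous_on_\<Phi>[OF pair])
  have cPQ: "continuous_on S (\<lambda>p. P1 (fst p) (snd p))" "continuous_on S (\<lambda>p. Q1 (fst p) (snd p))"
      "continuous_on S (\<lambda>p. P2 (fst p) (snd p))" "continuous_on S (\<lambda>p. Q2 (fst p) (snd p))" for S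
    unfolding P1_def Q1_def P2_def Q2_def
    by (intro continuous_on_inner continuous_on_D[OF pair] continuous_on_compose2[OF c1 c\<Phi>] continuous_on_compose2[OF cB2 c\<Phi>]; use sub in auto)+
  have cM: "continuous_on S (\<lambda>p. M (fst p) (snd p))" for S
  proof -
    have "continuous_on S (\<lambda>p. B2' (\<Phi> ((fst p, snd p), r)))"
      by (rule continuous_on_compose2[OF c2 c\<Phi>]) (use sub in auto)
    then have "continuous_on S (\<lambda>p. blinfun_apply (B2' (\<Phi> ((fst p, snd p), r))) (\<Phi>s ((fst p, snd p), r)))"
      by (intro bounded_bilinear.continuous_on[OF bounded_bilinear_blinfun_apply] continuous_on_D[OF pair])
    moreover have "continuous_on S (\<lambda>p. B2 (\<Phi> ((fst p, snd p), r)))"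
      by (rule continuous_on_compose2[OF cB2 c\<Phi>]) (use sub in auto)
    ultimately show ?thesis
      unfolding M_def by (intro continuous_on_add continuous_on_inner continuous_on_D[OF pair] cDD[OF pair])
  qed
  have cq: "continuous_on S (\<lambda>p. q (fst p) (snd p))" for S
  proof -
    have "isCont (\<lambda>p. q (fst p) (snd p)) p" for p
    proof -
      have "isCont p1 ((fst p, snd p), r)" by (rule has_derivative_continuous[OF qd])
      moreover have "isCont (\<lambda>p::real \<times> real. ((fst p, snd p), r)) p" by (intro continuous_intros)
      ultimately show ?thesis unfolding q_def by (rule isCont_o2[rotated])
    qed
    then show ?thesis by (simp add: continuous_at_imp_continuous_on)
  qed
  \<comment> \<open>\<open>f1\<close> is the \<open>s\<close>-derivative of \<open>q Q2\<close> and
    \<open>f2\<close> the \<open>t\<close>-derivative of \<open>q P2\<close>. The terms with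
    \<open>M\<close> cancel in \<open>f1 - f2\<close>, and by periodicity of \<open>P2\<close> and
    \<open>Q2\<close> each total derivative leaves only a period of \<open>p1\<close> times a loop
    integral of \<open>B2\<close>.\<close>
  define f1 where "f1 s t = q s t * M s t + P1 s t * Q2 s t" for s t
  define f2 where "f2 s t = q s t * M s t + Q1 s t * P2 s t" for s t
  have cf: "continuous_on S (\<lambda>(s, t). f1 s t)" "continuous_on S (\<lambda>(s, t). f2 s t)" for S
    unfolding f1_def f2_def case_prod_beta by (intro continuous_intros cPQ cM cq)+
  have per: "Q2 1 t = Q2 0 t" "P2 s 1 = P2 s 0" "q 1 t = q 0 t + a1" "q s 1 = q s 0 + b1" for s t
  proof -
    show "Q2 1 t = Q2 0 t" "P2 s 1 = P2 s 0"
      unfolding P2_def Q2_def using D_int[of 0 1 t 0 r] D_int[of s 0 0 1 r] \<Phi>_int[of 0 1 t 0 r] \<Phi>_int[of s 0 0 1 r] by simp_all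
    have "p1 ((0 + 1, t), r) = p1 ((0, t), r) + a1" "p1 ((s, 0 + 1), r) = p1 ((s, 0), r) + b1"
      using p1[unfolded torus_potential_def, THEN spec[of _ 0], THEN spec[of _ t], THEN spec[of _ r]]
        p1[unfolded torus_potential_def, THEN spec[of _ s], THEN spec[of _ 0], THEN spec[of _ r]] r by simp_all
    then show "q 1 t = q 0 t + a1" "q s 1 = q s 0 + b1" unfolding q_def by simp_all
  qed
  have I1: "integral {0..1} (\<lambda>s. integral {0..1} (\<lambda>t. f1 s t)) = a1 * b2"
  proof -
    have "integral {0..1} (\<lambda>s. integral {0..1} (\<lambda>t. f1 s t)) = integral {0..1} (\<lambda>t. integral {0..1} (\<lambda>s. f1 s t))"
      using integral_swap_continuous[OF cf(1), of 0 1 0 1] by simp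
    also have "\<dots> = integral {0..1} (\<lambda>t. a1 * Q2 0 t)"
    proof (rule integral_cong)
      fix t :: real
      have "((\<lambda>s. f1 s t) has_integral q 1 t * Q2 1 t - q 0 t * Q2 0 t) {0..1}"
        unfolding f1_def
        by (rule fundamental_theorem_of_calculus) (auto intro!: bounded_bilinear.has_vector_derivative[OF bounded_bilinear_mult] qs Q2s)
      from integral_unique[OF this] show "integral {0..1} (\<lambda>s. f1 s t) = a1 * Q2 0 t"
        by (simp add: per algebra_simps)
    qed
    also have "integral {0..1} (\<lambda>t. a1 * Q2 0 t) = a1 * b2"
      using integral_unique[OF torus_potential_period[OF p2 r, of "(0, 0)" 0 1]]
      by (simp add: Q2_def D_def)
    finally show ?thesis .
  qed
  have I2: "integral {0..1} (\<lambda>s. integral {0..1} (\<lambda>t. f2 s t)) = b1 * a2"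
  proof -
    have "integral {0..1} (\<lambda>s. integral {0..1} (\<lambda>t. f2 s t)) = integral {0..1} (\<lambda>s. b1 * P2 s 0)"
    proof (rule integral_cong)
      fix s :: real
      have "((\<lambda>t. f2 s t) has_integral q s 1 * P2 s 1 - q s 0 * P2 s 0) {0..1}"
        unfolding f2_def
        by (rule fundamental_theorem_of_calculus) (auto intro!: bounded_bilinear.has_vector_derivative[OF bounded_bilinear_mult] qt P2t)
      from integral_unique[OF this] show "integral {0..1} (\<lambda>t. f2 s t) = b1 * P2 s 0"
        by (simp add: per algebra_simps)
    qed
    also have "integral {0..1} (\<lambda>s. b1 * P2 s 0) = b1 * a2"
      using integral_unique[OF torus_potential_period[OF p2 r, of "(0, 0)" 1 0]]
      by (simp add: P2_def D_def)
    finally show ?thesis .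
  qed
  have in1: "(\<lambda>t. f s t) integrable_on {0..1}" if "continuous_on UNIV (\<lambda>(s, t). f s t)" for f :: "real \<Rightarrow> real \<Rightarrow> real" and s
    using continuous_on_compose2[OF that continuous_on_Pair[OF continuous_on_const[of "{0..1}" s] continuous_on_id]]
    by (intro integrable_continuous_interval) auto
  have in2: "(\<lambda>s. integral {0..1} (\<lambda>t. f s t)) integrable_on {0..1}" if "continuous_on UNIV (\<lambda>(s, t). f s t)" for f :: "real \<Rightarrow> real \<Rightarrow> real"
  proof (rule integrable_continuous_interval)
    have "continuous_on ({0..1} \<times> cbox 0 1) (\<lambda>(s, t). f s t)" using that continuous_on_subset by blast
    from integral_continuous_on_param[OF this] show "continuous_on {0..1} (\<lambda>s. integral {0..1} (\<lambda>t. f s t))" by simp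
  qed
  have "P1 s t * Q2 s t - Q1 s t * P2 s t = f1 s t - f2 s t" for s t by (simp add: f1_def f2_def)
  then have "integral {0..1} (\<lambda>s. integral {0..1} (\<lambda>t. P1 s t * Q2 s t - Q1 s t * P2 s t))
    = integral {0..1} (\<lambda>s. integral {0..1} (\<lambda>t. f1 s t) - integral {0..1} (\<lambda>t. f2 s t))"
    by (simp add: integral_diff[OF in1[OF cf(1)] in1[OF cf(2)]])
  also have "\<dots> = a1 * b2 - b1 * a2"
    by (simp add: integral_diff[OF in2[OF cf(1)] in2[OF cf(2)]] I1 I2)
  finally show ?thesis unfolding P1_def Q1_def P2_def Q2_def .
qed

subsection \<open>A separating function\<close>

definition slab :: "((real \<times> real) \<times> real) set" where "slab = UNIV \<times> {-\<delta><..<\<delta>}"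
definition nbhd :: "(real^3) set" where "nbhd = \<Phi> ` slab"
text \<open>An inverse of \<open>\<Phi>\<close> up to lattice translations. Only the height and the
  normal of the chosen point are used, and these do not depend on the choice.\<close>

definition sec :: "real^3 \<Rightarrow> (real \<times> real) \<times> real" where "sec y = (SOME z. z \<in> slab \<and> \<Phi> z = y)"

lemma \<Phi>_inj_slab:
  assumes "z \<in> slab" "w \<in> slab" "\<Phi> z = \<Phi> w"
  shows "snd z = snd w" "nrm (fst z) = nrm (fst w)"
proof -
  obtain s t r s' t' r' where z: "z = ((s, t), r)" and w: "w = ((s', t'), r')" by (cases z; cases w; cases "fst z"; cases "fst w") auto
  have *: "s - s' \<in> \<int> \<and> t - t' \<in> \<int> \<and> r = r'"
    by (rule \<Phi>_inj) (use assms in \<open>auto simp: z w slab_def\<close>)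
  then show "snd z = snd w" by (simp add: z w)
  obtain m n :: int where "s - s' = of_int m" "t - t' = of_int n" using * by (auto elim!: Ints_cases)
  then have st: "s = s' + of_int m" "t = t' + of_int n" by simp_all
  have "D ((s, t), 0) ((0,0),1) = D ((s', t'), 0) ((0,0),1)" unfolding st by (simp add: D_int)
  then show "nrm (fst z) = nrm (fst w)" by (simp add: D_r z w)
qed

lemma sec: "z \<in> slab \<Longrightarrow> sec (\<Phi> z) \<in> slab \<and> \<Phi> (sec (\<Phi> z)) = \<Phi> z"
  unfolding sec_def by (rule someI[where x=z]) (rule conjI, assumption, rule refl)

lemma snd_sec: "z \<in> slab \<Longrightarrow> snd (sec (\<Phi> z)) = snd z"
  by (rule \<Phi>_inj_slab(1)[OF conjunct1[OF sec] _ conjunct2[OF sec]])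

lemma nrm_sec: "z \<in> slab \<Longrightarrow> nrm (fst (sec (\<Phi> z))) = nrm (fst z)"
  by (rule \<Phi>_inj_slab(2)[OF conjunct1[OF sec] _ conjunct2[OF sec]])

text \<open>An open box of side 1 around the point contains no two parameters that differ by a
  nonzero lattice vector, so \<open>\<Phi>\<close> is injective on it and invariance of domain
  applies.\<close>

lemma local_inverse:
  assumes "z0 \<in> slab"
  shows "\<exists>V \<psi>. open V \<and> z0 \<in> V \<and> V \<subseteq> slab \<and> open (\<Phi> ` V) \<and> (\<forall>z\<in>V. \<psi> (\<Phi> z) = z) \<and> continuous_on (\<Phi> ` V) \<psi>"
proof -
  obtain s0 t0 r0 where z0: "z0 = ((s0, t0), r0)" by (cases z0; cases "fst z0") auto
  define V where "V = ({s0 - 1/2 <..< s0 + 1/2} \<times> {t0 - 1/2 <..< t0 + 1/2}) \<times> {-\<delta><..<\<delta>}"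
  have V: "open V" "z0 \<in> V" "V \<subseteq> slab"
    using assms by (auto simp: V_def z0 slab_def intro!: open_Times)
  have c: "continuous_on V \<Phi>" using continuous_on_\<Phi>[OF continuous_on_id] by simp
  have half: "w = 0" if w: "w \<in> \<int>" "\<bar>w\<bar> < 1" for w :: real
  proof -
    obtain k :: int where k: "w = of_int k" by (rule Ints_cases[OF w(1)])
    with w(2) have "\<bar>k\<bar> < 1" by linarith
    then show ?thesis using k by simp
  qed
  have inj: "inj_on \<Phi> V"
  proof (rule inj_onI)
    fix z w assume zw: "z \<in> V" "w \<in> V" "\<Phi> z = \<Phi> w"
    obtain s t r s' t' r' where z: "z = ((s, t), r)" and w: "w = ((s', t'), r')" by (cases z; cases w; cases "fst z"; cases "fst w") auto
    have *: "s - s' \<in> \<int> \<and> t - t' \<in> \<int> \<and> r = r'"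
      by (rule \<Phi>_inj) (use zw in \<open>auto simp: z w V_def\<close>)
    have "\<bar>s - s'\<bar> < 1" "\<bar>t - t'\<bar> < 1"
      using zw(1,2) unfolding z w V_def mem_Times_iff fst_conv snd_conv greaterThanLessThan_iff abs_less_iff by linarith+
    then show "z = w" using half[of "s - s'"] half[of "t - t'"] * by (simp add: z w)
  qed
  have dim: "DIM(real^3) \<le> DIM((real \<times> real) \<times> real)" by simp
  have inv: "\<And>z. z \<in> V \<Longrightarrow> inv_into V \<Phi> (\<Phi> z) = z" using inj by simp
  show ?thesis
    using V invariance_of_domain_gen[OF V(1) c inj dim] inv continuous_on_inverse_open[OF V(1) c dim inv]
    by (intro exI[of _ V] exI[of _ "inv_into V \<Phi>"]) simp
qed

lemma open_\<Phi>_image: assumes "open W" "W \<subseteq> slab" shows "open (\<Phi> ` W)"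
proof (subst open_subopen, intro ballI)
  fix y assume "y \<in> \<Phi> ` W"
  then obtain z where z: "z \<in> W" "y = \<Phi> z" by auto
  have "z \<in> slab" using z assms by auto
  from local_inverse[OF this] obtain V \<psi> where V: "open V" "z \<in> V" "\<forall>z\<in>V. \<psi> (\<Phi> z) = z"
    by (elim exE conjE) (rule that)
  have "open (\<Phi> ` (V \<inter> W))"
  proof (rule invariance_of_domain_gen)
    show "inj_on \<Phi> (V \<inter> W)" by (rule inj_on_inverseI[of _ \<psi>]) (use V(3) in blast)
    show "continuous_on (V \<inter> W) \<Phi>" using continuous_on_\<Phi>[OF continuous_on_id] by simp
    show "open (V \<inter> W)" using V(1) assms(1) by (rule open_Int)
  qed simp
  then show "\<exists>T. open T \<and> y \<in> T \<and> T \<subseteq> \<Phi> ` W" using V z by blast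
qed

lemma open_slab: "open slab"
  unfolding slab_def by (intro open_Times open_UNIV open_greaterThanLessThan)

lemma open_nbhd: "open nbhd"
  unfolding nbhd_def by (rule open_\<Phi>_image[OF open_slab order.refl])

text \<open>The gradient of the height is the unit normal itself, because the levels of the collar
  are parallel surfaces.\<close>

lemma height_has_derivative:
  assumes z0: "z0 \<in> slab"
  shows "((\<lambda>y. snd (sec y)) has_derivative (\<lambda>h. h \<bullet> nrm (fst z0))) (at (\<Phi> z0))"
proof -
  from local_inverse[OF z0] obtain V \<psi> where V: "open V" "z0 \<in> V" "V \<subseteq> slab" "open (\<Phi> ` V)" "\<forall>z\<in>V. \<psi> (\<Phi> z) = z" "continuous_on (\<Phi> ` V) \<psi>"
    by (elim exE conjE) (rule that)
  let ?n = "nrm (fst z0)"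
  \<comment> \<open>The inverse matrix of \<open>D z0\<close> by Cramer's rule: cross products of
    two columns, divided by the Jacobian. For the third row this quotient is the normal.\<close>
  define g' where "g' h = ((h \<bullet> cross3 (\<Phi>t z0) ?n / Jac z0, h \<bullet> cross3 ?n (\<Phi>s z0) / Jac z0), h \<bullet> ?n)" for h
  have J: "Jac z0 \<noteq> 0" using z0 Jac_pos[of "snd z0" "fst (fst z0)" "snd (fst z0)"] by (auto simp: slab_def abs_less_iff)
  have "(\<psi> has_derivative g') (at (\<Phi> z0))"
  proof (rule has_derivative_inverse_basic[where f=\<Phi> and f'="D z0" and T="\<Phi> ` V"])
    show "(\<Phi> has_derivative D z0) (at (\<psi> (\<Phi> z0)))" using V(2,5) D_has_derivative by simp
    have "linear g'"
      by (rule linearI) (auto simp: g'_def inner_add_left add_divide_distrib)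
    then show "bounded_linear g'" using linear_conv_bounded_linear by blast
    show "g' \<circ> D z0 = id"
    proof
      fix h :: "(real \<times> real) \<times> real"
      obtain a b c where h: "h = ((a, b), c)" by (cases h; cases "fst h") auto
      have e: "D z0 h = a *\<^sub>R \<Phi>s z0 + b *\<^sub>R \<Phi>t z0 + c *\<^sub>R ?n" unfolding h by (rule D_split)
      have n: "\<Phi>s z0 \<bullet> ?n = 0" "\<Phi>t z0 \<bullet> ?n = 0" using D_normal by (simp_all add: inner_commute)
      have t: "\<Phi>s z0 \<bullet> cross3 (\<Phi>t z0) ?n = Jac z0" "\<Phi>t z0 \<bullet> cross3 ?n (\<Phi>s z0) = Jac z0"
        unfolding Jac_def by (simp_all add: cross3_def inner_vec_def sum_3 vector_3 algebra_simps)
      have "g' (D z0 h) = ((a, b), c)"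
        unfolding g'_def e using J by (simp add: inner_add_left t n nrm_inner dot_cross_self)
      then show "(g' \<circ> D z0) h = id h" using h by simp
    qed
    show "continuous (at (\<Phi> z0)) \<psi>" using V(2,4,6) continuous_on_eq_continuous_at by blast
    show "\<Phi> (\<psi> y) = y" if "y \<in> \<Phi> ` V" for y using that V(5) by (elim imageE) simp
    show "open (\<Phi> ` V)" by (rule V(4))
    show "\<Phi> z0 \<in> \<Phi> ` V" using V(2) by blast
  qed
  then have "((\<lambda>y. snd (\<psi> y)) has_derivative (\<lambda>h. snd (g' h))) (at (\<Phi> z0))" by (rule has_derivative_snd)
  then have "((\<lambda>y. snd (\<psi> y)) has_derivative (\<lambda>h. h \<bullet> ?n)) (at (\<Phi> z0))" by (simp add: g'_def)
  then show ?thesis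
  proof (rule has_derivative_transform_within_open[OF _ V(4)])
    show "\<Phi> z0 \<in> \<Phi> ` V" using V(2) by blast
    fix y assume "y \<in> \<Phi> ` V"
    then obtain z where z: "z \<in> V" "y = \<Phi> z" by blast
    then have "z \<in> slab" using V(3) by blast
    from snd_sec[OF this] show "snd (\<psi> y) = snd (sec y)" using V(5) z by simp
  qed
qed

text \<open>A tent over \<open>[- \<delta>/2, 0]\<close>, safely below the level
  \<open>\<delta>/2\<close> of the loops whose fields are multiplied. Its integral is of class C^1,
  which is the regularity that the divergence theorem uses.\<close>

definition bump :: "real \<Rightarrow> real" where "bump r = max 0 (\<delta> / 4 - \<bar>r + \<delta> / 4\<bar>)"
definition ramp :: "real \<Rightarrow> real" where "ramp r = integral {-\<delta>..r} bump"

lemma bump_continuous: "continuous_on S bump" unfolding bump_def by (intro continuous_intros)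
lemma bump_0: "r \<le> -\<delta>/2 \<or> 0 \<le> r \<Longrightarrow> bump r = 0" unfolding bump_def using \<delta>_pos by auto
lemma bump_nonneg: "bump r \<ge> 0" by (simp add: bump_def)

lemma ramp_low: "r \<le> -\<delta>/2 \<Longrightarrow> ramp r = 0"
proof -
  assume "r \<le> -\<delta>/2"
  then have "integral {-\<delta>..r} bump = integral {-\<delta>..r} (\<lambda>_. 0)"
    by (intro integral_cong bump_0) auto
  then show ?thesis by (simp add: ramp_def)
qed

lemma ramp_split: "-\<delta> \<le> a \<Longrightarrow> a \<le> b \<Longrightarrow> ramp b = ramp a + integral {a..b} bump"
  unfolding ramp_def
  by (rule Henstock_Kurzweil_Integration.integral_combine[symmetric], assumption+,
      rule integrable_continuous_interval, rule bump_continuous)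

lemma ramp_high: "0 \<le> r \<Longrightarrow> ramp r = ramp 0"
proof -
  assume "0 \<le> r"
  moreover have "integral {0..r} bump = integral {0..r} (\<lambda>_. 0)"
    by (intro integral_cong bump_0) auto
  ultimately show ?thesis using ramp_split[of 0 r] \<delta>_pos by simp
qed

lemma ramp_pos: "ramp 0 > 0"
proof -
  have le: "-\<delta> \<le> -3/8 * \<delta>" "-3/8 * \<delta> \<le> -1/8 * \<delta>" "-\<delta> \<le> -1/8 * \<delta>" "-1/8 * \<delta> \<le> 0" using \<delta>_pos by auto
  have nn: "integral {a..b} bump \<ge> 0" for a b
    by (rule integral_nonneg) (auto intro!: integrable_continuous_interval bump_continuous bump_nonneg)
  \<comment> \<open>On the middle half of its support the tent has at least half of its height
    \<open>\<delta> / 4\<close>.\<close>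
  have "integral {-3/8 * \<delta>..-1/8 * \<delta>} (\<lambda>r. \<delta> / 8) \<le> integral {-3/8 * \<delta>..-1/8 * \<delta>} bump"
  proof (rule integral_le)
    fix r assume "r \<in> {-3/8 * \<delta>..-1/8 * \<delta>}"
    then have "\<bar>r + \<delta> / 4\<bar> \<le> \<delta> / 8" unfolding abs_le_iff by (simp add: field_simps)
    then show "\<delta> / 8 \<le> bump r" by (simp add: bump_def max_def)
  qed (auto intro!: integrable_continuous_interval bump_continuous)
  moreover have "integral {-3/8 * \<delta>..-1/8 * \<delta>} (\<lambda>r. \<delta> / 8) > 0" using \<delta>_pos by simp
  moreover have "ramp 0 = ramp (-3/8 * \<delta>) + integral {-3/8 * \<delta>..-1/8 * \<delta>} bump + integral {-1/8 * \<delta>..0} bump"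
    using ramp_split[OF le(1,2)] ramp_split[OF le(3,4)] by simp
  moreover have "ramp (-3/8 * \<delta>) \<ge> 0" using nn by (simp add: ramp_def)
  ultimately show ?thesis using nn[of "-1/8 * \<delta>" 0] by linarith
qed

lemma ramp_has_derivative: "-\<delta> < r \<Longrightarrow> r < \<delta> \<Longrightarrow> (ramp has_real_derivative bump r) (at r)"
proof -
  assume r: "-\<delta> < r" "r < \<delta>"
  have "((\<lambda>u. integral {-\<delta>..u} bump) has_vector_derivative bump r) (at r within {-\<delta>..\<delta>})"
    by (rule integral_has_vector_derivative[OF bump_continuous]) (use r in auto)
  moreover have "at r within {-\<delta>..\<delta>} = at r" by (rule at_within_interior) (use r in auto)
  ultimately show ?thesis by (simp add: ramp_def[abs_def] has_real_derivative_iff_has_vector_derivative)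
qed

end

section \<open>Splitting space along the torus by a circle-valued function\<close>

lemma continuous_integer_valued_constant:
  fixes f :: "'a::topological_space \<Rightarrow> real"
  assumes "connected S" "continuous_on S f" "\<And>x. x \<in> S \<Longrightarrow> f x \<in> \<int>" "a \<in> S" "b \<in> S"
  shows "f a = f b"
proof -
  have "f constant_on S"
  proof (rule continuous_discrete_range_constant[OF assms(1,2)])
    fix x assume x: "x \<in> S"
    have "1 \<le> norm (f y - f x)" if "y \<in> S" "f y \<noteq> f x" for y
    proof -
      have "f y - f x \<in> \<int>" using assms(3) x that by simp
      then obtain k :: int where k: "f y - f x = of_int k" by (rule Ints_cases)
      then have "k \<noteq> 0" using that by auto
      then show ?thesis unfolding k by simp
    qed
    then show "\<exists>e>0. \<forall>y. y \<in> S \<and> f y \<noteq> f x \<longrightarrow> e \<le> norm (f y - f x)"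
      by (intro exI[of _ 1]) auto
  qed
  then show ?thesis using assms(4,5) by (auto simp: constant_on_def)
qed

lemma exp_i_2pi_eq_iff: "exp (\<i> * of_real (2 * pi * a)) = exp (\<i> * of_real (2 * pi * b)) \<longleftrightarrow> a - b \<in> \<int>"
proof -
  have "exp (\<i> * of_real (2 * pi * a)) = exp (\<i> * of_real (2 * pi * b)) \<longleftrightarrow> (\<exists>n::int. 2 * pi * a = 2 * pi * b + 2 * of_int n * pi)"
    by (subst exp_eq) (simp add: complex_eq_iff)
  also have "\<dots> \<longleftrightarrow> (\<exists>n::int. a - b = of_int n)"
  proof -
    have "2 * pi * a = 2 * pi * b + 2 * of_int n * pi \<longleftrightarrow> a - b = of_int n" for n :: int
    proof -
      have "2 * pi * a = 2 * pi * b + 2 * of_int n * pi \<longleftrightarrow> (2 * pi) * a = (2 * pi) * (b + of_int n)"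
        by (simp add: algebra_simps)
      also have "\<dots> \<longleftrightarrow> a = b + of_int n" by simp
      finally show ?thesis by auto
    qed
    then show ?thesis by simp
  qed
  also have "\<dots> \<longleftrightarrow> a - b \<in> \<int>" by (auto elim: Ints_cases)
  finally show ?thesis .
qed

context torus_collar
begin

definition core :: "(real^3) set" where "core = \<Phi> ` (UNIV \<times> {-\<delta>/2..0})"

lemma core_subset: "core \<subseteq> nbhd"
  unfolding core_def nbhd_def slab_def using \<delta>_pos by (intro image_mono) auto

lemma compact_\<Phi>_image: "compact (\<Phi> ` (UNIV \<times> {a..b}))"
proof -
  have "\<Phi> ` (UNIV \<times> {a..b}) = \<Phi> ` (({0..1} \<times> {0..1}) \<times> {a..b})"
  proof
    show "\<Phi> ` (UNIV \<times> {a..b}) \<subseteq> \<Phi> ` (({0..1} \<times> {0..1}) \<times> {a..b})"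
    proof
      fix y assume "y \<in> \<Phi> ` (UNIV \<times> {a..b})"
      then obtain s t r where y: "y = \<Phi> ((s, t), r)" "r \<in> {a..b}" by auto
      have "((frac s, frac t), r) \<in> ({0..1} \<times> {0..1}) \<times> {a..b}"
        using y(2) by (auto simp: frac_lt_1 less_imp_le)
      then show "y \<in> \<Phi> ` (({0..1} \<times> {0..1}) \<times> {a..b})" using y(1) \<Phi>_frac by blast
    qed
  qed auto
  moreover have "compact (\<Phi> ` (({0..1} \<times> {0..1}) \<times> {a..b}))"
    by (intro compact_continuous_image compact_Times compact_Icc) (use continuous_on_\<Phi>[OF continuous_on_id] in simp)
  ultimately show ?thesis by simp
qed

lemma closed_core: "closed core"
  unfolding core_def by (rule compact_imp_closed[OF compact_\<Phi>_image])

lemma sec_off_core: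
  assumes "y \<in> nbhd" "y \<notin> core"
  shows "snd (sec y) < -\<delta>/2 \<or> 0 < snd (sec y)" "-\<delta> < snd (sec y)" "snd (sec y) < \<delta>"
proof -
  obtain z where z: "z \<in> slab" "y = \<Phi> z" using assms(1) by (auto simp: nbhd_def)
  have "z \<notin> UNIV \<times> {-\<delta>/2..0}" using assms(2) z(2) unfolding core_def by blast
  then have "snd z < -\<delta>/2 \<or> 0 < snd z" by (auto simp: mem_Times_iff)
  then show "snd (sec y) < -\<delta>/2 \<or> 0 < snd (sec y)" "-\<delta> < snd (sec y)" "snd (sec y) < \<delta>"
    using snd_sec[OF z(1)] z by (auto simp: slab_def)
qed

lemma continuous_height: "continuous_on nbhd (\<lambda>y. snd (sec y))"
proof (rule continuous_at_imp_continuous_on, rule ballI)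
  fix y assume "y \<in> nbhd"
  then obtain z where "z \<in> slab" "y = \<Phi> z" by (auto simp: nbhd_def)
  then show "isCont (\<lambda>y. snd (sec y)) y" using has_derivative_continuous[OF height_has_derivative] by simp
qed

lemma height_range: "(\<lambda>y. snd (sec y)) ` nbhd \<subseteq> {-\<delta><..<\<delta>}"
proof (rule image_subsetI)
  fix y assume "y \<in> nbhd"
  then obtain z where "z \<in> slab" "y = \<Phi> z" by (auto simp: nbhd_def)
  then show "snd (sec y) \<in> {-\<delta><..<\<delta>}" using snd_sec[of z] by (auto simp: slab_def)
qed

lemma ramp_continuous: "continuous_on {-\<delta><..<\<delta>} ramp"
proof (rule continuous_at_imp_continuous_on, rule ballI)
  fix r assume "r \<in> {-\<delta><..<\<delta>}"
  then show "isCont ramp r" using DERIV_isCont[OF ramp_has_derivative] by simp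
qed

definition chi :: "real \<Rightarrow> real" where "chi r = ramp r / ramp 0"

lemma chi_cases: "r \<le> -\<delta>/2 \<Longrightarrow> chi r = 0" "0 \<le> r \<Longrightarrow> chi r = 1"
proof -
  show "chi r = 0" if "r \<le> -\<delta>/2" using ramp_low[OF that] by (simp add: chi_def)
  show "chi r = 1" if "0 \<le> r" using ramp_pos unfolding chi_def ramp_high[OF that] by simp
qed

lemma chi_continuous: "continuous_on {-\<delta><..<\<delta>} chi"
  unfolding chi_def[abs_def] using ramp_pos by (intro continuous_intros ramp_continuous) auto

text \<open>The circle-valued function \<open>exp (2\<pi>i chi)\<close> of the height extends by 1 to all of space.  Its logarithm separates
  the two sides of the torus.\<close>
lemma separating_potential:
  "\<exists>U. continuous_on UNIV U \<and> (\<forall>z\<in>slab. U (\<Phi> z) = chi (snd z) - 1) \<and> (\<forall>y\<in>- core. U y \<in> \<int>)"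
proof -
  \<comment> \<open>Off the core \<open>chi\<close> is 0 or 1, so both branches equal 1 there and
    fit together across the boundary of the collar.\<close>
  define E where "E y = (if y \<in> nbhd then exp (\<i> * of_real (2 * pi * chi (snd (sec y)))) else 1)" for y
  have E1: "E y = 1" if "y \<notin> core" for y
  proof (cases "y \<in> nbhd")
    case True
    then have "chi (snd (sec y)) = 0 \<or> chi (snd (sec y)) = 1"
      using sec_off_core(1)[OF True that] chi_cases by auto
    then show ?thesis using exp_two_pi_i' by (auto simp: E_def mult.commute mult.left_commute)
  qed (simp add: E_def)
  have "continuous_on nbhd E"
  proof -
    have "continuous_on nbhd (\<lambda>y. exp (\<i> * of_real (2 * pi * chi (snd (sec y)))))"
      by (intro continuous_intros continuous_on_compose2[OF chi_continuous continuous_height] height_range)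
    then show ?thesis by (rule continuous_on_eq) (simp add: E_def)
  qed
  moreover have "continuous_on (- core) E"
    by (rule continuous_on_eq[OF continuous_on_const[of _ 1]]) (simp add: E1)
  ultimately have "continuous_on (nbhd \<union> - core) E"
    using open_nbhd closed_core by (intro continuous_on_open_Un) auto
  moreover have "nbhd \<union> - core = UNIV" using core_subset by auto
  ultimately have cE: "continuous_on UNIV E" by simp
  \<comment> \<open>Space is contractible, so \<open>E\<close> has a continuous logarithm. This
    takes the place of a separation theorem: the lift \<open>W\<close> of \<open>chi\<close> is
    single-valued although \<open>chi\<close> starts at 0 below the torus and ends at 1 above
    it.\<close>
  have con: "contractible (UNIV :: (real^3) set)" by (simp add: convex_imp_contractible)
  have "E y \<noteq> 0" for y by (simp add: E_def)
  then obtain l where l: "continuous_on UNIV l" "\<And>y. E y = exp (l y)"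
    using continuous_logarithm_on_contractible[OF cE con] by (metis UNIV_I)
  define W where "W y = Im (l y) / (2 * pi)" for y
  have EW: "E y = exp (\<i> * of_real (2 * pi * W y))" for y
  proof -
    have "norm (E y) = 1" by (simp add: E_def)
    then have "Re (l y) = 0" using l(2)[of y] by simp
    then have "l y = \<i> * of_real (2 * pi * W y)" by (simp add: W_def complex_eq_iff)
    then show ?thesis using l(2) by simp
  qed
  have cW: "continuous_on S W" for S
    unfolding W_def using continuous_on_subset[OF l(1)] by (intro continuous_intros) auto
  have int: "W (\<Phi> z) - chi (snd z) \<in> \<int>" if "z \<in> slab" for z
  proof -
    have "\<Phi> z \<in> nbhd" using that by (auto simp: nbhd_def)
    then have "exp (\<i> * of_real (2 * pi * W (\<Phi> z))) = exp (\<i> * of_real (2 * pi * chi (snd z)))"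
      using EW[of "\<Phi> z"] snd_sec[OF that] by (simp add: E_def)
    then show ?thesis by (simp only: exp_i_2pi_eq_iff)
  qed
  let ?z0 = "((0, 0), 0) :: (real \<times> real) \<times> real"
  have z0: "?z0 \<in> slab" using \<delta>_pos by (auto simp: slab_def)
  \<comment> \<open>On the connected slab \<open>W\<close> and \<open>chi\<close> differ by one
    integer. Subtracting a further 1 makes \<open>U\<close> vanish from level 0 upwards.\<close>
  define k where "k = W (\<Phi> ?z0) - chi (snd ?z0)"
  have const: "W (\<Phi> z) - chi (snd z) = k" if "z \<in> slab" for z
    unfolding k_def
  proof (rule continuous_integer_valued_constant[OF _ _ int that z0])
    show "connected slab" unfolding slab_def by (intro convex_connected convex_Times) auto
    show "continuous_on slab (\<lambda>z. W (\<Phi> z) - chi (snd z))"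
      by (intro continuous_intros continuous_on_compose2[OF cW[of UNIV] continuous_on_\<Phi>[OF continuous_on_id]]
          continuous_on_compose2[OF chi_continuous]) (auto simp: slab_def)
  qed
  have k: "k \<in> \<int>" unfolding k_def by (rule int[OF z0])
  show ?thesis
  proof (intro exI[of _ "\<lambda>y. W y - k - 1"] conjI ballI)
    show "continuous_on UNIV (\<lambda>y. W y - k - 1)" by (intro continuous_intros cW)
    show "W (\<Phi> z) - k - 1 = chi (snd z) - 1" if "z \<in> slab" for z using const[OF that] by simp
    fix y assume "y \<in> - core"
    then have "exp (\<i> * of_real (2 * pi * W y)) = exp (\<i> * of_real (2 * pi * 0))"
      using E1[of y] EW[of y] by simp
    then have "W y - 0 \<in> \<int>" by (simp only: exp_i_2pi_eq_iff)
    then show "W y - k - 1 \<in> \<int>" using k by simp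
  qed
qed

definition gradU :: "real^3 \<Rightarrow> real^3" where
  "gradU y = (if y \<in> nbhd then (bump (snd (sec y)) / ramp 0) *\<^sub>R nrm (fst (sec y)) else 0)"

lemma gradU_\<Phi>: "z \<in> slab \<Longrightarrow> gradU (\<Phi> z) = (bump (snd z) / ramp 0) *\<^sub>R nrm (fst z)"
  using snd_sec[of z] nrm_sec[of z] by (auto simp: gradU_def nbhd_def)

lemma gradU_off_core: "y \<notin> core \<Longrightarrow> gradU y = 0"
  using sec_off_core[of y] bump_0 by (auto simp: gradU_def)

lemma continuous_gradU: "continuous_on UNIV gradU"
proof -
  have "isCont gradU y" if "y \<in> nbhd" for y
  proof -
    obtain z0 where z0: "z0 \<in> slab" "y = \<Phi> z0" using \<open>y \<in> nbhd\<close> by (auto simp: nbhd_def)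
    from local_inverse[OF z0(1)] obtain V \<psi> where V: "open V" "z0 \<in> V" "V \<subseteq> slab" "open (\<Phi> ` V)" "\<forall>z\<in>V. \<psi> (\<Phi> z) = z" "continuous_on (\<Phi> ` V) \<psi>"
      by (elim exE conjE) (rule that)
    have "continuous_on (\<Phi> ` V) (\<lambda>y. (bump (snd (\<psi> y)) / ramp 0) *\<^sub>R nrm (fst (\<psi> y)))"
      using ramp_pos
      by (intro continuous_intros continuous_on_compose2[OF bump_continuous[of UNIV]] continuous_on_nrm V) auto
    then have "continuous_on (\<Phi> ` V) gradU"
    proof (rule continuous_on_eq)
      fix y assume "y \<in> \<Phi> ` V"
      then obtain z where z: "z \<in> V" "y = \<Phi> z" by blast
      then have "z \<in> slab" using V(3) by blast
      from gradU_\<Phi>[OF this] show "(bump (snd (\<psi> y)) / ramp 0) *\<^sub>R nrm (fst (\<psi> y)) = gradU y" using V(5) z by simp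
    qed
    moreover have "y \<in> \<Phi> ` V" using z0(2) V(2) by blast
    ultimately show ?thesis using V(4) continuous_on_eq_continuous_at by blast
  qed
  then have "continuous_on nbhd gradU" by (simp add: continuous_at_imp_continuous_on)
  moreover have "continuous_on (- core) gradU"
    by (rule continuous_on_eq[OF continuous_on_const[of _ 0]]) (simp add: gradU_off_core)
  ultimately have "continuous_on (nbhd \<union> - core) gradU"
    using open_nbhd closed_core by (intro continuous_on_open_Un) auto
  moreover have "nbhd \<union> - core = UNIV" using core_subset by auto
  ultimately show ?thesis by simp
qed

text \<open>On the collar the gradient comes from the formula in terms of the height; off the core
  \<open>U\<close> is continuous with integer values, hence locally constant.\<close>

lemma separating_function:
  "\<exists>U M. (\<forall>y. (U has_derivative (\<lambda>h. gradU y \<bullet> h)) (at y)) \<and> (\<forall>z\<in>slab. 0 \<le> snd z \<longrightarrow> U (\<Phi> z) = 0) \<and> (\<forall>y. \<bar>U y\<bar> \<le> M)"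
proof -
  from separating_potential obtain U where U: "continuous_on UNIV U" "\<forall>z\<in>slab. U (\<Phi> z) = chi (snd z) - 1" "\<forall>y\<in>- core. U y \<in> \<int>"
    by (elim exE conjE) (rule that)
  have cU: "continuous_on S U" for S using continuous_on_subset[OF U(1)] by blast
  have "(U has_derivative (\<lambda>h. gradU y \<bullet> h)) (at y)" for y
  proof (cases "y \<in> nbhd")
    case True
    then obtain z where z: "z \<in> slab" "y = \<Phi> z" by (auto simp: nbhd_def)
    have hr: "((\<lambda>y. snd (sec y)) has_derivative (\<lambda>h. h \<bullet> nrm (fst z))) (at y)"
      using height_has_derivative[OF z(1)] z(2) by simp
    have r: "-\<delta> < snd z" "snd z < \<delta>" using z by (auto simp: slab_def)
    have "(ramp has_derivative (\<lambda>h. h * bump (snd z))) (at (snd (sec y)))"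
      using ramp_has_derivative[OF r] snd_sec[OF z(1)] z(2) by (simp add: has_field_derivative_def mult_commute_abs)
    from has_derivative_compose[OF hr this]
    have "((\<lambda>y. ramp (snd (sec y))) has_derivative (\<lambda>h. (h \<bullet> nrm (fst z)) * bump (snd z))) (at y)" .
    then have "((\<lambda>y. ramp (snd (sec y)) / ramp 0 - 1) has_derivative (\<lambda>h. (h \<bullet> nrm (fst z)) * bump (snd z) / ramp 0)) (at y)"
      using ramp_pos by (auto intro!: derivative_eq_intros)
    then have "((\<lambda>y. chi (snd (sec y)) - 1) has_derivative (\<lambda>h. gradU y \<bullet> h)) (at y)"
      using gradU_\<Phi>[OF z(1)] z(2) by (simp add: chi_def inner_commute mult.commute)
    then show ?thesis
    proof (rule has_derivative_transform_within_open[OF _ open_nbhd True])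
      fix x assume "x \<in> nbhd"
      then obtain w where w: "w \<in> slab" "x = \<Phi> w" by (auto simp: nbhd_def)
      then show "chi (snd (sec x)) - 1 = U x" using U(2) snd_sec[OF w(1)] by simp
    qed
  next
    case False
    then have y: "y \<in> - core" using core_subset by auto
    then obtain e where e: "e > 0" "ball y e \<subseteq> - core" using closed_core open_Compl openE by blast
    have Uc: "U x = U y" if "x \<in> ball y e" for x
      by (rule continuous_integer_valued_constant[OF connected_ball[of y e] cU]) (use U(3) e that in auto)
    have "(U has_derivative (\<lambda>h. 0)) (at y)"
    proof (rule has_derivative_transform_within_open[OF has_derivative_const[of "U y"] open_ball[of y e]])
      show "y \<in> ball y e" using e(1) by simp
      show "U y = U x" if "x \<in> ball y e" for x using Uc[OF that] by simp
    qed
    moreover have "gradU y = 0" using False by (simp add: gradU_def)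
    ultimately show ?thesis by simp
  qed
  moreover have "\<forall>z\<in>slab. 0 \<le> snd z \<longrightarrow> U (\<Phi> z) = 0" using U(2) chi_cases(2) by simp
  moreover have "\<exists>M. \<forall>y. \<bar>U y\<bar> \<le> M"
  proof -
    have "bounded core" unfolding core_def by (rule compact_imp_bounded[OF compact_\<Phi>_image])
    then obtain \<rho> where "\<forall>x\<in>core. norm x \<le> \<rho>" unfolding bounded_iff by blast
    then have \<rho>: "core \<subseteq> cball 0 \<rho>" by auto
    have "bounded (U ` cball 0 \<rho>)"
      by (rule compact_imp_bounded[OF compact_continuous_image[OF cU compact_cball]])
    then obtain M1 where M1: "\<forall>y\<in>cball 0 \<rho>. \<bar>U y\<bar> \<le> M1" unfolding bounded_iff by auto
    \<comment> \<open>Outside a ball that contains the core, \<open>U\<close> is a single integer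
      because the complement of the ball is connected. Together with compactness of the ball this
      bounds \<open>U\<close>.\<close>
    have con: "connected (- cball (0::real^3) \<rho>)"
      by (rule connected_complement_bounded_convex) auto
    show ?thesis
    proof (cases "- cball (0::real^3) \<rho> = {}")
      case True
      then show ?thesis using M1 by (intro exI[of _ M1]) blast
    next
      case False
      then obtain q where q: "q \<in> - cball (0::real^3) \<rho>" by blast
      have "U y = U q" if "y \<in> - cball 0 \<rho>" for y
        by (rule continuous_integer_valued_constant[OF con cU _ that q]) (use U(3) \<rho> in auto)
      then have "\<bar>U y\<bar> \<le> max M1 \<bar>U q\<bar>" for y
        using bspec[OF M1, of y] by (cases "y \<in> cball 0 \<rho>") (auto simp: max_def)
      then show ?thesis by blast
    qed
  qed
  ultimately show ?thesis by blast
qed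

end

subsection \<open>Integrals over space\<close>

definition v3 :: "real \<Rightarrow> real \<Rightarrow> real \<Rightarrow> real^3" where
  "v3 x y z = x *\<^sub>R axis 1 1 + y *\<^sub>R axis 2 1 + z *\<^sub>R axis 3 1"

lemma v3_nth [simp]: "v3 x y z $ 1 = x" "v3 x y z $ 2 = y" "v3 x y z $ 3 = z"
  by (simp_all add: v3_def axis_def)

lemma v3_eq [simp]: "v3 (p $ 1) (p $ 2) (p $ 3) = p"
  by (simp add: vec_eq_iff forall_3)

lemma continuous_on_v3:
  "continuous_on S a \<Longrightarrow> continuous_on S b \<Longrightarrow> continuous_on S c \<Longrightarrow> continuous_on S (\<lambda>p. v3 (a p) (b p) (c p))"
  unfolding v3_def by (intro continuous_intros)

text \<open>The coordinate map takes boxes to boxes of the same volume, so it preserves the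
  integral, and Fubini applies in the product space.\<close>

lemma integral_vec3:
  fixes f :: "real^3 \<Rightarrow> real"
  assumes f: "continuous_on (cbox a b) f"
  shows "integral (cbox a b) f = integral {a$1..b$1} (\<lambda>x. integral {a$2..b$2} (\<lambda>y. integral {a$3..b$3} (\<lambda>z. f (v3 x y z))))"
proof -
  define g where "g q = v3 (fst q) (fst (snd q)) (snd (snd q))" for q :: "real \<times> real \<times> real"
  define h where "h p = (p$1, p$2, p$3)" for p :: "real^3"
  have hg: "h (g x) = x" and gh: "g (h y) = y" for x y by (simp_all add: g_def h_def)
  have in_cbox: "p \<in> cbox u w \<longleftrightarrow> p$1 \<in> {u$1..w$1} \<and> p$2 \<in> {u$2..w$2} \<and> p$3 \<in> {u$3..w$3}" for p u w :: "real^3"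
    by (auto simp: mem_box_cart forall_3)
  have hbox: "h ` cbox u w = cbox (h u) (h w)" for u w
  proof
    show "h ` cbox u w \<subseteq> cbox (h u) (h w)" by (auto simp: h_def in_cbox cbox_Pair_eq)
    show "cbox (h u) (h w) \<subseteq> h ` cbox u w"
    proof
      fix q assume "q \<in> cbox (h u) (h w)"
      then have "g q \<in> cbox u w" by (cases q) (auto simp: g_def h_def in_cbox cbox_Pair_eq)
      then show "q \<in> h ` cbox u w" using hg by (metis imageI)
    qed
  qed
  have gbox: "g ` cbox u w = cbox (g u) (g w)" for u w
  proof -
    have "cbox u w = h ` cbox (g u) (g w)" by (simp add: hbox hg)
    then have "g ` cbox u w = (\<lambda>x. g (h x)) ` cbox (g u) (g w)" by (simp add: image_image)
    then show ?thesis by (simp add: gh)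
  qed
  have content: "measure lborel (g ` cbox u w) = 1 * measure lborel (cbox u w)" for u w
  proof -
    obtain u1 u2 u3 w1 w2 w3 where u: "u = (u1, u2, u3)" and w: "w = (w1, w2, w3)" by (cases u; cases w; cases "snd u"; cases "snd w") auto
    have p3: "(\<Prod>i\<in>UNIV. F i) = F 1 * F 2 * F 3" for F :: "3 \<Rightarrow> real"
      unfolding UNIV_3 by (simp add: mult.assoc)
    have prod: "measure lborel (cbox u w) = measure lborel {u1..w1} * (measure lborel {u2..w2} * measure lborel {u3..w3})"
      by (simp add: u w content_Pair)
    show ?thesis
    proof (cases "u1 \<le> w1 \<and> u2 \<le> w2 \<and> u3 \<le> w3")
      case True
      then have "g u \<in> cbox (g u) (g w)" by (simp add: in_cbox g_def u w)
      then have "measure lborel (cbox (g u) (g w)) = (\<Prod>i\<in>UNIV. g w $ i - g u $ i)"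
        using content_cbox_cart by blast
      then show ?thesis using True unfolding gbox prod p3 by (simp add: g_def u w)
    next
      case False
      then have "cbox (g u) (g w) = {}" by (auto simp: in_cbox g_def u w)
      then show ?thesis using False unfolding gbox prod by auto
    qed
  qed
  have cg: "continuous_on S g" for S unfolding g_def by (intro continuous_on_v3 continuous_intros)
  have "((\<lambda>x. f (g x)) has_integral (1 / 1) *\<^sub>R integral (cbox a b) f) (h ` cbox a b)"
  proof (rule has_integral_twiddle[OF _ hg gh _ _ _ content])
    show "continuous (at x) g" for x using cg[of UNIV] continuous_on_eq_continuous_at open_UNIV by blast
    show "(f has_integral integral (cbox a b) f) (cbox a b)"
      using integrable_continuous[OF f] by (rule integrable_integral)
    show "\<exists>w z. g ` cbox u v = cbox w z" for u v using gbox by blast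
    show "\<exists>w z. h ` cbox u v = cbox w z" for u v using hbox by blast
  qed simp
  then have "integral (cbox a b) f = integral (cbox (h a) (h b)) (\<lambda>x. f (g x))"
    unfolding hbox by (simp add: integral_unique)
  also have "\<dots> = integral (cbox (a$1) (b$1)) (\<lambda>x. integral (cbox (a$2, a$3) (b$2, b$3)) (\<lambda>q. f (g (x, q))))"
  proof -
    have "continuous_on (cbox (h a) (h b)) (\<lambda>x. f (g x))"
      by (rule continuous_on_compose2[OF f cg]) (simp add: gbox gh)
    then show ?thesis unfolding h_def by (rule integral_prod_continuous)
  qed
  also have "\<dots> = integral (cbox (a$1) (b$1)) (\<lambda>x. integral (cbox (a$2) (b$2)) (\<lambda>y. integral (cbox (a$3) (b$3)) (\<lambda>z. f (g (x, y, z)))))"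
  proof (rule integral_cong)
    fix x assume x: "x \<in> cbox (a$1) (b$1)"
    have "continuous_on (cbox (a$2, a$3) (b$2, b$3)) (\<lambda>q. f (g (x, q)))"
      by (rule continuous_on_compose2[OF f], unfold g_def, intro continuous_on_v3 continuous_intros)
        (use x in \<open>auto simp: in_cbox cbox_Pair_eq\<close>)
    then show "integral (cbox (a$2, a$3) (b$2, b$3)) (\<lambda>q. f (g (x, q))) = integral (cbox (a$2) (b$2)) (\<lambda>y. integral (cbox (a$3) (b$3)) (\<lambda>z. f (g (x, y, z))))"
      by (rule integral_prod_continuous)
  qed
  finally show ?thesis by (simp add: g_def)
qed

lemma double_integral_bound:
  fixes f :: "real \<Rightarrow> real \<Rightarrow> real"
  assumes "a \<le> b" "c \<le> d" "0 \<le> C"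
    and f: "continuous_on ({a..b} \<times> {c..d}) (\<lambda>(x, y). f x y)"
    and C: "\<And>x y. x \<in> {a..b} \<Longrightarrow> y \<in> {c..d} \<Longrightarrow> \<bar>f x y\<bar> \<le> C"
  shows "\<bar>integral {a..b} (\<lambda>x. integral {c..d} (\<lambda>y. f x y))\<bar> \<le> C * (d - c) * (b - a)"
proof -
  have 1: "\<bar>integral {c..d} (\<lambda>y. f x y)\<bar> \<le> C * (d - c)" if "x \<in> {a..b}" for x
  proof -
    have "continuous_on {c..d} (\<lambda>y. f x y)"
      using continuous_on_compose2[OF f continuous_on_Pair[OF continuous_on_const[of "{c..d}" x] continuous_on_id]] that
      by (auto simp: image_subset_iff)
    then have "norm (integral (cbox c d) (\<lambda>y. f x y)) \<le> C * measure lborel (cbox c d)"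
      by (intro integrable_bound assms) (use C that in \<open>auto intro!: integrable_continuous_interval\<close>)
    then show ?thesis using assms by simp
  qed
  have "continuous_on ({a..b} \<times> cbox c d) (\<lambda>(x, y). f x y)" using f by simp
  from integral_continuous_on_param[OF this]
  have "(\<lambda>x. integral {c..d} (\<lambda>y. f x y)) integrable_on cbox a b" by (intro integrable_continuous) simp
  then have "norm (integral (cbox a b) (\<lambda>x. integral {c..d} (\<lambda>y. f x y))) \<le> (C * (d - c)) * measure lborel (cbox a b)"
    by (intro integrable_bound) (use 1 assms in auto)
  then show ?thesis using assms by simp
qed

text \<open>The flux through the faces of the cube \<open>[-R,R]\<^sup>3\<close> is \<open>O(R\<^sup>2 \<cdot> R\<^sup>-\<^sup>4)\<close>.\<close>
lemma divergence_integral_zero: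
  fixes Y :: "real^3 \<Rightarrow> real^3"
  assumes dY: "\<And>p. (Y has_derivative Y' p) (at p)" and cY: "\<And>h. continuous_on UNIV (\<lambda>p. Y' p h)"
    and S: "\<And>p. S p = Y' p (axis 1 1) $ 1 + Y' p (axis 2 1) $ 2 + Y' p (axis 3 1) $ 3"
    and supp: "\<And>p. norm p \<ge> R0 \<Longrightarrow> S p = 0" and R0: "R0 > 0"
    and decay: "\<And>p. norm p \<ge> R0 \<Longrightarrow> norm (Y p) \<le> C / norm p ^ 4" and C: "C \<ge> 0"
  shows "(S has_integral 0) UNIV"
proof -
  have cY0: "continuous_on T Y" for T
    by (meson continuous_at_imp_continuous_on dY has_derivative_continuous)
  have cS: "continuous_on T S" for T
  proof -
    have "continuous_on UNIV S" unfolding S[abs_def] by (intro continuous_intros cY)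
    then show ?thesis using continuous_on_subset by blast
  qed
  let ?Q = "\<lambda>R. cbox (v3 (-R) (-R) (-R)) (v3 R R R)"
  have bnd: "\<bar>integral (?Q R) S\<bar> \<le> 24 * C / R^2" if R: "R \<ge> R0" for R
  proof -
    have R': "R > 0" "-R \<le> R" using R R0 by auto
    let ?I = "{-R..R}"
    have cv: "continuous_on T (\<lambda>(x, y, z). Y' (v3 x y z) h $ i)" for T h i
      unfolding case_prod_beta
      by (intro bounded_linear.continuous_on[OF bounded_linear_vec_nth] continuous_on_compose2[OF cY] continuous_on_v3 continuous_intros) auto
    have line: "((\<lambda>u. Y (c u) $ i) has_real_derivative Y' (c u) e $ i) (at u within T)"
      if "\<And>u. (c has_vector_derivative e) (at u within T)" for c e u i T
    proof -
      have "((\<lambda>u. Y (c u)) has_derivative (\<lambda>h. Y' (c u) (h *\<^sub>R e))) (at u within T)"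
        by (rule has_derivative_compose[OF that[unfolded has_vector_derivative_def] dY])
      then have "((\<lambda>u. Y (c u)) has_vector_derivative Y' (c u) e) (at u within T)"
        by (simp add: has_vector_derivative_def linear_cmul[OF has_derivative_linear[OF dY]])
      from bounded_linear.has_vector_derivative[OF bounded_linear_vec_nth this]
      show ?thesis by (simp add: has_real_derivative_iff_has_vector_derivative)
    qed
    have lx: "((\<lambda>x. v3 x y z) has_vector_derivative axis 1 1) (at u within T)"
      and ly: "((\<lambda>y. v3 x y z) has_vector_derivative axis 2 1) (at u within T)"
      and lz: "((\<lambda>z. v3 x y z) has_vector_derivative axis 3 1) (at u within T)" for x y z u T
      unfolding v3_def by (auto intro!: derivative_eq_intros simp: has_vector_derivative_def)
    have "integral (?Q R) S = integral ?I (\<lambda>x. integral ?I (\<lambda>y. integral ?I (\<lambda>z.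
        Y' (v3 x y z) (axis 1 1) $ 1 + Y' (v3 x y z) (axis 2 1) $ 2 + Y' (v3 x y z) (axis 3 1) $ 3)))"
      by (subst integral_vec3[OF cS]) (simp add: S)
    also have "\<dots> = integral ?I (\<lambda>y. integral ?I (\<lambda>z. Y (v3 R y z) $ 1 - Y (v3 (-R) y z) $ 1))
      + integral ?I (\<lambda>x. integral ?I (\<lambda>z. Y (v3 x R z) $ 2 - Y (v3 x (-R) z) $ 2))
      + integral ?I (\<lambda>x. integral ?I (\<lambda>y. Y (v3 x y R) $ 3 - Y (v3 x y (-R)) $ 3))"
      by (rule box_divergence[where P="\<lambda>x y z. Y (v3 x y z) $ 1" and Q="\<lambda>x y z. Y (v3 x y z) $ 2" and R="\<lambda>x y z. Y (v3 x y z) $ 3",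
            OF R'(2) R'(2) R'(2) line[OF lx] line[OF ly] line[OF lz] cv cv cv])
    also have "\<bar>\<dots>\<bar> \<le> 8 * C / R^2 + 8 * C / R^2 + 8 * C / R^2"
    proof -
      have pt: "\<bar>Y p $ i\<bar> \<le> C / R^4" if "\<bar>p $ j\<bar> = R" for p i j
      proof -
        have "norm p \<ge> R" using that component_le_norm_cart[of p j] by simp
        then have "norm (Y p) \<le> C / norm p ^ 4" using decay R by simp
        also have "\<dots> \<le> C / R ^ 4"
          using \<open>norm p \<ge> R\<close> R' C by (intro divide_left_mono power_mono) (auto intro!: mult_pos_pos)
        finally show ?thesis using component_le_norm_cart[of "Y p" i] by linarith
      qed
      \<comment> \<open>A pair of opposite faces of area \<open>4 * R^2\<close> carries an integrand
        of size at most \<open>2 * C / R^4\<close>; the three pairs together give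
        \<open>24 * C / R^2\<close>.\<close>
      have face: "\<bar>integral ?I (\<lambda>y. integral ?I (\<lambda>z. Y (c y z) $ i - Y (d y z) $ i))\<bar> \<le> 8 * C / R^2"
        if "continuous_on UNIV (\<lambda>(y, z). c y z)" "continuous_on UNIV (\<lambda>(y, z). d y z)"
          "\<And>y z. \<bar>c y z $ j\<bar> = R" "\<And>y z. \<bar>d y z $ j\<bar> = R" for c d :: "real \<Rightarrow> real \<Rightarrow> real^3" and i j
      proof -
        have "\<bar>integral ?I (\<lambda>y. integral ?I (\<lambda>z. Y (c y z) $ i - Y (d y z) $ i))\<bar> \<le> (2 * C / R^4) * (R - - R) * (R - - R)"
        proof (rule double_integral_bound)
          have c: "continuous_on (?I \<times> ?I) (\<lambda>p. c (fst p) (snd p))" "continuous_on (?I \<times> ?I) (\<lambda>p. d (fst p) (snd p))"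
            using that(1,2) continuous_on_subset unfolding case_prod_beta by blast+
          show "continuous_on (?I \<times> ?I) (\<lambda>(x, y). Y (c x y) $ i - Y (d x y) $ i)"
            unfolding case_prod_beta
            by (intro continuous_on_diff bounded_linear.continuous_on[OF bounded_linear_vec_nth] continuous_on_compose2[OF cY0[of UNIV]] c) auto
          fix y z
          show "\<bar>Y (c y z) $ i - Y (d y z) $ i\<bar> \<le> 2 * C / R ^ 4"
            using pt[OF that(3)[of y z], of i] pt[OF that(4)[of y z], of i] by (simp add: abs_le_iff)
        qed (use R' C in auto)
        also have "\<dots> = 8 * C / R^2" using R' by (simp add: field_simps power_numeral_reduce)
        finally show ?thesis .
      qed
      have cont: "continuous_on UNIV (\<lambda>(y, z). v3 r y z)" "continuous_on UNIV (\<lambda>(y, z). v3 y r z)" "continuous_on UNIV (\<lambda>(y, z). v3 y z r)" for r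
        unfolding case_prod_beta by (intro continuous_on_v3 continuous_intros)+
      show ?thesis
        using face[OF cont(1)[of R] cont(1)[of "-R"], of 1 1] face[OF cont(2)[of R] cont(2)[of "-R"], of 2 2]
          face[OF cont(3)[of R] cont(3)[of "-R"], of 3 3] R' by (simp add: abs_le_iff)
    qed
    finally show ?thesis by simp
  qed
  have int0: "(S has_integral integral (?Q R) S) UNIV" if R: "R \<ge> R0" for R
  proof (rule has_integral_on_superset)
    show "(S has_integral integral (?Q R) S) (?Q R)"
      by (rule integrable_integral[OF integrable_continuous[OF cS]])
    fix p assume "p \<notin> ?Q R"
    then obtain j where "\<bar>p $ j\<bar> \<ge> R" by (auto simp: mem_box_cart forall_3 abs_le_iff) (smt (verit) abs_ge_self abs_ge_minus_self)+
    then have "norm p \<ge> R0" using component_le_norm_cart[of p j] R by linarith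
    then show "S p = 0" by (rule supp)
  qed auto
  \<comment> \<open>Beyond \<open>R0\<close> the integral over the cube no longer changes, while its
    bound tends to 0.\<close>
  have eq: "integral (?Q R) S = integral (?Q R0) S" if "R \<ge> R0" for R
    using has_integral_unique[OF int0[OF that] int0[OF order.refl]] .
  have "integral (?Q R0) S = 0"
  proof (rule ccontr)
    assume nz: "integral (?Q R0) S \<noteq> 0"
    have lim: "((\<lambda>R. 24 * C / R^2) \<longlongrightarrow> 0) at_top"
      by (intro tendsto_divide_0[OF tendsto_const] filterlim_at_top_imp_at_infinity filterlim_pow_at_top filterlim_ident) auto
    have "\<forall>\<^sub>F R in at_top. 24 * C / R^2 < \<bar>integral (?Q R0) S\<bar>"
      using order_tendstoD(2)[OF lim] nz by simp
    with eventually_ge_at_top[of R0] have "\<forall>\<^sub>F R in at_top. R \<ge> R0 \<and> 24 * C / R^2 < \<bar>integral (?Q R0) S\<bar>"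
      by (rule eventually_conj)
    then obtain R where "R \<ge> R0" "24 * C / R^2 < \<bar>integral (?Q R0) S\<bar>"
      using eventually_happens'[OF trivial_limit_at_top_linorder] by blast
    then show False using bnd[of R] eq[of R] by simp
  qed
  then show ?thesis using int0[OF order.refl] by simp
qed

subsection \<open>Degeneracy of the linking form\<close>

text \<open>The trace of \<open>cross3 b\<close> composed with \<open>T\<close> sees only the
  antisymmetric part of \<open>T\<close>. Applied to derivatives of curl-free fields, it shows that
  their cross product is divergence free.\<close>

lemma symmetric_cross_trace:
  fixes T :: "real^3 \<Rightarrow> real^3"
  assumes sym: "\<And>a b. T a \<bullet> b = T b \<bullet> a"
  shows "cross3 b (T (axis 1 1)) $ 1 + cross3 b (T (axis 2 1)) $ 2 + cross3 b (T (axis 3 1)) $ 3 = 0"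
proof -
  have "T (axis i 1) $ j = T (axis j 1) $ i" for i j
    using sym[of "axis i 1" "axis j 1"] by (simp add: inner_axis)
  from this[of 1 2] this[of 1 3] this[of 2 3] show ?thesis
    by (simp add: cross3_def vector_3)
qed

context torus_collar
begin

abbreviation "loop1 \<equiv> cv 0 (1, 0) (\<delta>/2)"
abbreviation "loop2 \<equiv> cv 0 (0, 1) (\<delta>/2)"
definition "B1 = bs loop1 (cv' 0 (1, 0) (\<delta>/2))"
definition "B2 = bs loop2 (cv' 0 (0, 1) (\<delta>/2))"
definition "off_loops = - (range loop1 \<union> range loop2)"
definition flux :: "real^3 \<Rightarrow> real" where "flux p = gradU p \<bullet> cross3 (B1 p) (B2 p)"

lemma fields:
  "\<exists>B1' B2' :: real^3 \<Rightarrow> (real^3) \<Rightarrow>\<^sub>L (real^3).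
    (\<forall>y\<in>off_loops. (B1 has_derivative blinfun_apply (B1' y)) (at y)) \<and> (\<forall>y\<in>off_loops. (B2 has_derivative blinfun_apply (B2' y)) (at y)) \<and>
    continuous_on off_loops B1' \<and> continuous_on off_loops B2' \<and>
    (\<forall>y\<in>off_loops. \<forall>a b. B1' y a \<bullet> b = B1' y b \<bullet> a) \<and> (\<forall>y\<in>off_loops. \<forall>a b. B2' y a \<bullet> b = B2' y b \<bullet> a)"
proof -
  have sub: "off_loops \<subseteq> - range loop1" "off_loops \<subseteq> - range loop2" by (auto simp: off_loops_def)
  from bs_field[OF closed_curve_cv[of 0 "(1, 0)" "\<delta>/2"]]
  obtain B1' :: "real^3 \<Rightarrow> (real^3) \<Rightarrow>\<^sub>L (real^3)" where 1: "\<forall>y\<in>- range loop1. (B1 has_derivative blinfun_apply (B1' y)) (at y)"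
    "continuous_on (- range loop1) B1'" "\<forall>y\<in>- range loop1. \<forall>a b. B1' y a \<bullet> b = B1' y b \<bullet> a"
    unfolding B1_def[symmetric] by (elim exE conjE) (rule that)
  from bs_field[OF closed_curve_cv[of 0 "(0, 1)" "\<delta>/2"]]
  obtain B2' :: "real^3 \<Rightarrow> (real^3) \<Rightarrow>\<^sub>L (real^3)" where 2: "\<forall>y\<in>- range loop2. (B2 has_derivative blinfun_apply (B2' y)) (at y)"
    "continuous_on (- range loop2) B2'" "\<forall>y\<in>- range loop2. \<forall>a b. B2' y a \<bullet> b = B2' y b \<bullet> a"
    unfolding B2_def[symmetric] by (elim exE conjE) (rule that)
  have 3: "\<forall>y\<in>off_loops. (B1 has_derivative blinfun_apply (B1' y)) (at y)" "\<forall>y\<in>off_loops. \<forall>a b. B1' y a \<bullet> b = B1' y b \<bullet> a"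
    using 1(1,3) sub(1) by blast+
  have 4: "\<forall>y\<in>off_loops. (B2 has_derivative blinfun_apply (B2' y)) (at y)" "\<forall>y\<in>off_loops. \<forall>a b. B2' y a \<bullet> b = B2' y b \<bullet> a"
    using 2(1,3) sub(2) by blast+
  show ?thesis
    by (intro exI[of _ B1'] exI[of _ B2'] conjI 3 4 continuous_on_subset[OF 1(2) sub(1)] continuous_on_subset[OF 2(2) sub(2)])
qed

lemma \<Phi>_off_loops: "-\<delta> < r \<Longrightarrow> r < \<delta>/2 \<Longrightarrow> \<Phi> (x, r) \<in> off_loops"
proof -
  assume r: "-\<delta> < r" "r < \<delta>/2"
  then have "\<bar>r\<bar> < \<delta>" "\<bar>\<delta>/2\<bar> < \<delta>" "r \<noteq> \<delta>/2" using \<delta>_pos by auto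
  then show ?thesis using \<Phi>_notin_cv by (auto simp: off_loops_def)
qed

lemma open_off_loops: "open off_loops"
  unfolding off_loops_def
  using closed_curve_compact[OF closed_curve_cv] by (intro open_Compl closed_Un compact_imp_closed)

text \<open>\<open>flux\<close> is the divergence of \<open>U\<close> times the cross product of the
  two fields. The fields are singular on the loops, but \<open>U\<close> vanishes on a whole
  neighbourhood of them, which makes the product a C^1 field on all of space.\<close>

lemma flux_integral: "(flux has_integral 0) UNIV"
proof -
  from separating_function obtain U M where U0: "\<forall>z\<in>slab. 0 \<le> snd z \<longrightarrow> U (\<Phi> z) = 0"
    and dU: "\<forall>y. (U has_derivative (\<lambda>h. gradU y \<bullet> h)) (at y)" and M: "\<forall>y. \<bar>U y\<bar> \<le> M"
    by (elim exE conjE) (rule that)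
  from fields obtain B1' B2' :: "real^3 \<Rightarrow> (real^3) \<Rightarrow>\<^sub>L (real^3)" where
    d1: "\<forall>y\<in>off_loops. (B1 has_derivative blinfun_apply (B1' y)) (at y)" and d2: "\<forall>y\<in>off_loops. (B2 has_derivative blinfun_apply (B2' y)) (at y)"
    and c1: "continuous_on off_loops B1'" and c2: "continuous_on off_loops B2'"
    and s1: "\<forall>y\<in>off_loops. \<forall>a b. B1' y a \<bullet> b = B1' y b \<bullet> a" and s2: "\<forall>y\<in>off_loops. \<forall>a b. B2' y a \<bullet> b = B2' y b \<bullet> a"
    by (elim exE conjE) (rule that)
  \<comment> \<open>The part of the collar above the torus: an open set around both loops on which
    \<open>U\<close> and its gradient vanish.\<close>
  define upper where "upper = \<Phi> ` (UNIV \<times> {0<..<\<delta>})"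
  have upper: "open upper"
    unfolding upper_def
  proof (rule open_\<Phi>_image)
    show "open ((UNIV :: (real \<times> real) set) \<times> {0<..<\<delta>})" by (intro open_Times open_UNIV open_greaterThanLessThan)
    show "UNIV \<times> {0<..<\<delta>} \<subseteq> slab" using \<delta>_pos by (auto simp: slab_def)
  qed
  have upper0: "U p = 0" "gradU p = 0" if p: "p \<in> upper" for p
  proof -
    obtain z where z: "z \<in> UNIV \<times> {0<..<\<delta>}" "p = \<Phi> z" using p unfolding upper_def by blast
    then have "z \<in> slab" "0 \<le> snd z" using \<delta>_pos by (auto simp: slab_def)
    then show "U p = 0" "gradU p = 0" using U0 gradU_\<Phi>[of z] bump_0[of "snd z"] z(2) by auto
  qed
  have cover: "p \<in> upper" if p: "p \<notin> off_loops" for p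
  proof -
    obtain x where "p = \<Phi> (x, \<delta>/2)" using p unfolding off_loops_def cv_def by blast
    moreover have "(x, \<delta>/2) \<in> UNIV \<times> {0<..<\<delta>}" using \<delta>_pos by auto
    ultimately show ?thesis unfolding upper_def by blast
  qed
  define X where "X p = cross3 (B1 p) (B2 p)" for p
  define X' where "X' p h = cross3 (B1 p) (B2' p h) + cross3 (B1' p h) (B2 p)" for p h
  define Y where "Y p = U p *\<^sub>R X p" for p
  \<comment> \<open>On the loops themselves the derivative is 0, in agreement with the vanishing of
    \<open>Y\<close> on \<open>upper\<close>.\<close>
  define Y' where "Y' p h = (if p \<in> off_loops then U p *\<^sub>R X' p h + (gradU p \<bullet> h) *\<^sub>R X p else 0)" for p h
  have dX: "(X has_derivative X' p) (at p)" if "p \<in> off_loops" for p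
    unfolding X_def[abs_def] X'_def[abs_def]
    by (rule bounded_bilinear.FDERIV[OF bounded_bilinear_cross3]) (use d1 d2 that in blast)+
  have cU: "continuous_on S U" for S
    using dU by (meson continuous_at_imp_continuous_on has_derivative_continuous)
  have cB: "continuous_on off_loops B1" "continuous_on off_loops B2"
    using d1 d2 by (meson continuous_at_imp_continuous_on has_derivative_continuous)+
  have cG: "continuous_on S gradU" for S using continuous_on_subset[OF continuous_gradU] by blast
  show ?thesis
  proof -
    obtain C1 where C1: "C1 \<ge> 0" "\<forall>y R. R > 0 \<longrightarrow> (\<forall>u. norm (loop1 u) \<le> R) \<longrightarrow> norm y \<ge> 2 * R \<longrightarrow> norm (B1 y) \<le> C1 / norm y ^ 2"
      using bs_decay[OF closed_curve_cv[of 0 "(1, 0)" "\<delta>/2"]] unfolding B1_def by metis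
    obtain C2 where C2: "C2 \<ge> 0" "\<forall>y R. R > 0 \<longrightarrow> (\<forall>u. norm (loop2 u) \<le> R) \<longrightarrow> norm y \<ge> 2 * R \<longrightarrow> norm (B2 y) \<le> C2 / norm y ^ 2"
      using bs_decay[OF closed_curve_cv[of 0 "(0, 1)" "\<delta>/2"]] unfolding B2_def by metis
    have "bounded (core \<union> range loop1 \<union> range loop2)"
      unfolding core_def
      by (intro bounded_Un[THEN iffD2] conjI compact_imp_bounded compact_\<Phi>_image closed_curve_compact[OF closed_curve_cv])
    then obtain \<rho> where \<rho>: "\<rho> > 0" "\<forall>x\<in>core \<union> range loop1 \<union> range loop2. norm x \<le> \<rho>"
      unfolding bounded_pos by blast
    show ?thesis
    \<comment> \<open>The core and the loops lie within distance \<open>\<rho>\<close> of the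
      origin. Beyond \<open>2 * \<rho>\<close> the decay of both fields is available, and the flux
      vanishes there.\<close>
    proof (rule divergence_integral_zero[where Y=Y and Y'=Y' and ?R0.0="2 * \<rho>" and C="M * (C1 * C2)"])
      fix p
      show "(Y has_derivative Y' p) (at p)"
      proof (cases "p \<in> off_loops")
        case True
        have "(Y has_derivative (\<lambda>h. U p *\<^sub>R X' p h + (gradU p \<bullet> h) *\<^sub>R X p)) (at p)"
          unfolding Y_def[abs_def] by (rule has_derivative_scaleR[OF dU[rule_format] dX[OF True]])
        then show ?thesis using True by (simp add: Y'_def[abs_def])
      next
        case False
        have "(Y has_derivative (\<lambda>h. 0)) (at p)"
          by (rule has_derivative_transform_within_open[OF has_derivative_const[of 0] upper cover[OF False]])
            (simp add: Y_def upper0)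
        then show ?thesis using False by (simp add: Y'_def[abs_def])
      qed
      show "flux p = Y' p (axis 1 1) $ 1 + Y' p (axis 2 1) $ 2 + Y' p (axis 3 1) $ 3"
      proof (cases "p \<in> off_loops")
        case True
        have t1: "X' p (axis 1 1) $ 1 + X' p (axis 2 1) $ 2 + X' p (axis 3 1) $ 3 = 0"
        proof -
          have "cross3 (B1 p) (B2' p (axis 1 1)) $ 1 + cross3 (B1 p) (B2' p (axis 2 1)) $ 2 + cross3 (B1 p) (B2' p (axis 3 1)) $ 3 = 0"
            by (rule symmetric_cross_trace) (use s2 True in blast)
          moreover have "cross3 (B2 p) (B1' p (axis 1 1)) $ 1 + cross3 (B2 p) (B1' p (axis 2 1)) $ 2 + cross3 (B2 p) (B1' p (axis 3 1)) $ 3 = 0"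
            by (rule symmetric_cross_trace) (use s1 True in blast)
          ultimately show ?thesis
            unfolding X'_def cross_skew[of "blinfun_apply (B1' p) _" "B2 p"] by simp
        qed
        have g: "gradU p \<bullet> axis i 1 = gradU p $ i" for i by (simp add: inner_axis)
        have "Y' p (axis 1 1) $ 1 + Y' p (axis 2 1) $ 2 + Y' p (axis 3 1) $ 3
          = U p * (X' p (axis 1 1) $ 1 + X' p (axis 2 1) $ 2 + X' p (axis 3 1) $ 3) + (gradU p $ 1 * X p $ 1 + gradU p $ 2 * X p $ 2 + gradU p $ 3 * X p $ 3)"
          using True by (simp add: Y'_def g algebra_simps)
        then show ?thesis unfolding t1 by (simp add: flux_def X_def inner_vec_def sum_3)
      next
        case False
        then show ?thesis using upper0(2)[OF cover[OF False]] by (simp add: flux_def Y'_def)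
      qed
      assume p: "norm p \<ge> 2 * \<rho>"
      then have "p \<notin> core" using \<rho> by force
      then show "flux p = 0" by (simp add: flux_def gradU_off_core)
      have "\<forall>u. norm (loop1 u) \<le> \<rho>" "\<forall>u. norm (loop2 u) \<le> \<rho>" using \<rho>(2) by blast+
      then have b: "norm (B1 p) \<le> C1 / norm p ^ 2" "norm (B2 p) \<le> C2 / norm p ^ 2"
        using C1(2) C2(2) \<rho>(1) p by blast+
      have "norm (Y p) \<le> M * (norm (B1 p) * norm (B2 p))"
        unfolding Y_def X_def norm_scaleR real_norm_def
        using M norm_cross3_le by (intro mult_mono) (auto intro: order_trans[OF abs_ge_zero])
      also have "\<dots> \<le> M * ((C1 / norm p ^ 2) * (C2 / norm p ^ 2))"
        using M b order_trans[OF abs_ge_zero M[rule_format, of 0]] C1(1)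
        by (intro mult_left_mono mult_mono) auto
      also have "\<dots> = M * (C1 * C2) / norm p ^ 4" by (simp add: power_numeral_reduce)
      finally show "norm (Y p) \<le> M * (C1 * C2) / norm p ^ 4" .
    next
      fix h
      have "continuous_on off_loops (\<lambda>p. Y' p h)"
      proof (rule continuous_on_eq)
        show "continuous_on off_loops (\<lambda>p. U p *\<^sub>R X' p h + (gradU p \<bullet> h) *\<^sub>R X p)"
          unfolding X_def X'_def
          by (intro continuous_intros continuous_on_cross3 cU cB cG
              bounded_bilinear.continuous_on[OF bounded_bilinear_blinfun_apply] c1 c2)
      qed (simp add: Y'_def)
      moreover have "continuous_on upper (\<lambda>p. Y' p h)"
        by (rule continuous_on_eq[OF continuous_on_const[of _ 0]]) (simp add: Y'_def upper0)
      ultimately have "continuous_on (off_loops \<union> upper) (\<lambda>p. Y' p h)"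
        using open_off_loops upper by (intro continuous_on_open_Un)
      moreover have "off_loops \<union> upper = UNIV" using cover by blast
      ultimately show "continuous_on UNIV (\<lambda>p. Y' p h)" by simp
    next
      show "2 * \<rho> > 0" using \<rho>(1) by simp
      show "M * (C1 * C2) \<ge> 0" using order_trans[OF abs_ge_zero M[rule_format, of 0]] C1(1) C2(1) by simp
    qed
  qed
qed

section \<open>Change of variables from space to the collar\<close>

definition to_slab :: "real^3 \<Rightarrow> (real \<times> real) \<times> real" where "to_slab v = ((v$1, v$2), v$3)"
text \<open>A half-open fundamental domain: every point of \<open>nbhd\<close> is hit exactly
  once.\<close>

definition cell :: "(real^3) set" where "cell = {v. v$1 \<in> {0..<1} \<and> v$2 \<in> {0..<1} \<and> v$3 \<in> {-\<delta><..<\<delta>}}"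

lemma to_slab_linear: "bounded_linear to_slab"
proof -
  have "linear to_slab" by (rule linearI) (auto simp: to_slab_def)
  then show ?thesis using linear_conv_bounded_linear by blast
qed

lemma cell_measurable: "cell \<in> sets lebesgue"
proof -
  have "cell = ({v. 0 \<le> v$1} \<inter> {v. v$1 < 1}) \<inter> (({v. 0 \<le> v$2} \<inter> {v. v$2 < 1}) \<inter> ({v. -\<delta> < v$3} \<inter> {v. v$3 < \<delta>}))"
    by (auto simp: cell_def)
  moreover have "closed {v::real^3. c \<le> v$i}" for c i by (intro closed_Collect_le continuous_intros)
  moreover have "open {v::real^3. v$i < c}" "open {v::real^3. c < v$i}" for c i by (intro open_Collect_less continuous_intros)+
  ultimately show ?thesis
    by (auto intro!: sets_completionI_sets sets.Int borel_closed borel_open)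
qed

lemma \<Phi>_cell_inj: "inj_on (\<lambda>v. \<Phi> (to_slab v)) cell"
proof (rule inj_onI)
  fix v w assume v: "v \<in> cell" and w: "w \<in> cell" and eq: "\<Phi> (to_slab v) = \<Phi> (to_slab w)"
  have 1: "v$1 - w$1 \<in> \<int> \<and> v$2 - w$2 \<in> \<int> \<and> v$3 = w$3"
    using eq unfolding to_slab_def by (intro \<Phi>_inj) (use v w in \<open>auto simp: cell_def\<close>)
  have half: "w = 0" if w: "w \<in> \<int>" "\<bar>w\<bar> < 1" for w :: real
  proof -
    obtain k :: int where k: "w = of_int k" by (rule Ints_cases[OF w(1)])
    with w(2) have "\<bar>k\<bar> < 1" by linarith
    then show ?thesis using k by simp
  qed
  have "\<bar>v$1 - w$1\<bar> < 1" "\<bar>v$2 - w$2\<bar> < 1"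
    using v w unfolding cell_def mem_Collect_eq atLeastLessThan_iff abs_less_iff by linarith+
  then show "v = w" using 1 half[of "v$1 - w$1"] half[of "v$2 - w$2"] by (simp add: vec_eq_iff forall_3)
qed

lemma \<Phi>_cell_image: "(\<lambda>v. \<Phi> (to_slab v)) ` cell = nbhd"
proof
  show "(\<lambda>v. \<Phi> (to_slab v)) ` cell \<subseteq> nbhd"
    by (auto simp: cell_def nbhd_def slab_def to_slab_def)
  show "nbhd \<subseteq> (\<lambda>v. \<Phi> (to_slab v)) ` cell"
  proof
    fix y assume "y \<in> nbhd"
    then obtain s t r where y: "y = \<Phi> ((s, t), r)" "-\<delta> < r" "r < \<delta>" by (auto simp: nbhd_def slab_def)
    have "v3 (frac s) (frac t) r \<in> cell" using y by (simp add: cell_def frac_lt_1)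
    moreover have "\<Phi> (to_slab (v3 (frac s) (frac t) r)) = y" using y \<Phi>_frac[of s t r] by (simp add: to_slab_def)
    ultimately show "y \<in> (\<lambda>v. \<Phi> (to_slab v)) ` cell" by force
  qed
qed

lemma det_Jac: "det (matrix (\<lambda>h. D z (to_slab h))) = Jac z"
proof -
  have "to_slab (axis 1 1) = ((1, 0), 0)" "to_slab (axis 2 1) = ((0, 1), 0)" "to_slab (axis 3 1) = ((0, 0), 1)"
    by (simp_all add: to_slab_def axis_def)
  then show ?thesis
    by (simp add: det_3 matrix_def Jac_def D_r cross3_def inner_vec_def sum_3 vector_3 algebra_simps)
qed

definition wedge :: "real \<Rightarrow> real \<Rightarrow> real \<Rightarrow> real" where
  "wedge s t r = (B1 (\<Phi> ((s, t), r)) \<bullet> \<Phi>s ((s, t), r)) * (B2 (\<Phi> ((s, t), r)) \<bullet> \<Phi>t ((s, t), r))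
    - (B1 (\<Phi> ((s, t), r)) \<bullet> \<Phi>t ((s, t), r)) * (B2 (\<Phi> ((s, t), r)) \<bullet> \<Phi>s ((s, t), r))"

text \<open>\<open>Jac z\<close> times the normal is the cross product of the tangent vectors, and
  by the Binet-Cauchy identity its product with the cross product of the fields is the coefficient
  of the wedge of the two pulled-back forms.\<close>

lemma Jac_flux:
  assumes "z \<in> slab"
  shows "Jac z * flux (\<Phi> z) = bump (snd z) / ramp 0 * wedge (fst (fst z)) (snd (fst z)) (snd z)"
proof -
  have "Jac z * flux (\<Phi> z) = bump (snd z) / ramp 0 * ((Jac z *\<^sub>R nrm (fst z)) \<bullet> cross3 (B1 (\<Phi> z)) (B2 (\<Phi> z)))"
    by (simp add: flux_def gradU_\<Phi>[OF assms])
  also have "(Jac z *\<^sub>R nrm (fst z)) \<bullet> cross3 (B1 (\<Phi> z)) (B2 (\<Phi> z)) = cross3 (\<Phi>s z) (\<Phi>t z) \<bullet> cross3 (B1 (\<Phi> z)) (B2 (\<Phi> z))"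
    by (simp only: cross_Jac)
  also have "\<dots> = wedge (fst (fst z)) (snd (fst z)) (snd z)"
    unfolding wedge_def prod.collapse dot_cross by (simp add: inner_commute mult.commute)
  finally show ?thesis .
qed

lemma cell_integral: "((\<lambda>v. Jac (to_slab v) * flux (\<Phi> (to_slab v))) has_integral 0) cell"
proof -
  \<comment> \<open>The change of variables is carried out for an integrand with values in
    \<open>real^1\<close>; its only component is read off afterwards.\<close>
  define F where "F y = flux y *\<^sub>R (vec 1 :: real^1)" for y
  have cflux: "continuous_on UNIV flux"
  proof -
    have "continuous_on off_loops flux"
    proof -
      from fields obtain B1' B2' :: "real^3 \<Rightarrow> (real^3) \<Rightarrow>\<^sub>L (real^3)" where
        d1: "\<forall>y\<in>off_loops. (B1 has_derivative blinfun_apply (B1' y)) (at y)" and d2: "\<forall>y\<in>off_loops. (B2 has_derivative blinfun_apply (B2' y)) (at y)"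
        by (elim exE conjE) (rule that)
      have "continuous_on off_loops B1" "continuous_on off_loops B2"
        using d1 d2 by (meson continuous_at_imp_continuous_on has_derivative_continuous)+
      then show ?thesis
        unfolding flux_def by (intro continuous_intros continuous_on_cross3 continuous_on_subset[OF continuous_gradU]) auto
    qed
    moreover have "continuous_on (- core) flux"
      by (rule continuous_on_eq[OF continuous_on_const[of _ 0]]) (simp add: flux_def gradU_off_core)
    ultimately have "continuous_on (off_loops \<union> - core) flux"
      using open_off_loops closed_core by (intro continuous_on_open_Un) auto
    moreover have "core \<subseteq> off_loops"
    proof
      fix y assume "y \<in> core"
      then obtain x r where "y = \<Phi> (x, r)" "-\<delta>/2 \<le> r" "r \<le> 0" unfolding core_def by auto
      then show "y \<in> off_loops" using \<Phi>_off_loops[of r x] \<delta>_pos by simp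
    qed
    then have "off_loops \<union> - core = UNIV" by auto
    ultimately show ?thesis by simp
  qed
  have "bounded nbhd"
  proof (rule bounded_subset)
    show "bounded (\<Phi> ` (UNIV \<times> {-\<delta>..\<delta>}))" by (rule compact_imp_bounded[OF compact_\<Phi>_image])
    show "nbhd \<subseteq> \<Phi> ` (UNIV \<times> {-\<delta>..\<delta>})" unfolding nbhd_def slab_def by (intro image_mono) auto
  qed
  then obtain a where a: "nbhd \<subseteq> cbox (- a) a" using bounded_subset_cbox_symmetric by blast
  have "F absolutely_integrable_on cbox (- a) a"
    unfolding F_def by (intro absolutely_integrable_continuous continuous_intros continuous_on_subset[OF cflux]) auto
  then have absF: "F absolutely_integrable_on nbhd"
    by (rule set_integrable_subset) (use a open_nbhd in auto)
  have off: "flux y = 0" if "y \<notin> nbhd" for y using that by (simp add: flux_def gradU_def)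
  have "((\<lambda>y. if y \<in> nbhd then flux y else 0) has_integral 0) UNIV"
    using flux_integral by (rule has_integral_eq[rotated]) (simp add: off)
  then have "(flux has_integral 0) nbhd" by (simp only: has_integral_restrict_UNIV)
  from has_integral_scaleR_left[OF this, of "vec 1 :: real^1"]
  have "integral nbhd F = 0" unfolding F_def by (simp add: integral_unique)
  with absF have "(\<lambda>v. \<bar>det (matrix (\<lambda>h. D (to_slab v) (to_slab h)))\<bar> *\<^sub>R F (\<Phi> (to_slab v))) absolutely_integrable_on cell \<and>
      integral cell (\<lambda>v. \<bar>det (matrix (\<lambda>h. D (to_slab v) (to_slab h)))\<bar> *\<^sub>R F (\<Phi> (to_slab v))) = 0"
    using has_absolute_integral_change_of_variables[where g="\<lambda>v. \<Phi> (to_slab v)" and g'="\<lambda>v h. D (to_slab v) (to_slab h)" and S=cell and f=F and b=0,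
        OF cell_measurable _ \<Phi>_cell_inj] has_derivative_compose[OF bounded_linear_imp_has_derivative[OF to_slab_linear] D_has_derivative]
    unfolding \<Phi>_cell_image by blast
  then have ai: "(\<lambda>v. \<bar>Jac (to_slab v)\<bar> *\<^sub>R F (\<Phi> (to_slab v))) absolutely_integrable_on cell"
    and i0: "integral cell (\<lambda>v. \<bar>Jac (to_slab v)\<bar> *\<^sub>R F (\<Phi> (to_slab v))) = 0"
    unfolding det_Jac by blast+
  have "((\<lambda>v. \<bar>Jac (to_slab v)\<bar> *\<^sub>R F (\<Phi> (to_slab v))) has_integral 0) cell"
    using integrable_integral[OF set_lebesgue_integral_eq_integral(1)[OF ai]] unfolding i0 .
  from has_integral_linear[OF this bounded_linear_vec_nth[of 1]]
  have "((\<lambda>v. \<bar>Jac (to_slab v)\<bar> * flux (\<Phi> (to_slab v))) has_integral 0) cell"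
    by (simp add: o_def F_def)
  then show ?thesis
  proof (rule has_integral_eq[rotated])
    fix v assume "v \<in> cell"
    then have "Jac (to_slab v) > 0" unfolding to_slab_def by (intro Jac_pos) (auto simp: cell_def)
    then show "\<bar>Jac (to_slab v)\<bar> * flux (\<Phi> (to_slab v)) = Jac (to_slab v) * flux (\<Phi> (to_slab v))" by simp
  qed
qed

text \<open>By \<open>wedge_period\<close> each level contributes the same determinant of periods,
  and the weights \<open>bump r / ramp 0\<close> have integral 1. So the total flux equals that
  determinant, and it is 0.\<close>

lemma lnk_det: "lnk (1, 0) (1, 0) * lnk (0, 1) (0, 1) = lnk (1, 0) (0, 1) * lnk (0, 1) (1, 0)"
proof -
  have bnds: "\<bar>\<delta>/2\<bar> < \<delta>" "-\<delta> \<le> -\<delta>" "\<delta>/2 \<le> \<delta>" "\<delta>/2 \<le> \<delta>/2 \<or> \<delta>/2 \<le> -\<delta>" using \<delta>_pos by auto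
  from cv_potential[OF bnds, of 0 "(1, 0)"] obtain a1 b1 p1 where p1: "torus_potential B1 \<Phi> (-\<delta>) (\<delta>/2) a1 b1 p1"
    and l1: "\<forall>y d \<sigma>. -\<delta> < \<sigma> \<and> \<sigma> < \<delta>/2 \<longrightarrow> linking_number loop1 (cv y d \<sigma>) = (of_int (fst d) * a1 + of_int (snd d) * b1) / (4 * pi)"
    unfolding B1_def[symmetric] by (elim exE conjE) (rule that)
  from cv_potential[OF bnds, of 0 "(0, 1)"] obtain a2 b2 p2 where p2: "torus_potential B2 \<Phi> (-\<delta>) (\<delta>/2) a2 b2 p2"
    and l2: "\<forall>y d \<sigma>. -\<delta> < \<sigma> \<and> \<sigma> < \<delta>/2 \<longrightarrow> linking_number loop2 (cv y d \<sigma>) = (of_int (fst d) * a2 + of_int (snd d) * b2) / (4 * pi)"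
    unfolding B2_def[symmetric] by (elim exE conjE) (rule that)
  have ab: "lnk (1, 0) (1, 0) = a1 / (4 * pi)" "lnk (1, 0) (0, 1) = b1 / (4 * pi)"
    "lnk (0, 1) (1, 0) = a2 / (4 * pi)" "lnk (0, 1) (0, 1) = b2 / (4 * pi)"
    using l1[rule_format, of 0] l2[rule_format, of 0] \<delta>_pos by (simp_all add: lnk_def)
  from fields obtain B1' B2' :: "real^3 \<Rightarrow> (real^3) \<Rightarrow>\<^sub>L (real^3)" where
    d1: "\<forall>y\<in>off_loops. (B1 has_derivative blinfun_apply (B1' y)) (at y)" and d2: "\<forall>y\<in>off_loops. (B2 has_derivative blinfun_apply (B2' y)) (at y)"
    and c1: "continuous_on off_loops B1'" and c2: "continuous_on off_loops B2'"
    and s1: "\<forall>y\<in>off_loops. \<forall>a b. B1' y a \<bullet> b = B1' y b \<bullet> a" and s2: "\<forall>y\<in>off_loops. \<forall>a b. B2' y a \<bullet> b = B2' y b \<bullet> a"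
    by (elim exE conjE) (rule that)
  have cB: "continuous_on off_loops B1" "continuous_on off_loops B2"
    using d1 d2 by (meson continuous_at_imp_continuous_on has_derivative_continuous)+
  have wp: "integral {0..1} (\<lambda>s. integral {0..1} (\<lambda>t. wedge s t r)) = a1 * b2 - b1 * a2" if "-\<delta> < r" "r < \<delta>/2" for r
    unfolding wedge_def by (rule wedge_period[OF p1 p2 that cB(1) d2 c2 s2]) (rule \<Phi>_off_loops[OF that])
  define q where "q s t r = bump r / ramp 0 * wedge s t r" for s t r
  let ?R = "{-\<delta>/2..0}"
  let ?C = "cbox (v3 0 0 (-\<delta>/2)) (v3 1 1 0)"
  have cq: "continuous_on S (\<lambda>p. q (s p) (t p) (r p))"
    if "continuous_on S s" "continuous_on S t" "continuous_on S r" "\<And>p. p \<in> S \<Longrightarrow> r p \<in> ?R" for S :: "'b::topological_space set" and s t r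
  proof -
    have pair: "continuous_on S (\<lambda>p. ((s p, t p), r p))" by (intro continuous_intros that)
    have off: "(\<lambda>p. \<Phi> ((s p, t p), r p)) ` S \<subseteq> off_loops"
    proof (rule image_subsetI)
      fix p assume "p \<in> S"
      from that(4)[OF this] show "\<Phi> ((s p, t p), r p) \<in> off_loops" using \<delta>_pos by (intro \<Phi>_off_loops) auto
    qed
    show ?thesis
      unfolding q_def wedge_def
      by (intro continuous_on_mult continuous_on_divide continuous_on_diff continuous_on_inner continuous_on_const continuous_on_D[OF pair]
          continuous_on_compose2[OF cB(1) continuous_on_\<Phi>[OF pair] off] continuous_on_compose2[OF cB(2) continuous_on_\<Phi>[OF pair] off]
          continuous_on_compose2[OF bump_continuous[of UNIV] that(3)])
        (use ramp_pos in auto)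
  qed
  \<comment> \<open>The half-open cell is exchanged for the closed box \<open>?C\<close>: the faces
    at 1 are negligible, and the tent vanishes at all heights outside \<open>?R\<close>.\<close>
  have "((\<lambda>v. if v \<in> ?C then q (v$1) (v$2) (v$3) else 0) has_integral 0) UNIV"
  proof (rule has_integral_spike)
    show "negligible ({v::real^3. v$1 = 1} \<union> {v. v$2 = 1})"
    proof -
      have "negligible {v::real^3. v$i = 1}" for i
        using negligible_standard_hyperplane[of "axis i (1::real) :: real^3" 1] by (simp add: inner_axis axis_in_Basis_iff)
      then show ?thesis by (intro negligible_Un)
    qed
    show "((\<lambda>v. if v \<in> cell then Jac (to_slab v) * flux (\<Phi> (to_slab v)) else 0) has_integral 0) UNIV"
      using cell_integral by (simp only: has_integral_restrict_UNIV)
    fix v :: "real^3" assume v: "v \<in> UNIV - ({v. v$1 = 1} \<union> {v. v$2 = 1})"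
    have C: "v \<in> ?C \<longleftrightarrow> v$1 \<in> {0..1} \<and> v$2 \<in> {0..1} \<and> v$3 \<in> ?R" by (auto simp: mem_box_cart forall_3)
    show "(if v \<in> ?C then q (v$1) (v$2) (v$3) else 0) = (if v \<in> cell then Jac (to_slab v) * flux (\<Phi> (to_slab v)) else 0)"
    proof (cases "v \<in> cell")
      case True
      then have "to_slab v \<in> slab" by (auto simp: cell_def slab_def to_slab_def)
      then have eq: "Jac (to_slab v) * flux (\<Phi> (to_slab v)) = q (v$1) (v$2) (v$3)"
        by (simp add: Jac_flux q_def) (simp add: to_slab_def)
      have "q (v$1) (v$2) (v$3) = 0" if "v \<notin> ?C"
      proof -
        have "v$3 \<le> -\<delta>/2 \<or> 0 \<le> v$3" using that True unfolding C by (auto simp: cell_def)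
        then show ?thesis using bump_0 by (simp add: q_def)
      qed
      then show ?thesis using True eq by simp
    next
      case False
      then have "v \<notin> ?C" using v \<delta>_pos unfolding C by (auto simp: cell_def)
      then show ?thesis using False by simp
    qed
  qed
  then have "((\<lambda>v. q (v$1) (v$2) (v$3)) has_integral 0) ?C" by (simp only: has_integral_restrict_UNIV)
  then have "0 = integral ?C (\<lambda>v. q (v$1) (v$2) (v$3))" by (simp add: integral_unique)
  also have "\<dots> = integral {0..1} (\<lambda>s. integral {0..1} (\<lambda>t. integral ?R (\<lambda>r. q s t r)))"
  proof -
    have "continuous_on ?C (\<lambda>v. q (v$1) (v$2) (v$3))"
      by (rule cq) (auto intro!: continuous_intros simp: mem_box_cart forall_3)
    from integral_vec3[OF this] show ?thesis by simp
  qed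
  \<comment> \<open>Two cyclic rotations of the variables make the height \<open>r\<close> the
    outermost one.\<close>
  also have "\<dots> = integral {0..1} (\<lambda>t. integral ?R (\<lambda>r. integral {0..1} (\<lambda>s. q s t r)))"
  proof -
    have "continuous_on (cbox 0 1 \<times> cbox 0 1 \<times> cbox (-\<delta>/2) 0) (\<lambda>(s, t, r). q s t r)"
      unfolding case_prod_beta by (rule cq) (auto intro!: continuous_intros)
    from integral_triple_swap(2)[OF this] show ?thesis by simp
  qed
  also have "\<dots> = integral ?R (\<lambda>r. integral {0..1} (\<lambda>s. integral {0..1} (\<lambda>t. q s t r)))"
  proof -
    have "continuous_on (cbox 0 1 \<times> cbox (-\<delta>/2) 0 \<times> cbox 0 1) (\<lambda>(t, r, s). q s t r)"
      unfolding case_prod_beta by (rule cq) (auto intro!: continuous_intros)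
    from integral_triple_swap(2)[OF this] show ?thesis by simp
  qed
  also have "\<dots> = integral ?R (\<lambda>r. bump r / ramp 0 * (a1 * b2 - b1 * a2))"
  proof (rule integral_cong)
    fix r assume r: "r \<in> ?R"
    have "integral {0..1} (\<lambda>s. integral {0..1} (\<lambda>t. q s t r)) = bump r / ramp 0 * integral {0..1} (\<lambda>s. integral {0..1} (\<lambda>t. wedge s t r))"
      unfolding q_def by simp
    also have "integral {0..1} (\<lambda>s. integral {0..1} (\<lambda>t. wedge s t r)) = a1 * b2 - b1 * a2"
      by (rule wp) (use r \<delta>_pos in auto)
    finally show "integral {0..1} (\<lambda>s. integral {0..1} (\<lambda>t. q s t r)) = bump r / ramp 0 * (a1 * b2 - b1 * a2)" .
  qed
  also have "\<dots> = integral ?R bump / ramp 0 * (a1 * b2 - b1 * a2)" by simp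
  also have "integral ?R bump = ramp 0"
    using ramp_split[of "-\<delta>/2" 0] ramp_low[of "-\<delta>/2"] \<delta>_pos by simp
  finally have "a1 * b2 - b1 * a2 = 0" using ramp_pos by simp
  then show ?thesis unfolding ab by simp
qed

lemma lnk_integer: "lnk b c \<in> \<int>"
  unfolding lnk_def
  by (rule linking_number_integer[OF closed_curve_cv closed_curve_cv cv_disjoint]) (use \<delta>_pos in auto)

end

section \<open>Integral matrices of rank one, and the conclusion\<close>

lemma rank_one_factorisation:
  fixes a b c d :: int
  assumes det: "a * d = b * c" and skew: "b - c = 1"
  obtains \<alpha> \<beta> \<gamma> \<omega> :: int where "a = \<alpha> * \<gamma>" "b = \<alpha> * \<omega>" "c = \<beta> * \<gamma>" "d = \<beta> * \<omega>" "\<alpha> * \<omega> - \<beta> * \<gamma> = 1"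
proof (cases "gcd a c = 0")
  case True
  then have "a = 0" "c = 0" by auto
  with skew show thesis by (intro that[of 1 0 1 d]) auto
next
  case False
  \<comment> \<open>The column is the first column of the matrix divided by its greatest common
    divisor; being primitive, it divides the second column with an integral quotient
    \<open>w\<close>. The row is \<open>(gcd a c, w)\<close>, and \<open>skew\<close> becomes the
    determinant condition.\<close>
  then obtain a' c' where ac: "a = a' * gcd a c" "c = c' * gcd a c" "coprime a' c'"
    using gcd_coprime_exists by blast
  define g where "g = gcd a c"
  have g: "g \<noteq> 0" "a = a' * g" "c = c' * g" using False ac by (simp_all add: g_def)
  have "g * (a' * d) = g * (b * c')" using det g by (simp add: algebra_simps)
  then have eq: "a' * d = b * c'" using g(1) by simp
  then have "a' dvd b" using ac(3) by (metis dvd_triv_left coprime_dvd_mult_left_iff)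
  then obtain w where w: "b = a' * w" by auto
  show thesis
  proof (cases "a' = 0")
    \<comment> \<open>Here \<open>a'\<close> cannot be cancelled from \<open>eq\<close>. As
      \<open>b = 0\<close> forces \<open>c = - 1\<close>, the column \<open>(0, 1)\<close> and the
      row \<open>(- 1, d)\<close> do.\<close>
    case True
    then have "a = 0" "b = 0" using g w by simp_all
    then show thesis using skew by (intro that[of 0 "- 1" d 1]) auto
  next
    case False
    with eq w have "d = w * c'" by simp
    then show thesis using g w skew by (intro that[of a' g w c']) (auto simp: algebra_simps)
  qed
qed

theorem theorem4:
  fixes f :: "real \<times> real \<Rightarrow> real^3"
  assumes "torus_smooth_embedding f"
  shows "\<exists>(p :: int \<times> int) (q :: int \<times> int) (\<epsilon> :: int).
           (fst p * snd q - snd p * fst q = 1 \<or> fst p * snd q - snd p * fst q = -1) \<and>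
           (\<epsilon> = 1 \<or> \<epsilon> = -1) \<and>
           (\<forall>x1 y1 x2 y2 :: int.
              \<forall>\<^sub>F eps in at_right 0.
                seifert_lk f eps (x1 * fst p + y1 * fst q, x1 * snd p + y1 * snd q)
                                 (x2 * fst p + y2 * fst q, x2 * snd p + y2 * snd q)
                = of_int (\<epsilon> * x1 * y2))"
proof -
  interpret embedded_torus f using assms by unfold_locales
  obtain \<delta> where "tube \<delta>" using tube_exists by blast
  then interpret torus_collar f \<delta> by unfold_locales
  obtain a b c d :: int where m: "lnk (1, 0) (1, 0) = of_int a" "lnk (1, 0) (0, 1) = of_int b"
      "lnk (0, 1) (1, 0) = of_int c" "lnk (0, 1) (0, 1) = of_int d"
    using lnk_integer by (metis Ints_cases)
  have "real_of_int (a * d) = of_int (b * c)" "real_of_int (b - c) = of_int 1"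
    using lnk_det lnk_jump unfolding m by simp_all
  then have "a * d = b * c" "b - c = 1" by (simp_all only: of_int_eq_iff)
  then obtain \<alpha> \<beta> \<gamma> \<omega> where fac: "a = \<alpha> * \<gamma>" "b = \<alpha> * \<omega>" "c = \<beta> * \<gamma>" "d = \<beta> * \<omega>" and one: "\<alpha> * \<omega> - \<beta> * \<gamma> = 1"
    using rank_one_factorisation by blast
  \<comment> \<open>A product of two linear functionals: \<open>(\<alpha>, \<beta>)\<close> acts on
    the upper class, \<open>(\<gamma>, \<omega>)\<close> on the lower one.\<close>
  have form: "lnk u v = of_int ((fst u * \<alpha> + snd u * \<beta>) * (\<gamma> * fst v + \<omega> * snd v))" for u v
  proof -
    have "lnk u v = of_int (fst u) * (of_int (fst v) * of_int a + of_int (snd v) * of_int b)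
        + of_int (snd u) * (of_int (fst v) * of_int c + of_int (snd v) * of_int d)"
      using lnk_linear_left[of u v] lnk_linear_right[of "(1, 0)" v] lnk_linear_right[of "(0, 1)" v] unfolding m by simp
    then show ?thesis by (simp add: fac algebra_simps)
  qed
  have "\<forall>\<^sub>F eps in at_right 0. 0 < eps \<and> eps < \<delta>"
    using \<delta>_pos unfolding eventually_at_right_field by auto
  \<comment> \<open>The basis consists of a kernel vector of each functional:
    \<open>(\<beta>, - \<alpha>)\<close> for the upper and \<open>(\<omega>, - \<gamma>)\<close> for
    the lower. On the other basis vector the upper functional is 1 and the lower one is -1. As the
    second argument of \<open>seifert_lk\<close> is the upper class, this leaves
    \<open>- x1 * y2\<close>, with the one threshold \<open>\<delta>\<close> for all pairs of
    classes.\<close>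
  then have "\<forall>\<^sub>F eps in at_right 0.
      seifert_lk f eps (x1 * \<beta> + y1 * \<omega>, x1 * - \<alpha> + y1 * - \<gamma>) (x2 * \<beta> + y2 * \<omega>, x2 * - \<alpha> + y2 * - \<gamma>)
      = of_int (-1 * x1 * y2)" for x1 y1 x2 y2
  proof eventually_elim
    case (elim eps)
    have k: "(x2 * \<beta> + y2 * \<omega>) * \<alpha> + (x2 * - \<alpha> + y2 * - \<gamma>) * \<beta> = y2 * (\<alpha> * \<omega> - \<beta> * \<gamma>)"
      "\<gamma> * (x1 * \<beta> + y1 * \<omega>) + \<omega> * (x1 * - \<alpha> + y1 * - \<gamma>) = - x1 * (\<alpha> * \<omega> - \<beta> * \<gamma>)"
      by algebra+
    have "seifert_lk f eps (x1 * \<beta> + y1 * \<omega>, x1 * - \<alpha> + y1 * - \<gamma>) (x2 * \<beta> + y2 * \<omega>, x2 * - \<alpha> + y2 * - \<gamma>)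
      = lnk (x2 * \<beta> + y2 * \<omega>, x2 * - \<alpha> + y2 * - \<gamma>) (x1 * \<beta> + y1 * \<omega>, x1 * - \<alpha> + y1 * - \<gamma>)"
      by (rule seifert_lk_eq) (use elim in auto)
    then show ?case
      unfolding form fst_conv snd_conv k one by (simp add: mult.commute)
  qed
  moreover have "fst (\<beta>, - \<alpha>) * snd (\<omega>, - \<gamma>) - snd (\<beta>, - \<alpha>) * fst (\<omega>, - \<gamma>) = 1"
    using one by (simp add: algebra_simps)
  ultimately show ?thesis
    by (intro exI[of _ "(\<beta>, - \<alpha>)"] exI[of _ "(\<omega>, - \<gamma>)"] exI[of _ "- 1"]) simp
qed

end
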